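(* Suppose that $\Gamma$ is a sofic (respectively $\mathbb{K}$-linear sofic, for a field $\mathbb{K}$; hyperlinear; weakly sofic) group and that $\Gamma\curvearrowright_{\alpha}X$ is a sofic action on the set $X$. Then the symmetric enrichment $\mathcal{S}(\Gamma,X)$ and the alternating enrichment $\mathcal{A}(\Gamma,X)$ are sofic (respectively $\mathbb{K}$-linear sofic; hyperlinear; weakly sofic) groups.
   Context: Enrichments. For a set $X$, $\operatorname{Sym}_f(X)$ is the group of finitely supported permutations of $X$ and $\operatorname{Alt}_f(X)$ its subgroup of even permutations. An action $\Gamma\curvearrowright_\alpha X$ induces $\hat\alpha(g):\sigma\mapsto\alpha(g)\sigma\alpha(g)^{-1}$ on $\operatorname{Sym}_f(X)$, preserving $\operatorname{Alt}_f(X)$. Then $\mathcal{S}(\Gamma,X)=\operatorname{Sym}_f(X)\rtimes_{\hat\alpha}\Gamma$ and $\mathcal{A}(\Gamma,X)=\operatorname{Alt}_f(X)\rtimes_{\hat\alpha}\Gamma$. Metric approximation. For a group $\Gamma$, a group $G$ with bounded bi-invariant metric $d$, a function $\varphi:\Gamma\to G$, finite $F\subseteq\Gamma$ and $\epsilon,c>0$: $\varphi$ is $(F,\epsilon)$-multiplicative if $d(\varphi(gh),\varphi(g)\varphi(h))<\epsilon$ for all $g,h\in F$ with $gh\in F$; $(F,c)$-separating if $d(\varphi(g),e_G)>c$ for all $e\neq g\in F$; unital if $\varphi(e_\Gamma)=e_G$. Given a family $\mathcal{G}$ of groups with bi-invariant metrics of uniformly bounded diameter, $\Gamma$ is $\mathcal{G}$-approximable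 if there is $c>0$ such that for all finite $F\subseteq\Gamma$ and $\epsilon>0$ there is a unital, $(F,\epsilon)$-multiplicative, $(F,c)$-separating function from $\Gamma$ to some member of $\mathcal{G}$. Then $\Gamma$ is: sofic if $\mathcal{G}=\{(\operatorname{Sym}(n),d_n):n\in\mathbb{N}\}$ with $d_n$ the normalized Hamming metric; $\mathbb{K}$-linear sofic if $\mathcal{G}=\{GL_n(\mathbb{K}):n\in\mathbb{N}\}$ with metric $\frac1n\operatorname{rk}(M-N)$; hyperlinear if $\mathcal{G}=\{U(n):n\in\mathbb{N}\}$ (unitary groups) with metric $\sqrt{\frac1n\operatorname{Tr}((A-B)(A-B)^* )}$; weakly sofic if $\mathcal{G}$ is the family of all finite groups equipped with bi-invariant metrics of diameter one. The normalized Hamming metric on $\operatorname{Sym}(A)$, $A$ finite, is $d_A(\sigma,\tau)=1-\frac{1}{|A|}|\{a\in A:\sigma(a)=\tau(a)\}|$. Sofic actions on sets. Given $\Gamma\curvearrowright_\alpha X$, finite $F\subseteq\Gamma$, $E\subseteq X$, and $\epsilon>0$, a function $\varphi:\Gamma\to\operatorname{Sym}(A)$ ($A$ finite) is an $(F,E,\epsilon)$-orbit approximation of $\alpha$ if there exist a finite set $B$, $S\subseteq A$ with $|S|>(1-\epsilon)|A|$, and injective functions $(\pi_s:E\hookrightarrow B)_{s\in S}$ such that for all $g\in F$, $x\in E$, $s\in S$, if $\varphi(g)\cdot s\in S$ and $\alpha(g)^{-1}\cdot x\in E$ then $\pi_{\varphi(g)\cdot s}(x)=\pi_s(\alpha(g)^{-1}\cdot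 x)$. The action $\alpha$ is sofic if for all such $F,E,\epsilon$ there exist a finite set $A$ and a unital $(F,\epsilon)$-multiplicative (with respect to $d_A$) $(F,E,\epsilon)$-orbit approximation $\varphi:\Gamma\to\operatorname{Sym}(A)$ of $\alpha$. *)

theory Defs
  imports
    "HOL-Algebra.Group_Action"
    "HOL-Algebra.Sym_Groups"
    "HOL-Analysis.Abstract_Metric_Spaces"
    "Jordan_Normal_Form.DL_Rank"
    "Jordan_Normal_Form.Schur_Decomposition"
begin

section \<open>Symmetric and alternating enrichments\<close>

text \<open>
  Elements of \<open>BijGroup X\<close>, the values of a HOL-Algebra \<open>group_action\<close>, are \<open>undefined\<close> off \<open>X\<close>,
  whereas \<open>permutes\<close> and \<open>evenperm\<close> refer to functions that are the identity off \<open>X\<close>. The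
  function \<open>perm_of X\<close> translates from the former convention to the latter.
\<close>

definition perm_of :: "'x set \<Rightarrow> ('x \<Rightarrow> 'x) \<Rightarrow> 'x \<Rightarrow> 'x" where
  "perm_of X f = (\<lambda>x. if x \<in> X then f x else x)"

definition sym_on :: "'x set \<Rightarrow> ('x \<Rightarrow> 'x) monoid" where
  "sym_on X = \<lparr>carrier = {p. p permutes X}, Group.monoid.mult = (\<circ>), one = id\<rparr>"

definition fin_sym :: "'x set \<Rightarrow> ('x \<Rightarrow> 'x) monoid" where
  "fin_sym X = (sym_on X)\<lparr>carrier := {p. p permutes X \<and> finite {x. p x \<noteq> x}}\<rparr>"

definition fin_alt :: "'x set \<Rightarrow> ('x \<Rightarrow> 'x) monoid" where
  "fin_alt X = (sym_on X)\<lparr>carrier := {p. p permutes X \<and> finite {x. p x \<noteq> x} \<and> evenperm p}\<rparr>"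

definition conj_action :: "'x set \<Rightarrow> ('g \<Rightarrow> 'x \<Rightarrow> 'x) \<Rightarrow> 'g \<Rightarrow> ('x \<Rightarrow> 'x) \<Rightarrow> ('x \<Rightarrow> 'x)" where
  "conj_action X \<alpha> g \<sigma> = perm_of X (\<alpha> g) \<circ> \<sigma> \<circ> inv' (perm_of X (\<alpha> g))"

definition semidirect_product ::
  "('n, 'a) monoid_scheme \<Rightarrow> ('g, 'b) monoid_scheme \<Rightarrow> ('g \<Rightarrow> 'n \<Rightarrow> 'n) \<Rightarrow> ('n \<times> 'g) monoid" where
  "semidirect_product N Q \<theta> =
     \<lparr>carrier = carrier N \<times> carrier Q,
      Group.monoid.mult = (\<lambda>(m, g) (n, h). (m \<otimes>\<^bsub>N\<^esub> \<theta> g n, g \<otimes>\<^bsub>Q\<^esub> h)),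
      one = (\<one>\<^bsub>N\<^esub>, \<one>\<^bsub>Q\<^esub>)\<rparr>"

definition symmetric_enrichment ::
  "('g, 'm) monoid_scheme \<Rightarrow> 'x set \<Rightarrow> ('g \<Rightarrow> 'x \<Rightarrow> 'x) \<Rightarrow> (('x \<Rightarrow> 'x) \<times> 'g) monoid" where
  "symmetric_enrichment \<Gamma> X \<alpha> = semidirect_product (fin_sym X) \<Gamma> (conj_action X \<alpha>)"

definition alternating_enrichment ::
  "('g, 'm) monoid_scheme \<Rightarrow> 'x set \<Rightarrow> ('g \<Rightarrow> 'x \<Rightarrow> 'x) \<Rightarrow> (('x \<Rightarrow> 'x) \<times> 'g) monoid" where
  "alternating_enrichment \<Gamma> X \<alpha> = semidirect_product (fin_alt X) \<Gamma> (conj_action X \<alpha>)"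


section \<open>Metric approximation of groups\<close>

definition unital ::
  "('g, 'm) monoid_scheme \<Rightarrow> ('h, 'n) monoid_scheme \<Rightarrow> ('g \<Rightarrow> 'h) \<Rightarrow> bool" where
  "unital \<Gamma> G \<phi> \<longleftrightarrow> \<phi> \<one>\<^bsub>\<Gamma>\<^esub> = \<one>\<^bsub>G\<^esub>"

definition approx_multiplicative ::
  "('g, 'm) monoid_scheme \<Rightarrow> ('h, 'n) monoid_scheme \<Rightarrow> ('h \<Rightarrow> 'h \<Rightarrow> real)
     \<Rightarrow> 'g set \<Rightarrow> real \<Rightarrow> ('g \<Rightarrow> 'h) \<Rightarrow> bool" where
  "approx_multiplicative \<Gamma> G d F \<epsilon> \<phi> \<longleftrightarrow>
     (\<forall>g\<in>F. \<forall>h\<in>F. g \<otimes>\<^bsub>\<Gamma>\<^esub> h \<in> F \<longrightarrow> d (\<phi> (g \<otimes>\<^bsub>\<Gamma>\<^esub> h)) (\<phi> g \<otimes>\<^bsub>G\<^esub> \<phi> h) < \<epsilon>)"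

definition separating ::
  "('g, 'm) monoid_scheme \<Rightarrow> ('h, 'n) monoid_scheme \<Rightarrow> ('h \<Rightarrow> 'h \<Rightarrow> real)
     \<Rightarrow> 'g set \<Rightarrow> real \<Rightarrow> ('g \<Rightarrow> 'h) \<Rightarrow> bool" where
  "separating \<Gamma> G d F c \<phi> \<longleftrightarrow> (\<forall>g\<in>F. g \<noteq> \<one>\<^bsub>\<Gamma>\<^esub> \<longrightarrow> d (\<phi> g) \<one>\<^bsub>G\<^esub> > c)"

text \<open>
  A family of metric groups is a set of pairs consisting of a group and a metric, the values of
  the latter being relevant only on the carrier.
\<close>

definition approximable ::
  "('h monoid \<times> ('h \<Rightarrow> 'h \<Rightarrow> real)) set \<Rightarrow> ('g, 'm) monoid_scheme \<Rightarrow> bool" where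
  "approximable \<G> \<Gamma> \<longleftrightarrow>
     group \<Gamma> \<and>
     (\<exists>c>0. \<forall>F \<epsilon>. finite F \<and> F \<subseteq> carrier \<Gamma> \<and> \<epsilon> > 0 \<longrightarrow>
        (\<exists>(G, d)\<in>\<G>. \<exists>\<phi>\<in>carrier \<Gamma> \<rightarrow> carrier G.
           unital \<Gamma> G \<phi> \<and> approx_multiplicative \<Gamma> G d F \<epsilon> \<phi> \<and> separating \<Gamma> G d F c \<phi>))"

definition hamming_dist :: "'a set \<Rightarrow> ('a \<Rightarrow> 'a) \<Rightarrow> ('a \<Rightarrow> 'a) \<Rightarrow> real" where
  "hamming_dist A \<sigma> \<tau> = 1 - real (card {a \<in> A. \<sigma> a = \<tau> a}) / real (card A)"

text \<open>The normalised metrics below only make sense for \<open>n \<ge> 1\<close>.\<close>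

definition sofic_group :: "('g, 'm) monoid_scheme \<Rightarrow> bool" where
  "sofic_group \<Gamma> \<longleftrightarrow> approximable {(sym_group n, hamming_dist {1..n}) |n. n \<ge> 1} \<Gamma>"

definition GL_group :: "'k::field itself \<Rightarrow> nat \<Rightarrow> 'k mat monoid" where
  "GL_group ty n = units_of (ring_mat ty n ())"

definition rank_dist :: "nat \<Rightarrow> 'k::field mat \<Rightarrow> 'k mat \<Rightarrow> real" where
  "rank_dist n M N = real (vec_space.rank n (M - N)) / real n"

definition linear_sofic_group :: "'k::field itself \<Rightarrow> ('g, 'm) monoid_scheme \<Rightarrow> bool" where
  "linear_sofic_group ty \<Gamma> \<longleftrightarrow> approximable {(GL_group ty n, rank_dist n) |n. n \<ge> 1} \<Gamma>"

definition unitary_group :: "nat \<Rightarrow> complex mat monoid" where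
  "unitary_group n =
     \<lparr>carrier = {A \<in> carrier_mat n n. A * mat_adjoint A = 1\<^sub>m n \<and> mat_adjoint A * A = 1\<^sub>m n},
      Group.monoid.mult = (*), one = 1\<^sub>m n\<rparr>"

definition mat_trace :: "'k::comm_monoid_add mat \<Rightarrow> 'k" where
  "mat_trace A = (\<Sum>i<dim_row A. A $$ (i, i))"

text \<open>The trace of \<open>(A - B) (A - B)\<^sup>*\<close> is real, so taking its real part loses nothing.\<close>

definition hs_dist :: "nat \<Rightarrow> complex mat \<Rightarrow> complex mat \<Rightarrow> real" where
  "hs_dist n A B = sqrt (1 / real n * Re (mat_trace ((A - B) * mat_adjoint (A - B))))"

definition hyperlinear_group :: "('g, 'm) monoid_scheme \<Rightarrow> bool" where
  "hyperlinear_group \<Gamma> \<longleftrightarrow> approximable {(unitary_group n, hs_dist n) |n. n \<ge> 1} \<Gamma>"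

definition bi_invariant :: "('h, 'n) monoid_scheme \<Rightarrow> ('h \<Rightarrow> 'h \<Rightarrow> real) \<Rightarrow> bool" where
  "bi_invariant G d \<longleftrightarrow>
     (\<forall>g\<in>carrier G. \<forall>x\<in>carrier G. \<forall>y\<in>carrier G.
        d (g \<otimes>\<^bsub>G\<^esub> x) (g \<otimes>\<^bsub>G\<^esub> y) = d x y \<and> d (x \<otimes>\<^bsub>G\<^esub> g) (y \<otimes>\<^bsub>G\<^esub> g) = d x y)"

text \<open>
  Every finite group is isomorphic to one whose elements are natural numbers, so taking \<open>nat\<close>
  as the element type is no restriction; likewise for the finite sets \<open>A\<close> and \<open>B\<close> in
  the definition of sofic actions.
\<close>

definition weakly_sofic_group :: "('g, 'm) monoid_scheme \<Rightarrow> bool" where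
  "weakly_sofic_group \<Gamma> \<longleftrightarrow>
     approximable
       {(G :: nat monoid, d). group G \<and> finite (carrier G) \<and> Metric_space (carrier G) d \<and>
          bi_invariant G d \<and> Sup {d x y |x y. x \<in> carrier G \<and> y \<in> carrier G} = 1} \<Gamma>"


section \<open>Sofic actions\<close>

definition orbit_approximation ::
  "'x set \<Rightarrow> ('g \<Rightarrow> 'x \<Rightarrow> 'x) \<Rightarrow> 'a set \<Rightarrow> 'g set \<Rightarrow> 'x set \<Rightarrow> real \<Rightarrow> ('g \<Rightarrow> 'a \<Rightarrow> 'a) \<Rightarrow> bool" where
  "orbit_approximation X \<alpha> A F E \<epsilon> \<phi> \<longleftrightarrow>
     (\<exists>(B :: nat set) S \<pi>. finite B \<and> S \<subseteq> A \<and> real (card S) > (1 - \<epsilon>) * real (card A) \<and>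
        (\<forall>s\<in>S. inj_on (\<pi> s) E \<and> \<pi> s ` E \<subseteq> B) \<and>
        (\<forall>g\<in>F. \<forall>x\<in>E. \<forall>s\<in>S. \<phi> g s \<in> S \<and> inv_into X (\<alpha> g) x \<in> E \<longrightarrow>
           \<pi> (\<phi> g s) x = \<pi> s (inv_into X (\<alpha> g) x)))"

definition sofic_action ::
  "('g, 'm) monoid_scheme \<Rightarrow> 'x set \<Rightarrow> ('g \<Rightarrow> 'x \<Rightarrow> 'x) \<Rightarrow> bool" where
  "sofic_action \<Gamma> X \<alpha> \<longleftrightarrow>
     (\<forall>F E \<epsilon>. finite F \<and> F \<subseteq> carrier \<Gamma> \<and> finite E \<and> E \<subseteq> X \<and> \<epsilon> > 0 \<longrightarrow>
        (\<exists>A :: nat set. finite A \<and>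
           (\<exists>\<phi>\<in>carrier \<Gamma> \<rightarrow> carrier (sym_on A).
              unital \<Gamma> (sym_on A) \<phi> \<and>
              approx_multiplicative \<Gamma> (sym_on A) (hamming_dist A) F \<epsilon> \<phi> \<and>
              orbit_approximation X \<alpha> A F E \<epsilon> \<phi>)))"

end

theory Submission
  imports Defs "HOL-Algebra.Weak_Morphisms"
begin

text \<open>
  Let \<open>\<phi> : \<Gamma> \<rightarrow> Sym(A)\<close> be an orbit approximation with injections \<open>\<pi>\<^sub>s : E \<rightarrow> B\<close> for \<open>s \<in> S\<close>. A
  permutation \<open>\<sigma>\<close> supported in \<open>E\<close> is transported by \<open>\<pi>\<^sub>s\<close> to \<open>\<sigma>\<^sub>s \<in> Sym(B)\<close>, and \<open>(\<sigma>, g)\<close> acts on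
  \<open>A \<times> Sym(B)\<close> by \<open>(a, \<beta>) \<mapsto> (\<phi>(g) a, \<sigma>\<^bsub>\<phi>(g) a\<^esub> \<beta>)\<close>. Equivariance of the \<open>\<pi>\<^sub>s\<close> makes this approximately
  multiplicative in the Hamming metric, and \<open>(\<sigma>, 1)\<close> with \<open>\<sigma> \<noteq> 1\<close> moves almost every point, since left
  translations of \<open>Sym(B)\<close> have no fixed points. The elements with nontrivial \<open>\<Gamma>\<close>-component are separated
  by the given approximation of \<open>\<Gamma>\<close>. The two maps are combined in a group of the same
  family, which needs only two properties of the family: it contains images of the finite
  symmetric groups on which the metric is controlled by the Hamming metric, and products of two of
  its members embed in a third with comparable metric. The alternating enrichment is a subgroup.
\<close>

section \<open>Enrichments as groups\<close>

text \<open>The constant \<open>c\<close> in approximability precedes \<open>F\<close>, while |B|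
  grows with \<open>F\<close>: acting on \<open>B\<close> itself, a transported transposition would
  move only the fraction 2/|B| of each fibre, and no uniform separation could result. Neither of the
  two maps suffices alone. An orbit approximation need not separate \<open>\<Gamma>\<close> (a
  trivial action admits the constant map \<open>id\<close>), while a unital map factoring through
  \<open>\<Gamma>\<close> kills every element with trivial second component. The fibre part is
  indexed by the image point of \<open>a\<close> because conjugation by \<open>g\<close> then
  becomes a shift of base point: the injection at \<open>\<phi> g s\<close>, evaluated at the
  translate of \<open>z\<close> by \<open>g\<close>, equals the injection at \<open>s\<close>
  evaluated at \<open>z\<close>. Fibre parts of products are therefore products of fibre parts, in
  the order kept by left translation. Tolerances are fixed from the end backwards: the error allowed
  in the target metric determines the Hamming tolerance, this the orbit approximation, and only then
  is the degree of the symmetric group known. Hence the constants attached to a family may not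
  depend on the degree.\<close>

text \<open>Points of \<open>E\<close> outside \<open>D\<close> are fixed by \<open>p\<close>, and
  injectivity keeps their images away from the image of \<open>D\<close>. Permutations with
  different supports can thus be transported on one common set \<open>E\<close>, where composition
  is preserved.\<close>

lemma map_permutation_mono:
  assumes "inj_on f E" "D \<subseteq> E" "p permutes D"
  shows "map_permutation E f p = map_permutation D f p"
proof
  fix y
  have injD: "inj_on f D" using assms inj_on_subset by blast
  show "map_permutation E f p y = map_permutation D f p y"
  proof (cases "y \<in> f ` E")
    case False
    then show ?thesis using assms(2) by (auto simp: map_permutation_def restrict_id_def)
  next
    case True
    then obtain x where x: "x \<in> E" "y = f x" by blast
    show ?thesis
    proof (cases "x \<in> D")
      case True
      then show ?thesis using x assms injD by (simp add: map_permutation_apply)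
    next
      case False
      then have "f x \<notin> f ` D" using x assms by (auto dest: inj_onD)
      then show ?thesis using x False assms
        by (simp add: map_permutation_apply permutes_not_in) (simp add: map_permutation_def)
    qed
  qed
qed

text \<open>Conjugation is itself a transport, along a permutation of the ambient set; conjugates
  can then be handled by functoriality of \<open>map_permutation\<close>.\<close>

lemma map_permutation_eq_conj:
  assumes "a permutes X" "D \<subseteq> X" "p permutes D"
  shows "map_permutation D a p = a \<circ> p \<circ> inv' a"
proof
  fix y
  have inj: "inj a" using assms(1) permutes_inj by blast
  have surj: "a (inv' a y) = y" using assms(1) by (simp add: permutes_inverses)
  show "map_permutation D a p y = (a \<circ> p \<circ> inv' a) y"
  proof (cases "inv' a y \<in> D")
    case True
    then show ?thesis
      using map_permutation_apply[of a D "inv' a y" p] inj surj by (simp add: inj_on_subset)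
  next
    case False
    then have "y \<notin> a ` D" using inj by (auto simp: inj_image_mem_iff)
    then show ?thesis using False surj assms(3)
      by (simp add: map_permutation_def permutes_not_in)
  qed
qed

text \<open>The hypothesis \<open>\<rho>' (a y) = \<rho> y\<close> is the equivariance supplied by an orbit approximation: it
  turns conjugation by \<open>a\<close> in \<open>X\<close> into a change of the base point of the fibre.\<close>

lemma map_permutation_conj:
  assumes inj: "inj_on \<rho> E" "inj_on \<rho>' E" and sub: "D \<subseteq> E" "a ` D \<subseteq> E" "D \<subseteq> X"
    and a: "a permutes X" and p: "p permutes D"
    and eq: "\<And>y. y \<in> D \<Longrightarrow> \<rho>' (a y) = \<rho> y"
  shows "map_permutation E \<rho>' (a \<circ> p \<circ> inv' a) = map_permutation E \<rho> p"
proof -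
  have bij: "bij_betw a D (a ` D)"
    using a permutes_inj inj_on_subset by (metis bij_betw_imageI subset_UNIV)
  have "map_permutation E \<rho>' (a \<circ> p \<circ> inv' a) = map_permutation (a ` D) \<rho>' (map_permutation D a p)"
    using map_permutation_mono[OF inj(2) sub(2)] map_permutation_permutes[OF bij p]
    by (simp add: map_permutation_eq_conj[OF a sub(3) p])
  also have "\<dots> = map_permutation D (\<rho>' \<circ> a) p"
    using map_permutation_compose[OF bij] inj(2) sub(2) inj_on_subset by blast
  also have "\<dots> = map_permutation D \<rho> p"
    by (rule sym, rule map_permutation_cong) (use inj sub p eq inj_on_subset in auto)
  also have "\<dots> = map_permutation E \<rho> p"
    using map_permutation_mono[OF inj(1) sub(1) p] by simp
  finally show ?thesis .
qed

lemma map_permutation_eq_id_iff: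
  assumes "inj_on f E" "p permutes E"
  shows "map_permutation E f p = id \<longleftrightarrow> p = id"
proof
  assume *: "map_permutation E f p = id"
  show "p = id"
  proof
    fix x
    show "p x = id x"
    proof (cases "x \<in> E")
      case True
      then have "f (p x) = f x" using map_permutation_apply[OF assms(1) True, of p] * by simp
      then show ?thesis using True assms by (auto dest: inj_onD simp: permutes_in_image)
    next
      case False
      then show ?thesis using assms by (simp add: permutes_not_in)
    qed
  qed
next
  assume "p = id"
  then show "map_permutation E f p = id" using assms by (simp add: map_permutation_id')
qed

section \<open>Actions by permutations and the sign of a conjugate\<close>

lemma perm_of_permutes:
  assumes "group_action \<Gamma> X \<alpha>" "g \<in> carrier \<Gamma>"
  shows "perm_of X (\<alpha> g) permutes X"
proof (rule bij_imp_permutes)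
  interpret group_action \<Gamma> X \<alpha> by fact
  have "bij_betw (\<alpha> g) X X" using bij_prop0[OF assms(2)] by (simp add: Bij_def)
  then show "bij_betw (perm_of X (\<alpha> g)) X X"
    by (rule bij_betw_cong[THEN iffD1, rotated]) (simp add: perm_of_def)
qed (simp add: perm_of_def)

lemma perm_of_mult:
  assumes "group_action \<Gamma> X \<alpha>" "g \<in> carrier \<Gamma>" "h \<in> carrier \<Gamma>"
  shows "perm_of X (\<alpha> (g \<otimes>\<^bsub>\<Gamma>\<^esub> h)) = perm_of X (\<alpha> g) \<circ> perm_of X (\<alpha> h)"
proof
  interpret group_action \<Gamma> X \<alpha> by fact
  fix x
  show "perm_of X (\<alpha> (g \<otimes>\<^bsub>\<Gamma>\<^esub> h)) x = (perm_of X (\<alpha> g) \<circ> perm_of X (\<alpha> h)) x"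
  proof (cases "x \<in> X")
    case True
    then show ?thesis
      using composition_rule[OF True assms(2,3)] element_image[OF assms(3) True refl] by (simp add: perm_of_def)
  qed (simp add: perm_of_def)
qed

lemma perm_of_one:
  assumes "group_action \<Gamma> X \<alpha>"
  shows "perm_of X (\<alpha> \<one>\<^bsub>\<Gamma>\<^esub>) = id"
proof
  fix x
  show "perm_of X (\<alpha> \<one>\<^bsub>\<Gamma>\<^esub>) x = id x"
    using fun_cong[OF group_action.id_eq_one[OF assms, symmetric], of x] by (simp add: perm_of_def)
qed

lemma support_conj:
  assumes "bij a"
  shows "{x. (a \<circ> p \<circ> inv' a) x \<noteq> x} = a ` {x. p x \<noteq> x}"
proof -
  have "(a \<circ> p \<circ> inv' a) (a x) = a x \<longleftrightarrow> p x = x" for x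
    using assms by (simp add: bij_is_inj inj_eq)
  then show ?thesis using assms
    by (auto simp: image_iff) (metis bij_inv_eq_iff)+
qed

text \<open>Conjugation by \<open>a\<close> carries the transposition of \<open>b\<close> and
  \<open>c\<close> to that of \<open>a b\<close> and \<open>a c\<close>, so the number of factors is
  kept. Multiplicativity of the sign would not suffice, as \<open>a\<close> may have infinite
  support.\<close>

lemma swapidseq_conj:
  assumes "swapidseq n p" "bij a"
  shows "swapidseq n (a \<circ> p \<circ> inv' a)"
  using assms
proof (induction rule: swapidseq.induct)
  case id
  then show ?case by (simp add: fun_eq_iff bij_is_surj surj_f_inv_f)
next
  case (comp_Suc n p b c)
  have inj: "inj a" using comp_Suc.prems bij_is_inj by blast
  have eq: "a \<circ> (Transposition.transpose b c \<circ> p) \<circ> inv' a = Transposition.transpose (a b) (a c) \<circ> (a \<circ> p \<circ> inv' a)"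
  proof
    fix x
    show "(a \<circ> (Transposition.transpose b c \<circ> p) \<circ> inv' a) x = (Transposition.transpose (a b) (a c) \<circ> (a \<circ> p \<circ> inv' a)) x"
      using inj by (auto simp: Transposition.transpose_def inj_eq)
  qed
  have ab: "a b \<noteq> a c" using comp_Suc.hyps inj by (auto dest: injD)
  show ?case unfolding eq by (rule swapidseq.comp_Suc[OF comp_Suc.IH[OF comp_Suc.prems] ab])
qed

lemma evenperm_conj:
  assumes "permutation p" "bij a"
  shows "evenperm (a \<circ> p \<circ> inv' a) \<longleftrightarrow> evenperm p"
proof -
  obtain n where n: "swapidseq n p" using assms(1) by (auto simp: permutation_def)
  show ?thesis using evenperm_unique[OF n refl] evenperm_unique[OF swapidseq_conj[OF n assms(2)] refl]
    by simp
qed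

lemma permutation_if_permutes_finite_support:
  assumes "p permutes X" "finite {x. p x \<noteq> x}"
  shows "permutation p"
  using assms by (simp add: permutation permutes_bij)

section \<open>Semidirect products and the group structure of the enrichments\<close>

lemma group_semidirect_product:
  assumes N: "group N" and Q: "group Q"
    and hom: "\<And>g. g \<in> carrier Q \<Longrightarrow> \<theta> g \<in> hom N N"
    and one: "\<And>n. n \<in> carrier N \<Longrightarrow> \<theta> \<one>\<^bsub>Q\<^esub> n = n"
    and mult: "\<And>g h n. \<lbrakk>g \<in> carrier Q; h \<in> carrier Q; n \<in> carrier N\<rbrakk> \<Longrightarrow> \<theta> (g \<otimes>\<^bsub>Q\<^esub> h) n = \<theta> g (\<theta> h n)"
  shows "group (semidirect_product N Q \<theta>)"
proof -
  interpret N: group N by fact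
  interpret Q: group Q by fact
  have closed: "\<theta> g n \<in> carrier N" if "g \<in> carrier Q" "n \<in> carrier N" for g n
    using hom that by (auto simp: hom_def)
  have homm: "\<theta> g (m \<otimes>\<^bsub>N\<^esub> n) = \<theta> g m \<otimes>\<^bsub>N\<^esub> \<theta> g n"
    if "g \<in> carrier Q" "m \<in> carrier N" "n \<in> carrier N" for g m n
    using hom that by (auto simp: hom_def)
  have hom1: "\<theta> g \<one>\<^bsub>N\<^esub> = \<one>\<^bsub>N\<^esub>" if "g \<in> carrier Q" for g
    using that N.group_axioms hom hom_one by blast
  show ?thesis
  proof (rule groupI)
    fix x assume "x \<in> carrier (semidirect_product N Q \<theta>)"
    then obtain n g where x: "x = (n, g)" "n \<in> carrier N" "g \<in> carrier Q"
      by (auto simp: semidirect_product_def)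
    have "\<theta> (inv\<^bsub>Q\<^esub> g) (inv\<^bsub>N\<^esub> n) \<otimes>\<^bsub>N\<^esub> \<theta> (inv\<^bsub>Q\<^esub> g) n = \<one>\<^bsub>N\<^esub>"
      using homm[of "inv\<^bsub>Q\<^esub> g" "inv\<^bsub>N\<^esub> n" n] hom1 x by simp
    then show "\<exists>y\<in>carrier (semidirect_product N Q \<theta>).
        y \<otimes>\<^bsub>semidirect_product N Q \<theta>\<^esub> x = \<one>\<^bsub>semidirect_product N Q \<theta>\<^esub>"
      using x closed
      by (intro bexI[of _ "(\<theta> (inv\<^bsub>Q\<^esub> g) (inv\<^bsub>N\<^esub> n), inv\<^bsub>Q\<^esub> g)"]) (auto simp: semidirect_product_def)
  qed (auto simp: semidirect_product_def closed homm mult one N.m_assoc Q.m_assoc)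
qed

lemma group_fin_sym: "group (fin_sym X)"
proof (rule groupI)
  fix p q assume "p \<in> carrier (fin_sym X)" "q \<in> carrier (fin_sym X)"
  moreover have "{x. p (q x) \<noteq> x} \<subseteq> {x. p x \<noteq> x} \<union> {x. q x \<noteq> x}" by auto
  ultimately show "p \<otimes>\<^bsub>fin_sym X\<^esub> q \<in> carrier (fin_sym X)"
    by (auto simp: fin_sym_def sym_on_def permutes_compose intro: finite_subset)
next
  fix p assume p: "p \<in> carrier (fin_sym X)"
  then have perm: "p permutes X" by (simp add: fin_sym_def)
  have "{x. inv' p x \<noteq> x} = {x. p x \<noteq> x}"
    using perm by (metis (lifting) permutes_inv_eq)
  then show "\<exists>q\<in>carrier (fin_sym X). q \<otimes>\<^bsub>fin_sym X\<^esub> p = \<one>\<^bsub>fin_sym X\<^esub>"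
    using p perm permutes_inv[OF perm] permutes_inv_o[OF perm]
    by (intro bexI[of _ "inv' p"]) (auto simp: fin_sym_def sym_on_def)
qed (auto simp: fin_sym_def sym_on_def permutes_id comp_assoc)

lemma conj_action_closed:
  assumes "group_action \<Gamma> X \<alpha>" "g \<in> carrier \<Gamma>" "p \<in> carrier (fin_sym X)"
  shows "conj_action X \<alpha> g p \<in> carrier (fin_sym X)"
proof -
  have a: "perm_of X (\<alpha> g) permutes X" by (rule perm_of_permutes[OF assms(1,2)])
  show ?thesis
    using assms(3) a support_conj[OF permutes_bij[OF a], of p]
    by (auto simp: fin_sym_def sym_on_def conj_action_def permutes_compose permutes_inv simp del: o_apply)
qed

lemma group_symmetric_enrichment:
  assumes "group_action \<Gamma> X \<alpha>"
  shows "group (symmetric_enrichment \<Gamma> X \<alpha>)"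
  unfolding symmetric_enrichment_def
proof (rule group_semidirect_product)
  interpret group_action \<Gamma> X \<alpha> by fact
  show "group \<Gamma>" using group_hom group_hom.axioms(1) by blast
  show "group (fin_sym X)" by (rule group_fin_sym)
  show "conj_action X \<alpha> g \<in> hom (fin_sym X) (fin_sym X)" if g: "g \<in> carrier \<Gamma>" for g
  proof (rule homI)
    let ?a = "perm_of X (\<alpha> g)"
    have a: "?a permutes X" by (rule perm_of_permutes[OF assms g])
    then have bij: "bij ?a" by (rule permutes_bij)
    fix p assume p: "p \<in> carrier (fin_sym X)"
    then show "conj_action X \<alpha> g p \<in> carrier (fin_sym X)" by (rule conj_action_closed[OF assms g])
    fix q
    show "conj_action X \<alpha> g (p \<otimes>\<^bsub>fin_sym X\<^esub> q) =
        conj_action X \<alpha> g p \<otimes>\<^bsub>fin_sym X\<^esub> conj_action X \<alpha> g q"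
      using bij_is_inj[OF bij] by (simp add: fin_sym_def sym_on_def conj_action_def fun_eq_iff)
  qed
  show "conj_action X \<alpha> \<one>\<^bsub>\<Gamma>\<^esub> p = p" for p
    by (simp add: conj_action_def perm_of_one[OF assms])
  show "conj_action X \<alpha> (g \<otimes>\<^bsub>\<Gamma>\<^esub> h) p = conj_action X \<alpha> g (conj_action X \<alpha> h p)"
    if "g \<in> carrier \<Gamma>" "h \<in> carrier \<Gamma>" for g h p
  proof -
    have bij: "bij (perm_of X (\<alpha> g))" "bij (perm_of X (\<alpha> h))"
      using that perm_of_permutes[OF assms] permutes_bij by blast+
    show ?thesis
      unfolding conj_action_def perm_of_mult[OF assms that(1,2)] o_inv_distrib[OF bij] by (simp only: comp_assoc)
  qed
qed

text \<open>The two semidirect products differ only in their carriers, so the alternating case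
  reduces to passing to a subgroup.\<close>

lemma alternating_enrichment_eq:
  "alternating_enrichment \<Gamma> X \<alpha> =
     (symmetric_enrichment \<Gamma> X \<alpha>)\<lparr>carrier := carrier (fin_alt X) \<times> carrier \<Gamma>\<rparr>"
  by (simp add: alternating_enrichment_def symmetric_enrichment_def semidirect_product_def
      fin_alt_def fin_sym_def)

lemma subgroup_alternating_enrichment:
  assumes "group_action \<Gamma> X \<alpha>"
  shows "subgroup (carrier (fin_alt X) \<times> carrier \<Gamma>) (symmetric_enrichment \<Gamma> X \<alpha>)"
proof (rule group.subgroupI)
  let ?S = "symmetric_enrichment \<Gamma> X \<alpha>"
  interpret group_action \<Gamma> X \<alpha> by fact
  interpret \<Gamma>: group \<Gamma> using group_hom group_hom.axioms(1) by blast
  show S: "group ?S" by (rule group_symmetric_enrichment) fact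
  have alt: "p \<in> carrier (fin_alt X) \<longleftrightarrow> p \<in> carrier (fin_sym X) \<and> evenperm p" for p
    by (auto simp: fin_alt_def fin_sym_def)
  have perm: "permutation p" if "p \<in> carrier (fin_sym X)" for p
    using that permutation_if_permutes_finite_support by (auto simp: fin_sym_def)
  show "carrier (fin_alt X) \<times> carrier \<Gamma> \<subseteq> carrier ?S"
    by (auto simp: symmetric_enrichment_def semidirect_product_def alt)
  have "(id, \<one>\<^bsub>\<Gamma>\<^esub>) \<in> carrier (fin_alt X) \<times> carrier \<Gamma>"
    by (auto simp: fin_alt_def permutes_id)
  then show "carrier (fin_alt X) \<times> carrier \<Gamma> \<noteq> {}" by blast
  have conj: "conj_action X \<alpha> g p \<in> carrier (fin_alt X)"
    if "g \<in> carrier \<Gamma>" "p \<in> carrier (fin_alt X)" for g p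
  proof -
    have a: "perm_of X (\<alpha> g) permutes X" by (rule perm_of_permutes[OF assms that(1)])
    have p: "p \<in> carrier (fin_sym X)" "evenperm p" using that alt by auto
    have "evenperm (conj_action X \<alpha> g p)"
      using evenperm_conj[OF perm[OF p(1)] permutes_bij[OF a]] p(2) by (simp add: conj_action_def)
    then show ?thesis using conj_action_closed[OF assms that(1) p(1)] by (simp add: alt)
  qed
  have mult: "p \<circ> q \<in> carrier (fin_alt X)"
    if "p \<in> carrier (fin_alt X)" "q \<in> carrier (fin_alt X)" for p q
    using that group.is_monoid[OF group_fin_sym, THEN monoid.m_closed, of p X q] evenperm_comp[OF perm perm]
    unfolding alt by (simp add: fin_sym_def sym_on_def)
  fix x assume x: "x \<in> carrier (fin_alt X) \<times> carrier \<Gamma>"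
  then obtain p g where pg: "x = (p, g)" "p \<in> carrier (fin_alt X)" "g \<in> carrier \<Gamma>" by auto
  have invp: "inv' p \<in> carrier (fin_alt X)"
  proof -
    have pX: "p permutes X" using pg by (simp add: fin_alt_def)
    have "{x. inv' p x \<noteq> x} = {x. p x \<noteq> x}"
      using pX by (metis (lifting) permutes_inv_eq)
    moreover have "evenperm (inv' p)" using evenperm_inv[OF perm, of p] pg alt by simp
    ultimately show ?thesis using pg permutes_inv[OF pX] by (simp add: fin_alt_def)
  qed
  \<comment> \<open>The explicit inverse of \<open>(p, g)\<close>; it is checked only as a left
    inverse, which determines the inverse in a group.\<close>
  let ?y = "(conj_action X \<alpha> (inv\<^bsub>\<Gamma>\<^esub> g) (inv' p), inv\<^bsub>\<Gamma>\<^esub> g)"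
  let ?a = "perm_of X (\<alpha> (inv\<^bsub>\<Gamma>\<^esub> g))"
  have a: "?a permutes X" by (rule perm_of_permutes[OF assms]) (use pg in simp)
  have pX: "p permutes X" using pg by (simp add: fin_alt_def)
  have "conj_action X \<alpha> (inv\<^bsub>\<Gamma>\<^esub> g) (inv' p) \<circ> conj_action X \<alpha> (inv\<^bsub>\<Gamma>\<^esub> g) p = id"
    by (simp add: fun_eq_iff conj_action_def permutes_inverses[OF a] permutes_inverses[OF pX])
  then have y1: "?y \<otimes>\<^bsub>?S\<^esub> x = \<one>\<^bsub>?S\<^esub>"
    using pg by (simp add: symmetric_enrichment_def semidirect_product_def fin_sym_def sym_on_def)
  have y2: "?y \<in> carrier (fin_alt X) \<times> carrier \<Gamma>" using pg conj invp by simp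
  then have "?y \<in> carrier ?S" "x \<in> carrier ?S"
    using x by (auto simp: symmetric_enrichment_def semidirect_product_def alt)
  then have "inv\<^bsub>?S\<^esub> x = ?y" using group.inv_equality[OF S y1] by simp
  then show "inv\<^bsub>?S\<^esub> x \<in> carrier (fin_alt X) \<times> carrier \<Gamma>" using y2 by simp
  fix y assume "y \<in> carrier (fin_alt X) \<times> carrier \<Gamma>"
  then show "x \<otimes>\<^bsub>?S\<^esub> y \<in> carrier (fin_alt X) \<times> carrier \<Gamma>"
    using pg conj mult by (auto simp: symmetric_enrichment_def semidirect_product_def fin_sym_def sym_on_def simp del: o_apply)
qed

section \<open>Approximability of subgroups\<close>

lemma approximable_iff:
  "approximable \<G> \<Gamma> \<longleftrightarrow> group \<Gamma> \<and>
     (\<exists>c>0. \<forall>F \<epsilon>. finite F \<and> F \<subseteq> carrier \<Gamma> \<and> \<epsilon> > 0 \<longrightarrow>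
        (\<exists>G d \<phi>. (G, d) \<in> \<G> \<and> \<phi> \<in> carrier \<Gamma> \<rightarrow> carrier G \<and> unital \<Gamma> G \<phi> \<and>
           approx_multiplicative \<Gamma> G d F \<epsilon> \<phi> \<and> separating \<Gamma> G d F c \<phi>))"
  unfolding approximable_def Bex_def by simp

text \<open>A finite subset of \<open>H\<close> is a finite subset of \<open>G\<close>, so an
  approximation of \<open>G\<close> restricts with the same constant \<open>c\<close>.\<close>

lemma approximable_subgroup:
  assumes "approximable \<G> G" "subgroup H G"
  shows "approximable \<G> (G\<lparr>carrier := H\<rparr>)"
proof -
  have sub: "H \<subseteq> carrier G" using assms(2) subgroup.subset by blast
  obtain c where "c > 0" and c: "\<And>F \<epsilon>. finite F \<and> F \<subseteq> carrier G \<and> \<epsilon> > 0 \<Longrightarrow>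
        (\<exists>K d \<phi>. (K, d) \<in> \<G> \<and> \<phi> \<in> carrier G \<rightarrow> carrier K \<and>
           unital G K \<phi> \<and> approx_multiplicative G K d F \<epsilon> \<phi> \<and> separating G K d F c \<phi>)"
    using assms(1) unfolding approximable_iff by blast
  have "group (G\<lparr>carrier := H\<rparr>)"
    using assms group.subgroup_imp_group unfolding approximable_def by blast
  moreover have "\<exists>K d \<phi>. (K, d) \<in> \<G> \<and> \<phi> \<in> H \<rightarrow> carrier K \<and>
           unital (G\<lparr>carrier := H\<rparr>) K \<phi> \<and> approx_multiplicative (G\<lparr>carrier := H\<rparr>) K d F \<epsilon> \<phi> \<and>
           separating (G\<lparr>carrier := H\<rparr>) K d F c \<phi>"
    if F: "finite F" "F \<subseteq> H" "\<epsilon> > 0" for F \<epsilon>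
  proof -
    obtain K d \<phi> where "(K, d) \<in> \<G>" "\<phi> \<in> carrier G \<rightarrow> carrier K" "unital G K \<phi>"
      "approx_multiplicative G K d F \<epsilon> \<phi>" "separating G K d F c \<phi>"
      using c[of F \<epsilon>] F sub by blast
    then show ?thesis using sub
      by (intro exI[of _ K] exI[of _ d] exI[of _ \<phi>])
        (simp add: unital_def approx_multiplicative_def separating_def Pi_iff subset_iff)
  qed
  ultimately show ?thesis
    unfolding approximable_iff by (intro conjI exI[of _ c] allI impI) (use \<open>c > 0\<close> in auto)
qed

section \<open>Hamming metric and skew products\<close>

text \<open>Nonemptiness matters: on the empty set the definition yields 1 but the quotient 0, since
  \<open>0 / 0 = 0\<close>.\<close>

lemma hamming_dist_eq:
  assumes "finite A" "A \<noteq> {}"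
  shows "hamming_dist A p q = real (card {a \<in> A. p a \<noteq> q a}) / real (card A)"
proof -
  have "{a \<in> A. p a \<noteq> q a} = A - {a \<in> A. p a = q a}" by auto
  then have "card {a \<in> A. p a \<noteq> q a} = card A - card {a \<in> A. p a = q a}"
    using assms(1) by (simp add: card_Diff_subset)
  moreover have "card {a \<in> A. p a = q a} \<le> card A" using assms(1) by (intro card_mono) auto
  moreover have "card A > 0" using assms by (simp add: card_gt_0_iff)
  ultimately show ?thesis by (simp add: hamming_dist_def of_nat_diff field_simps)
qed

lemma hamming_dist_map_permutation:
  assumes "inj_on f A" "finite A" "p permutes A" "q permutes A"
  shows "hamming_dist (f ` A) (map_permutation A f p) (map_permutation A f q) = hamming_dist A p q"
proof -
  have "{b \<in> f ` A. map_permutation A f p b = map_permutation A f q b} = f ` {a \<in> A. p a = q a}"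
    using assms by (auto simp: map_permutation_apply inj_on_eq_iff permutes_in_image)
  moreover have "inj_on f {a \<in> A. p a = q a}" using assms(1) by (rule inj_on_subset) auto
  ultimately show ?thesis using assms(1) by (simp add: hamming_dist_def card_image)
qed

text \<open>The element of the wreath product of \<open>Sym(B)\<close> and \<open>Sym(A)\<close> with base \<open>p\<close> and fibre part \<open>L\<close>.
  The fibre over a point of \<open>A\<close> is \<open>Sym(B)\<close> acting on itself by translations rather than \<open>B\<close>: a
  nontrivial fibre part then moves the whole fibre, so that no mass is lost on its fixed points.\<close>

definition skew_product ::
  "'a set \<Rightarrow> 'b set \<Rightarrow> ('a \<Rightarrow> 'a) \<Rightarrow> ('a \<Rightarrow> 'b \<Rightarrow> 'b) \<Rightarrow> 'a \<times> ('b \<Rightarrow> 'b) \<Rightarrow> 'a \<times> ('b \<Rightarrow> 'b)" where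
  "skew_product A B p L = (\<lambda>(a, \<beta>). if a \<in> A \<and> \<beta> permutes B then (p a, L (p a) \<circ> \<beta>) else (a, \<beta>))"

text \<open>The set is finite, so injectivity is enough: equal images have equal base points, hence
  the same fibre part \<open>L (p a)\<close>, which cancels.\<close>

lemma skew_product_permutes:
  assumes "finite A" "finite B" "p permutes A" "\<And>a. L a permutes B"
  shows "skew_product A B p L permutes A \<times> {\<beta>. \<beta> permutes B}"
proof (rule bij_imp_permutes)
  let ?Y = "A \<times> {\<beta>. \<beta> permutes B}" and ?T = "skew_product A B p L"
  have "inj_on ?T ?Y"
  proof (rule inj_onI)
    fix x y assume "x \<in> ?Y" "y \<in> ?Y" and eq: "?T x = ?T y"
    then obtain a \<beta> b \<gamma> where x: "x = (a, \<beta>)" "a \<in> A" "\<beta> permutes B"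
      and y: "y = (b, \<gamma>)" "b \<in> A" "\<gamma> permutes B" by auto
    have "p a = p b" using eq x y by (simp add: skew_product_def)
    then have ab: "a = b" using permutes_inj[OF assms(3)] by (simp add: inj_eq)
    then have "L (p a) \<circ> \<beta> = L (p a) \<circ> \<gamma>" using eq x y by (simp add: skew_product_def)
    then have "\<beta> = \<gamma>" using permutes_inj[OF assms(4)] by (simp add: fun.inj_map_strong inj_eq fun_eq_iff)
    then show "x = y" using ab x y by simp
  qed
  moreover have "?T ` ?Y \<subseteq> ?Y"
    using assms(3) permutes_compose[OF _ assms(4)] by (auto simp: skew_product_def permutes_in_image)
  moreover have "finite ?Y" using assms(1,2) by (simp add: finite_permutations)
  ultimately show "bij_betw ?T ?Y ?Y" by (simp add: bij_betw_def endo_inj_surj)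
  show "skew_product A B p L x = x" if "x \<notin> A \<times> {\<beta>. \<beta> permutes B}" for x
    using that by (cases x) (auto simp: skew_product_def)
qed

text \<open>A change of variables by \<open>p\<close>. It bounds the number of base points sent to a
  bad set and later gives right invariance of the Hamming metric.\<close>

lemma card_preimage_permutes:
  assumes "p permutes A"
  shows "card {a \<in> A. P (p a)} = card {a \<in> A. P a}"
proof -
  have "bij_betw p {a \<in> A. P (p a)} {a \<in> A. P a}"
  proof (rule bij_betw_imageI)
    show "inj_on p {a \<in> A. P (p a)}" using permutes_inj[OF assms] inj_on_subset by blast
    show "p ` {a \<in> A. P (p a)} = {a \<in> A. P a}"
    proof (intro equalityI subsetI)
      fix b assume "b \<in> {a \<in> A. P a}"
      moreover then obtain a where "b = p a" "a \<in> A" using permutes_image[OF assms] by blast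
      ultimately show "b \<in> p ` {a \<in> A. P (p a)}" by auto
    qed (use assms in \<open>auto simp: permutes_in_image\<close>)
  qed
  then show ?thesis by (rule bij_betw_same_card)
qed

text \<open>The composite sends \<open>(a, \<beta>)\<close> to
  \<open>(p (q a), L (p (q a)) \<circ> M (q a) \<circ> \<beta>)\<close>. By \<open>cocycle\<close>
  it can differ from the skew product over \<open>r\<close> only above three sets of base points:
  where \<open>r\<close> differs from \<open>p \<circ> q\<close>, where \<open>q a\<close> is
  outside \<open>S\<close>, and where \<open>p (q a)\<close> is outside \<open>S\<close>. Each has
  proportion below \<open>\<epsilon>\<close>, whence the factor 3.\<close>

lemma skew_product_hamming_le:
  assumes fin: "finite A" "A \<noteq> {}" "finite B"
    and p: "p permutes A" and q: "q permutes A"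
    and L: "\<And>a. M a permutes B"
    and S: "S \<subseteq> A" "real (card S) > (1 - \<epsilon>) * real (card A)"
    and rp: "hamming_dist A r (p \<circ> q) < \<epsilon>"
    and cocycle: "\<And>a. \<lbrakk>a \<in> A; r a = p (q a); q a \<in> S; p (q a) \<in> S\<rbrakk> \<Longrightarrow> K (r a) = L (p (q a)) \<circ> M (q a)"
  shows "hamming_dist (A \<times> {\<beta>. \<beta> permutes B})
     (skew_product A B r K) (skew_product A B p L \<circ> skew_product A B q M) < 3 * \<epsilon>"
proof -
  let ?Z = "{\<beta>. \<beta> permutes B}"
  let ?B1 = "{a \<in> A. r a \<noteq> p (q a)}" and ?B2 = "{a \<in> A. q a \<notin> S}" and ?B3 = "{a \<in> A. p (q a) \<notin> S}"
  have Z: "finite ?Z" "?Z \<noteq> {}" using finite_permutations[OF fin(3)] permutes_id by (simp, blast)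
  have cA: "card A > 0" and cZ: "card ?Z > 0" using fin Z by (auto simp: card_gt_0_iff)
  have eq: "skew_product A B r K (a, \<beta>) = (skew_product A B p L \<circ> skew_product A B q M) (a, \<beta>)"
    if "a \<in> A" "\<beta> permutes B" "a \<notin> ?B1 \<union> ?B2 \<union> ?B3" for a \<beta>
  proof -
    have "r a = p (q a)" "q a \<in> S" "p (q a) \<in> S" using that by blast+
    moreover have "q a \<in> A" using q that by (simp add: permutes_in_image)
    moreover have "M (q a) \<circ> \<beta> permutes B" by (rule permutes_compose[OF that(2) L])
    ultimately show ?thesis using cocycle[OF that(1)] that by (simp add: skew_product_def comp_assoc)
  qed
  have agree: "a \<in> ?B1 \<union> ?B2 \<union> ?B3"
    if "a \<in> A" "\<beta> permutes B" "skew_product A B r K (a, \<beta>) \<noteq> (skew_product A B p L \<circ> skew_product A B q M) (a, \<beta>)"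
    for a \<beta>
    by (rule ccontr, drule eq[OF that(1,2)]) (rule notE[OF that(3)])
  have "{y \<in> A \<times> ?Z. skew_product A B r K y \<noteq> (skew_product A B p L \<circ> skew_product A B q M) y}
      \<subseteq> (?B1 \<union> ?B2 \<union> ?B3) \<times> ?Z"
  proof (rule subrelI)
    fix a \<beta> assume "(a, \<beta>) \<in> {y \<in> A \<times> ?Z. skew_product A B r K y \<noteq> (skew_product A B p L \<circ> skew_product A B q M) y}"
    then have *: "(a \<in> A \<and> \<beta> permutes B) \<and>
        skew_product A B r K (a, \<beta>) \<noteq> (skew_product A B p L \<circ> skew_product A B q M) (a, \<beta>)"
      unfolding mem_Collect_eq mem_Sigma_iff .
    show "(a, \<beta>) \<in> (?B1 \<union> ?B2 \<union> ?B3) \<times> ?Z"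
      using agree[OF conjunct1[OF conjunct1[OF *]] conjunct2[OF conjunct1[OF *]] conjunct2[OF *]] *
      by (intro SigmaI CollectI) blast+
  qed
  then have "card {y \<in> A \<times> ?Z. skew_product A B r K y \<noteq> (skew_product A B p L \<circ> skew_product A B q M) y}
      \<le> card ((?B1 \<union> ?B2 \<union> ?B3) \<times> ?Z)"
    using fin Z by (intro card_mono) auto
  also have "\<dots> \<le> (card ?B1 + card ?B2 + card ?B3) * card ?Z"
    unfolding card_cartesian_product
    by (intro mult_right_mono order_trans[OF card_Un_le] add_right_mono card_Un_le) auto
  finally have "real (card {y \<in> A \<times> ?Z. skew_product A B r K y \<noteq> (skew_product A B p L \<circ> skew_product A B q M) y})
      \<le> real ((card ?B1 + card ?B2 + card ?B3) * card ?Z)" by (rule of_nat_mono)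
  then have "real (card {y \<in> A \<times> ?Z. skew_product A B r K y \<noteq> (skew_product A B p L \<circ> skew_product A B q M) y})
      \<le> (real (card ?B1) + real (card ?B2) + real (card ?B3)) * real (card ?Z)"
    by (simp only: of_nat_mult of_nat_add)
  moreover have "real (card ?B1) < \<epsilon> * real (card A)"
    using rp cA hamming_dist_eq[OF fin(1,2), of r "p \<circ> q"] by (simp add: field_simps)
  moreover have "card {a \<in> A. a \<notin> S} = card A - card S"
    using S fin by (simp add: card_Diff_subset set_diff_eq[symmetric] finite_subset)
  then have cS: "real (card {a \<in> A. a \<notin> S}) < \<epsilon> * real (card A)"
    using S fin card_mono[OF fin(1) S(1)] by (simp add: of_nat_diff algebra_simps)
  \<comment> \<open>Both remaining bad sets are preimages, under permutations of \<open>A\<close>,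
    of the complement of \<open>S\<close>, so each is as small as that complement.\<close>
  moreover have "card ?B2 = card {a \<in> A. a \<notin> S}" by (rule card_preimage_permutes[OF q])
  moreover have "card ?B3 = card {a \<in> A. a \<notin> S}"
    using card_preimage_permutes[OF permutes_compose[OF q p]] by simp
  ultimately have "real (card {y \<in> A \<times> ?Z. skew_product A B r K y \<noteq> (skew_product A B p L \<circ> skew_product A B q M) y})
      < (3 * \<epsilon> * real (card A)) * real (card ?Z)"
    using mult_strict_right_mono[of "real (card ?B1) + real (card ?B2) + real (card ?B3)" "3 * \<epsilon> * real (card A)" "real (card ?Z)"] cZ
    by linarith
  moreover have "A \<times> ?Z \<noteq> {}" "finite (A \<times> ?Z)"
    using fin(1,2) Z finite_cartesian_product[OF fin(1) Z(1)] unfolding Times_empty by blast+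
  ultimately show ?thesis
    using cA cZ by (simp add: hamming_dist_eq card_cartesian_product divide_less_eq mult.assoc)
qed

text \<open>Over \<open>S\<close> the base point stays and the fibre is translated by
  \<open>L a\<close>. Cancelling \<open>\<beta>\<close> in
  \<open>L a \<circ> \<beta> = \<beta>\<close> would give \<open>L a = id\<close>, so every point
  above \<open>S\<close> moves, however small the support of \<open>L a\<close>.\<close>

lemma skew_product_hamming_ge:
  assumes fin: "finite A" "A \<noteq> {}" "finite B"
    and S: "S \<subseteq> A" "real (card S) > (1 - \<epsilon>) * real (card A)"
    and L: "\<And>a. a \<in> S \<Longrightarrow> L a \<noteq> id"
  shows "hamming_dist (A \<times> {\<beta>. \<beta> permutes B}) (skew_product A B id L) id > 1 - \<epsilon>"
proof -
  let ?Z = "{\<beta>. \<beta> permutes B}"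
  have Z: "finite ?Z" "?Z \<noteq> {}" using finite_permutations[OF fin(3)] permutes_id by (simp, blast)
  have cA: "card A > 0" and cZ: "card ?Z > 0" using fin Z by (auto simp: card_gt_0_iff)
  have "L a \<circ> \<beta> \<noteq> \<beta>" if "a \<in> S" "\<beta> permutes B" for a \<beta>
  proof
    assume "L a \<circ> \<beta> = \<beta>"
    then have "L a \<circ> (\<beta> \<circ> inv' \<beta>) = \<beta> \<circ> inv' \<beta>" by (simp add: comp_assoc[symmetric])
    then show False using L[OF that(1)] permutes_inv_o[OF that(2)] by simp
  qed
  then have "skew_product A B id L (a, \<beta>) \<noteq> id (a, \<beta>)" if "a \<in> S" "\<beta> \<in> ?Z" for a \<beta>
    using that S(1) by (simp add: skew_product_def subset_iff)
  then have "S \<times> ?Z \<subseteq> {y \<in> A \<times> ?Z. skew_product A B id L y \<noteq> id y}"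
    using S(1) by blast
  then have "card (S \<times> ?Z) \<le> card {y \<in> A \<times> ?Z. skew_product A B id L y \<noteq> id y}"
    using fin Z by (intro card_mono) auto
  then have "real (card S) * real (card ?Z) \<le> real (card {y \<in> A \<times> ?Z. skew_product A B id L y \<noteq> id y})"
    by (simp add: card_cartesian_product flip: of_nat_mult)
  moreover have "(1 - \<epsilon>) * real (card A) * real (card ?Z) < real (card S) * real (card ?Z)"
    using mult_strict_right_mono[OF S(2), of "real (card ?Z)"] cZ by linarith
  ultimately have "(1 - \<epsilon>) * (real (card A) * real (card ?Z))
      < real (card {y \<in> A \<times> ?Z. skew_product A B id L y \<noteq> id y})"
    by linarith
  moreover have "hamming_dist (A \<times> ?Z) (skew_product A B id L) id =
      real (card {y \<in> A \<times> ?Z. skew_product A B id L y \<noteq> id y}) / (real (card A) * real (card ?Z))"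
    using hamming_dist_eq[of "A \<times> ?Z" "skew_product A B id L" id] fin(1,2) Z
    by (simp only: card_cartesian_product of_nat_mult finite_cartesian_product Times_empty simp_thms)
  moreover have "0 < real (card A) * real (card ?Z)" using cA cZ by simp
  ultimately show ?thesis by (simp only: pos_less_divide_eq)
qed

section \<open>Approximation of the symmetric enrichment\<close>

lemma symmetric_enrichment_simps:
  "carrier (symmetric_enrichment \<Gamma> X \<alpha>) = carrier (fin_sym X) \<times> carrier \<Gamma>"
  "\<one>\<^bsub>symmetric_enrichment \<Gamma> X \<alpha>\<^esub> = (id, \<one>\<^bsub>\<Gamma>\<^esub>)"
  "(\<sigma>, g) \<otimes>\<^bsub>symmetric_enrichment \<Gamma> X \<alpha>\<^esub> (\<tau>, h) = (\<sigma> \<circ> conj_action X \<alpha> g \<tau>, g \<otimes>\<^bsub>\<Gamma>\<^esub> h)"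
  by (simp_all add: symmetric_enrichment_def semidirect_product_def fin_sym_def sym_on_def)

text \<open>The bound \<open>m \<ge> 2\<close> is asked because a trivial group carries no metric of
  diameter one, as the weakly sofic case demands. Separation is claimed only for trivial second
  component, with a bound that depends neither on \<open>F\<close> nor on
  \<open>\<epsilon>\<close>.\<close>

lemma enrichment_permutation_approximation:
  fixes \<Gamma> :: "('g, 'm) monoid_scheme" and X :: "'x set" and \<alpha> :: "'g \<Rightarrow> 'x \<Rightarrow> 'x"
  defines "\<S> \<equiv> symmetric_enrichment \<Gamma> X \<alpha>"
  assumes act: "group_action \<Gamma> X \<alpha>" and sof: "sofic_action \<Gamma> X \<alpha>"
    and F: "finite F" "F \<subseteq> carrier \<S>" and "\<epsilon> > 0"
  obtains m T where "m \<ge> 2" "T \<in> carrier \<S> \<rightarrow> carrier (sym_group m)" "T \<one>\<^bsub>\<S>\<^esub> = id"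
    "approx_multiplicative \<S> (sym_group m) (hamming_dist {1..m}) F \<epsilon> T"
    "\<And>\<sigma>. \<lbrakk>(\<sigma>, \<one>\<^bsub>\<Gamma>\<^esub>) \<in> F; \<sigma> \<noteq> id\<rbrakk> \<Longrightarrow> hamming_dist {1..m} (T (\<sigma>, \<one>\<^bsub>\<Gamma>\<^esub>)) id \<ge> 1 / 2"
proof -
  interpret group_action \<Gamma> X \<alpha> by fact
  define a where "a g = perm_of X (\<alpha> g)" for g
  \<comment> \<open>\<open>D\<close> collects the supports of all first components. Adding its
    translates by the second components makes room in \<open>E\<close> for the supports of the
    conjugates that occur in products.\<close>
  define D where "D = (\<Union>\<sigma>\<in>fst ` F. {x. \<sigma> x \<noteq> x})"
  define E where "E = D \<union> (\<Union>g\<in>snd ` F. a g ` D)"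
  \<comment> \<open>The factor 3 pays for the three bad sets of a product; the cap
    \<open>1 / 2\<close> keeps the displacement \<open>1 - \<epsilon>'\<close> at
    \<open>1 / 2\<close> or more.\<close>
  define \<epsilon>' where "\<epsilon>' = min (\<epsilon> / 3) (1 / 2)"
  have \<epsilon>': "\<epsilon>' > 0" "3 * \<epsilon>' \<le> \<epsilon>" "\<epsilon>' \<le> 1 / 2" using \<open>\<epsilon> > 0\<close> by (auto simp: \<epsilon>'_def)
  have F1: "\<sigma> permutes X" "finite {x. \<sigma> x \<noteq> x}" "g \<in> carrier \<Gamma>" if "(\<sigma>, g) \<in> F" for \<sigma> g
    using F(2) that by (auto simp: \<S>_def symmetric_enrichment_simps fin_sym_def)
  have a: "a g permutes X" if "g \<in> carrier \<Gamma>" for g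
    unfolding a_def by (rule perm_of_permutes[OF act that])
  have suppX: "{x. \<sigma> x \<noteq> x} \<subseteq> X" if "\<sigma> permutes X" for \<sigma> :: "'x \<Rightarrow> 'x"
    using that by (auto dest: permutes_not_in)
  have DX: "D \<subseteq> X" unfolding D_def using F1(1) suppX by fastforce
  have finD: "finite D" unfolding D_def using F(1) F1(2) by force
  have finE: "finite E" unfolding E_def using finD F(1) by auto
  have EX: "E \<subseteq> X"
  proof -
    have "a g ` D \<subseteq> X" if "g \<in> snd ` F" for g
      using that F1(3) a DX by (force simp: permutes_in_image)
    then show ?thesis using DX by (auto simp: E_def)
  qed
  have permD: "\<sigma> permutes D" if "(\<sigma>, g) \<in> F" for \<sigma> g
    by (rule permutes_superset[OF F1(1)[OF that]]) (use that in \<open>force simp: D_def\<close>)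
  have DE: "D \<subseteq> E" "\<And>g. g \<in> snd ` F \<Longrightarrow> a g ` D \<subseteq> E" by (auto simp: E_def)
  have "snd ` F \<subseteq> carrier \<Gamma>" using F1(3) by auto
  then obtain A :: "nat set" and \<phi> where A: "finite A"
    and \<phi>: "\<phi> \<in> carrier \<Gamma> \<rightarrow> carrier (sym_on A)" "unital \<Gamma> (sym_on A) \<phi>"
      "approx_multiplicative \<Gamma> (sym_on A) (hamming_dist A) (snd ` F) \<epsilon>' \<phi>"
      "orbit_approximation X \<alpha> A (snd ` F) E \<epsilon>' \<phi>"
    using sof F(1) finE EX \<epsilon>'(1) unfolding sofic_action_def by (metis finite_imageI)
  obtain B0 :: "nat set" and S \<pi> where B0_S_\<pi>: "finite B0 \<and> S \<subseteq> A \<and> real (card S) > (1 - \<epsilon>') * real (card A) \<and>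
      (\<forall>s\<in>S. inj_on (\<pi> s) E \<and> \<pi> s ` E \<subseteq> B0) \<and>
      (\<forall>g\<in>snd ` F. \<forall>x\<in>E. \<forall>s\<in>S. \<phi> g s \<in> S \<and> inv_into X (\<alpha> g) x \<in> E \<longrightarrow>
         \<pi> (\<phi> g s) x = \<pi> s (inv_into X (\<alpha> g) x))"
    using \<phi>(4) unfolding orbit_approximation_def by (elim exE) (rule that)
  have B0: "finite B0" and S: "S \<subseteq> A" "real (card S) > (1 - \<epsilon>') * real (card A)"
    and \<pi>: "\<And>s. s \<in> S \<Longrightarrow> inj_on (\<pi> s) E" "\<And>s. s \<in> S \<Longrightarrow> \<pi> s ` E \<subseteq> B0"
    using B0_S_\<pi> by simp_all
  have orb: "\<pi> (\<phi> g s) x = \<pi> s (inv_into X (\<alpha> g) x)"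
    if "g \<in> snd ` F" "x \<in> E" "s \<in> S" "\<phi> g s \<in> S" "inv_into X (\<alpha> g) x \<in> E" for g x s
    using B0_S_\<pi> that by blast
  have Ane: "A \<noteq> {}" using S by auto
  have \<phi>A: "\<phi> g permutes A" if "g \<in> carrier \<Gamma>" for g
    using \<phi>(1) that by (auto simp: sym_on_def)
  have \<phi>1: "\<phi> \<one>\<^bsub>\<Gamma>\<^esub> = id" using \<phi>(2) by (simp add: unital_def sym_on_def)
  \<comment> \<open>The two extra points only serve to make the permutation group of \<open>B\<close> nontrivial.\<close>
  define B where "B = B0 \<union> {0, 1}"
  have B: "finite B" using B0 by (simp add: B_def)
  \<comment> \<open>Nothing is known of the injections off \<open>S\<close>, and only permutations
    of \<open>E\<close> can be transported. The default \<open>id\<close> still makes the skew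
    product a permutation for every element of the enrichment, not just for those in
    \<open>F\<close>.\<close>
  define L where "L \<sigma> s = (if s \<in> S \<and> \<sigma> permutes E then map_permutation E (\<pi> s) \<sigma> else id)" for \<sigma> s
  have L: "L \<sigma> s permutes B" for \<sigma> s
  proof (cases "s \<in> S \<and> \<sigma> permutes E")
    case True
    then have "map_permutation E (\<pi> s) \<sigma> permutes \<pi> s ` E"
      using \<pi>(1) by (intro map_permutation_permutes bij_betw_imageI) auto
    then have "map_permutation E (\<pi> s) \<sigma> permutes B"
      by (rule permutes_subset) (use True \<pi>(2)[of s] in \<open>auto simp: B_def\<close>)
    then show ?thesis using True by (simp add: L_def)
  qed (auto simp: L_def permutes_id)
  have L_id: "L id s = id" for s
    using \<pi>(1) by (simp add: L_def map_permutation_id')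
  define Y where "Y = A \<times> {\<beta>. \<beta> permutes B}"
  have Y: "finite Y" using A B by (simp add: Y_def finite_permutations)
  have "card {0, 1 :: nat} \<le> card B" by (rule card_mono[OF B]) (simp add: B_def)
  then have "fact 2 \<le> (fact (card B) :: nat)" by (intro fact_mono) simp
  moreover have "card A \<ge> 1" using A Ane by (simp add: Suc_leI card_gt_0_iff)
  ultimately have "1 * 2 \<le> card A * fact (card B)" by (intro mult_le_mono) auto
  then have m: "card Y \<ge> 2" using card_permutations[OF refl B] by (simp add: Y_def card_cartesian_product)
  \<comment> \<open>The points of \<open>Y\<close> are relabelled because \<open>sym_group\<close>
    acts on an initial segment of the positive integers; relabelling preserves the Hamming
    metric.\<close>
  obtain f where f: "bij_betw f Y {1..card Y}"
    using finite_same_card_bij[OF Y, of "{1..card Y}"] by auto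
  have finj: "inj_on f Y" and fim: "f ` Y = {1..card Y}" using f by (auto simp: bij_betw_def)
  define U where "U = (\<lambda>(\<sigma>, g). skew_product A B (\<phi> g) (L \<sigma>))"
  have U: "U (\<sigma>, g) permutes Y" if "g \<in> carrier \<Gamma>" for \<sigma> g
    unfolding U_def Y_def prod.case by (intro skew_product_permutes A B \<phi>A that L)
  define T where "T x = map_permutation Y f (U x)" for x
  have T: "T \<in> carrier \<S> \<rightarrow> carrier (sym_group (card Y))"
    using map_permutation_permutes[OF f U]
    by (auto simp: T_def \<S>_def symmetric_enrichment_simps sym_group_def)
  have U1: "U (id, \<one>\<^bsub>\<Gamma>\<^esub>) = id"
    by (auto simp: U_def skew_product_def \<phi>1 L_id fun_eq_iff)
  have T1: "T \<one>\<^bsub>\<S>\<^esub> = id"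
    by (simp add: T_def \<S>_def symmetric_enrichment_simps U1 map_permutation_id'[OF finj])
  have am: "approx_multiplicative \<S> (sym_group (card Y)) (hamming_dist {1..card Y}) F \<epsilon> T"
    unfolding approx_multiplicative_def
  proof (intro ballI impI)
    fix x y assume xy: "x \<in> F" "y \<in> F" "x \<otimes>\<^bsub>\<S>\<^esub> y \<in> F"
    obtain \<sigma> g \<tau> h where x: "x = (\<sigma>, g)" and y: "y = (\<tau>, h)" by (metis surj_pair)
    have prod: "x \<otimes>\<^bsub>\<S>\<^esub> y = (\<sigma> \<circ> (a g \<circ> \<tau> \<circ> inv' (a g)), g \<otimes>\<^bsub>\<Gamma>\<^esub> h)"
      by (simp add: x y \<S>_def symmetric_enrichment_simps conj_action_def a_def)
    have g: "g \<in> carrier \<Gamma>" "g \<in> snd ` F" and h: "h \<in> carrier \<Gamma>" "h \<in> snd ` F"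
      using xy F1(3) x y by force+
    have gh: "g \<otimes>\<^bsub>\<Gamma>\<^esub> h \<in> carrier \<Gamma>" "g \<otimes>\<^bsub>\<Gamma>\<^esub> h \<in> snd ` F"
      using xy(3) F1(3) unfolding prod by force+
    have \<tau>: "\<tau> permutes D" "\<tau> permutes E" and \<sigma>: "\<sigma> permutes E"
      using permD xy(1,2) x y permutes_subset[OF _ DE(1)] by blast+
    have conj: "a g \<circ> \<tau> \<circ> inv' (a g) permutes E"
    proof -
      have "bij_betw (a g) D (a g ` D)"
        using permutes_inj[OF a[OF g(1)]] by (intro bij_betw_imageI) (auto intro: inj_on_subset)
      then have "map_permutation D (a g) \<tau> permutes a g ` D" using \<tau>(1) by (rule map_permutation_permutes)
      then show ?thesis
        using map_permutation_eq_conj[OF a[OF g(1)] DX \<tau>(1)] permutes_subset[OF _ DE(2)[OF g(2)]] by simp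
    qed
    \<comment> \<open>The transport of the product splits into that of \<open>\<sigma>\<close> and
      that of the conjugate of \<open>\<tau>\<close>, both at \<open>\<phi> g (\<phi> h b)\<close>.
      By equivariance the latter equals the transport of \<open>\<tau>\<close> at
      \<open>\<phi> h b\<close>.\<close>
    have cocycle: "L (\<sigma> \<circ> (a g \<circ> \<tau> \<circ> inv' (a g))) (\<phi> (g \<otimes>\<^bsub>\<Gamma>\<^esub> h) b) = L \<sigma> (\<phi> g (\<phi> h b)) \<circ> L \<tau> (\<phi> h b)"
      if b: "\<phi> (g \<otimes>\<^bsub>\<Gamma>\<^esub> h) b = \<phi> g (\<phi> h b)" "\<phi> h b \<in> S" "\<phi> g (\<phi> h b) \<in> S" for b
    proof -
      let ?t = "\<phi> h b"
      have "\<pi> (\<phi> g ?t) (a g z) = \<pi> ?t z" if z: "z \<in> D" for z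
      proof -
        have zX: "z \<in> X" using z DX by blast
        then have az: "a g z = \<alpha> g z" by (simp add: a_def perm_of_def)
        \<comment> \<open>The orbit condition speaks of inverse images, so it is evaluated at
          \<open>a g z\<close>, whose inverse image is \<open>z\<close>; both points lie in
          \<open>E\<close> by its choice.\<close>
        have iz: "inv_into X (\<alpha> g) (a g z) = z"
          unfolding az using inj_prop[OF g(1)] zX by (rule inv_into_f_f)
        have "a g z \<in> E" using DE(2)[OF g(2)] z by blast
        moreover have "z \<in> E" using DE(1) z by blast
        ultimately show ?thesis using orb[OF g(2) _ b(2,3), of "a g z"] by (simp only: iz)
      qed
      then have "map_permutation E (\<pi> (\<phi> g ?t)) (a g \<circ> \<tau> \<circ> inv' (a g)) = map_permutation E (\<pi> ?t) \<tau>"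
        by (rule map_permutation_conj[OF \<pi>(1)[OF b(2)] \<pi>(1)[OF b(3)] DE(1) DE(2)[OF g(2)] DX a[OF g(1)] \<tau>(1)])
      moreover have "\<sigma> \<circ> (a g \<circ> \<tau> \<circ> inv' (a g)) permutes E" by (rule permutes_compose[OF conj \<sigma>])
      ultimately show ?thesis
        using b \<sigma> \<tau>(2) map_permutation_compose'[OF \<pi>(1)[OF b(3)] conj, of \<sigma>] by (simp add: L_def)
    qed
    have "hamming_dist A (\<phi> (g \<otimes>\<^bsub>\<Gamma>\<^esub> h)) (\<phi> g \<circ> \<phi> h) < \<epsilon>'"
      using \<phi>(3)[unfolded approx_multiplicative_def, rule_format, OF g(2) h(2) gh(2)]
      by (simp add: sym_on_def)
    then have "hamming_dist Y (U (\<sigma> \<circ> (a g \<circ> \<tau> \<circ> inv' (a g)), g \<otimes>\<^bsub>\<Gamma>\<^esub> h)) (U (\<sigma>, g) \<circ> U (\<tau>, h)) < 3 * \<epsilon>'"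
      unfolding U_def Y_def prod.case
      by (intro skew_product_hamming_le[OF A Ane B \<phi>A[OF g(1)] \<phi>A[OF h(1)] L S] cocycle)
    also have "hamming_dist Y (U (\<sigma> \<circ> (a g \<circ> \<tau> \<circ> inv' (a g)), g \<otimes>\<^bsub>\<Gamma>\<^esub> h)) (U (\<sigma>, g) \<circ> U (\<tau>, h))
        = hamming_dist {1..card Y} (T (x \<otimes>\<^bsub>\<S>\<^esub> y)) (T x \<circ> T y)"
      unfolding T_def prod unfolding x y
      using hamming_dist_map_permutation[OF finj Y U[OF gh(1)] permutes_compose[OF U[OF h(1)] U[OF g(1)]]]
        map_permutation_compose'[OF finj U[OF h(1)]] by (simp only: fim)
    finally show "hamming_dist {1..card Y} (T (x \<otimes>\<^bsub>\<S>\<^esub> y)) (T x \<otimes>\<^bsub>sym_group (card Y)\<^esub> T y) < \<epsilon>"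
      using \<epsilon>'(2) by (simp add: sym_group_def)
  qed
  have sep: "hamming_dist {1..card Y} (T (\<sigma>, \<one>\<^bsub>\<Gamma>\<^esub>)) id \<ge> 1 / 2" if \<sigma>: "(\<sigma>, \<one>\<^bsub>\<Gamma>\<^esub>) \<in> F" "\<sigma> \<noteq> id" for \<sigma>
  proof -
    have one: "\<one>\<^bsub>\<Gamma>\<^esub> \<in> carrier \<Gamma>" using F1(3) \<sigma>(1) by blast
    have "\<sigma> permutes E" using permutes_subset[OF permD[OF \<sigma>(1)] DE(1)] .
    then have "L \<sigma> s \<noteq> id" if "s \<in> S" for s
      using that \<sigma>(2) map_permutation_eq_id_iff[OF \<pi>(1)[OF that]] by (simp add: L_def)
    then have "hamming_dist Y (U (\<sigma>, \<one>\<^bsub>\<Gamma>\<^esub>)) id > 1 - \<epsilon>'"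
      unfolding U_def Y_def prod.case \<phi>1 by (intro skew_product_hamming_ge[OF A Ane B S])
    also have "hamming_dist Y (U (\<sigma>, \<one>\<^bsub>\<Gamma>\<^esub>)) id = hamming_dist {1..card Y} (T (\<sigma>, \<one>\<^bsub>\<Gamma>\<^esub>)) id"
      unfolding T_def
      using hamming_dist_map_permutation[OF finj Y U[OF one] permutes_id, of \<sigma>]
      by (simp only: fim map_permutation_id'[OF finj])
    finally show ?thesis using \<epsilon>'(3) by simp
  qed
  show thesis by (rule that[OF m T T1 am sep])
qed

section \<open>Conditions on the family and combination of the two maps\<close>

text \<open>One \<open>\<delta>\<close> must serve all degrees \<open>m\<close>, since
  \<open>m\<close> is found only after the Hamming tolerance has been set. A general modulus, rather
  than a Lipschitz bound, is forced by the Hilbert-Schmidt metric, which behaves like the square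
  root of the Hamming metric. The threshold \<open>1 / 2\<close> is the displacement that the skew
  product guarantees.\<close>

definition perm_representable :: "('h monoid \<times> ('h \<Rightarrow> 'h \<Rightarrow> real)) set \<Rightarrow> bool" where
  "perm_representable \<G> \<longleftrightarrow> (\<exists>c>0. \<forall>\<eta>>0. \<exists>\<delta>>0. \<forall>m\<ge>2. \<exists>G d \<iota>. (G, d) \<in> \<G> \<and>
     \<iota> \<in> hom (sym_group m) G \<and>
     (\<forall>p q. p permutes {1..m} \<and> q permutes {1..m} \<longrightarrow>
        (hamming_dist {1..m} p q < \<delta> \<longrightarrow> d (\<iota> p) (\<iota> q) < \<eta>) \<and>
        (hamming_dist {1..m} p id \<ge> 1 / 2 \<longrightarrow> d (\<iota> p) \<one>\<^bsub>G\<^esub> > c)))"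

text \<open>Coefficient 1 in the upper bound lets two errors below \<open>\<epsilon> / 2\<close> add
  up to less than \<open>\<epsilon>\<close>; the lower bounds preserve separation by either factor,
  with one \<open>\<kappa>\<close> for the whole family.\<close>

definition product_closed :: "('h monoid \<times> ('h \<Rightarrow> 'h \<Rightarrow> real)) set \<Rightarrow> bool" where
  "product_closed \<G> \<longleftrightarrow> (\<exists>\<kappa>>0. \<forall>G\<^sub>1 d\<^sub>1 G\<^sub>2 d\<^sub>2. (G\<^sub>1, d\<^sub>1) \<in> \<G> \<and> (G\<^sub>2, d\<^sub>2) \<in> \<G> \<longrightarrow>
     (\<exists>G d \<iota>. (G, d) \<in> \<G> \<and> \<iota> \<in> hom (G\<^sub>1 \<times>\<times> G\<^sub>2) G \<and>
       (\<forall>x\<^sub>1\<in>carrier G\<^sub>1. \<forall>y\<^sub>1\<in>carrier G\<^sub>1. \<forall>x\<^sub>2\<in>carrier G\<^sub>2. \<forall>y\<^sub>2\<in>carrier G\<^sub>2.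
          d (\<iota> (x\<^sub>1, x\<^sub>2)) (\<iota> (y\<^sub>1, y\<^sub>2)) \<le> d\<^sub>1 x\<^sub>1 y\<^sub>1 + d\<^sub>2 x\<^sub>2 y\<^sub>2 \<and>
          \<kappa> * d\<^sub>1 x\<^sub>1 y\<^sub>1 \<le> d (\<iota> (x\<^sub>1, x\<^sub>2)) (\<iota> (y\<^sub>1, y\<^sub>2)) \<and>
          \<kappa> * d\<^sub>2 x\<^sub>2 y\<^sub>2 \<le> d (\<iota> (x\<^sub>1, x\<^sub>2)) (\<iota> (y\<^sub>1, y\<^sub>2)))))"

theorem approximable_symmetric_enrichment:
  fixes \<Gamma> :: "('g, 'm) monoid_scheme" and X :: "'x set" and \<alpha> :: "'g \<Rightarrow> 'x \<Rightarrow> 'x"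
  assumes act: "group_action \<Gamma> X \<alpha>" and sof: "sofic_action \<Gamma> X \<alpha>"
    and grp: "\<And>G d. (G, d) \<in> \<G> \<Longrightarrow> group G"
    and app: "approximable \<G> \<Gamma>" and rep: "perm_representable \<G>" and prod: "product_closed \<G>"
  shows "approximable \<G> (symmetric_enrichment \<Gamma> X \<alpha>)"
proof -
  define \<S> where "\<S> = symmetric_enrichment \<Gamma> X \<alpha>"
  interpret \<Gamma>: group \<Gamma> using app by (simp add: approximable_iff)
  have S_simps: "carrier \<S> = carrier (fin_sym X) \<times> carrier \<Gamma>" "\<one>\<^bsub>\<S>\<^esub> = (id, \<one>\<^bsub>\<Gamma>\<^esub>)"
    by (simp_all add: \<S>_def symmetric_enrichment_simps)
  have snd_mult: "snd (x \<otimes>\<^bsub>\<S>\<^esub> y) = snd x \<otimes>\<^bsub>\<Gamma>\<^esub> snd y" for x y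
    by (cases x, cases y) (simp add: \<S>_def symmetric_enrichment_simps)
  interpret S: group \<S> unfolding \<S>_def by (rule group_symmetric_enrichment[OF act])
  obtain c1 where c1: "c1 > 0" "\<And>F \<epsilon>. finite F \<and> F \<subseteq> carrier \<Gamma> \<and> \<epsilon> > 0 \<Longrightarrow>
        (\<exists>G d \<phi>. (G, d) \<in> \<G> \<and> \<phi> \<in> carrier \<Gamma> \<rightarrow> carrier G \<and> unital \<Gamma> G \<phi> \<and>
           approx_multiplicative \<Gamma> G d F \<epsilon> \<phi> \<and> separating \<Gamma> G d F c1 \<phi>)"
    using app unfolding approximable_iff by blast
  obtain c2 where c2: "c2 > 0" "\<And>\<eta>. \<eta> > 0 \<Longrightarrow> \<exists>\<delta>>0. \<forall>m\<ge>2. \<exists>G d \<iota>. (G, d) \<in> \<G> \<and>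
     \<iota> \<in> hom (sym_group m) G \<and>
     (\<forall>p q. p permutes {1..m} \<and> q permutes {1..m} \<longrightarrow>
        (hamming_dist {1..m} p q < \<delta> \<longrightarrow> d (\<iota> p) (\<iota> q) < \<eta>) \<and>
        (hamming_dist {1..m} p id \<ge> 1 / 2 \<longrightarrow> d (\<iota> p) \<one>\<^bsub>G\<^esub> > c2))"
    using rep unfolding perm_representable_def by blast
  obtain \<kappa> where \<kappa>: "\<kappa> > 0" "\<forall>G\<^sub>1 d\<^sub>1 G\<^sub>2 d\<^sub>2. (G\<^sub>1, d\<^sub>1) \<in> \<G> \<and> (G\<^sub>2, d\<^sub>2) \<in> \<G> \<longrightarrow>
     (\<exists>G d \<iota>. (G, d) \<in> \<G> \<and> \<iota> \<in> hom (G\<^sub>1 \<times>\<times> G\<^sub>2) G \<and>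
       (\<forall>x\<^sub>1\<in>carrier G\<^sub>1. \<forall>y\<^sub>1\<in>carrier G\<^sub>1. \<forall>x\<^sub>2\<in>carrier G\<^sub>2. \<forall>y\<^sub>2\<in>carrier G\<^sub>2.
          d (\<iota> (x\<^sub>1, x\<^sub>2)) (\<iota> (y\<^sub>1, y\<^sub>2)) \<le> d\<^sub>1 x\<^sub>1 y\<^sub>1 + d\<^sub>2 x\<^sub>2 y\<^sub>2 \<and>
          \<kappa> * d\<^sub>1 x\<^sub>1 y\<^sub>1 \<le> d (\<iota> (x\<^sub>1, x\<^sub>2)) (\<iota> (y\<^sub>1, y\<^sub>2)) \<and>
          \<kappa> * d\<^sub>2 x\<^sub>2 y\<^sub>2 \<le> d (\<iota> (x\<^sub>1, x\<^sub>2)) (\<iota> (y\<^sub>1, y\<^sub>2))))"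
    using prod unfolding product_closed_def by (elim exE conjE) (rule that)
  \<comment> \<open>Separation by one factor survives in the product up to \<open>\<kappa>\<close>;
    the minimum covers whichever factor separates.\<close>
  define c where "c = \<kappa> * min c1 c2"
  have c: "c > 0" "c \<le> \<kappa> * c1" "c \<le> \<kappa> * c2" using c1(1) c2(1) \<kappa>(1) by (auto simp: c_def)
  have "\<exists>G d \<phi>. (G, d) \<in> \<G> \<and> \<phi> \<in> carrier \<S> \<rightarrow> carrier G \<and> unital \<S> G \<phi> \<and>
           approx_multiplicative \<S> G d F \<epsilon> \<phi> \<and> separating \<S> G d F c \<phi>"
    if F: "finite F" "F \<subseteq> carrier \<S>" and \<epsilon>: "\<epsilon> > 0" for F \<epsilon>
  proof -
    have "finite (snd ` F) \<and> snd ` F \<subseteq> carrier \<Gamma> \<and> \<epsilon> / 2 > 0" using F \<epsilon> by (auto simp: S_simps)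
    from c1(2)[OF this] obtain G1 d1 \<theta> where G1: "(G1, d1) \<in> \<G>"
      and \<theta>: "\<theta> \<in> carrier \<Gamma> \<rightarrow> carrier G1" "unital \<Gamma> G1 \<theta>"
        "approx_multiplicative \<Gamma> G1 d1 (snd ` F) (\<epsilon> / 2) \<theta>" "separating \<Gamma> G1 d1 (snd ` F) c1 \<theta>"
      by blast
    have "\<epsilon> / 2 > 0" using \<epsilon> by simp
    from c2(2)[OF this] obtain \<delta> where \<delta>: "\<delta> > 0" "\<And>m. m \<ge> 2 \<Longrightarrow> \<exists>G d \<iota>. (G, d) \<in> \<G> \<and>
     \<iota> \<in> hom (sym_group m) G \<and>
     (\<forall>p q. p permutes {1..m} \<and> q permutes {1..m} \<longrightarrow>
        (hamming_dist {1..m} p q < \<delta> \<longrightarrow> d (\<iota> p) (\<iota> q) < \<epsilon> / 2) \<and>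
        (hamming_dist {1..m} p id \<ge> 1 / 2 \<longrightarrow> d (\<iota> p) \<one>\<^bsub>G\<^esub> > c2))" by blast
    \<comment> \<open>The tolerance is \<open>\<delta>\<close>, so that the image of
      \<open>T\<close> in the group chosen next is multiplicative up to
      \<open>\<epsilon> / 2\<close>.\<close>
    obtain m T where m: "m \<ge> 2" and T: "T \<in> carrier \<S> \<rightarrow> carrier (sym_group m)" "T \<one>\<^bsub>\<S>\<^esub> = id"
      "approx_multiplicative \<S> (sym_group m) (hamming_dist {1..m}) F \<delta> T"
      "\<And>\<sigma>. \<lbrakk>(\<sigma>, \<one>\<^bsub>\<Gamma>\<^esub>) \<in> F; \<sigma> \<noteq> id\<rbrakk> \<Longrightarrow> hamming_dist {1..m} (T (\<sigma>, \<one>\<^bsub>\<Gamma>\<^esub>)) id \<ge> 1 / 2"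
      using enrichment_permutation_approximation[OF act sof F[unfolded \<S>_def] \<delta>(1)] unfolding \<S>_def by blast
    from \<delta>(2)[OF m] obtain G2 d2 \<iota> where G2: "(G2, d2) \<in> \<G>"
      and \<iota>: "\<iota> \<in> hom (sym_group m) G2"
        "\<And>p q. \<lbrakk>p permutes {1..m}; q permutes {1..m}; hamming_dist {1..m} p q < \<delta>\<rbrakk> \<Longrightarrow> d2 (\<iota> p) (\<iota> q) < \<epsilon> / 2"
        "\<And>p. \<lbrakk>p permutes {1..m}; hamming_dist {1..m} p id \<ge> 1 / 2\<rbrakk> \<Longrightarrow> d2 (\<iota> p) \<one>\<^bsub>G2\<^esub> > c2"
      by metis
    from \<kappa>(2)[rule_format, OF conjI[OF G1 G2]] obtain G d \<rho> where G: "(G, d) \<in> \<G>"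
      and \<rho>: "\<rho> \<in> hom (G1 \<times>\<times> G2) G"
        "\<And>x1 y1 x2 y2. \<lbrakk>x1 \<in> carrier G1; y1 \<in> carrier G1; x2 \<in> carrier G2; y2 \<in> carrier G2\<rbrakk> \<Longrightarrow>
          d (\<rho> (x1, x2)) (\<rho> (y1, y2)) \<le> d1 x1 y1 + d2 x2 y2 \<and>
          \<kappa> * d1 x1 y1 \<le> d (\<rho> (x1, x2)) (\<rho> (y1, y2)) \<and>
          \<kappa> * d2 x2 y2 \<le> d (\<rho> (x1, x2)) (\<rho> (y1, y2))"
      by blast
    interpret G1: group G1 by (rule grp[OF G1])
    interpret G2: group G2 by (rule grp[OF G2])
    define \<psi> where "\<psi> x = \<rho> (\<theta> (snd x), \<iota> (T x))" for x
    have \<theta>C: "\<theta> (snd x) \<in> carrier G1" if "x \<in> carrier \<S>" for x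
      using \<theta>(1) that by (auto simp: S_simps)
    have Tp: "T x permutes {1..m}" if "x \<in> carrier \<S>" for x
      using T(1) that by (auto simp: sym_group_def)
    have \<iota>C: "\<iota> p \<in> carrier G2" if "p permutes {1..m}" for p
      using \<iota>(1) that by (auto simp: hom_def sym_group_def)
    have \<iota>T: "\<iota> (T x) \<in> carrier G2" if "x \<in> carrier \<S>" for x using \<iota>C[OF Tp[OF that]] .
    have \<iota>m: "\<iota> (p \<circ> q) = \<iota> p \<otimes>\<^bsub>G2\<^esub> \<iota> q" if "p permutes {1..m}" "q permutes {1..m}" for p q
      using hom_mult[OF \<iota>(1), of p q] that by (simp add: sym_group_def)
    have \<theta>1: "\<theta> \<one>\<^bsub>\<Gamma>\<^esub> = \<one>\<^bsub>G1\<^esub>" using \<theta>(2) by (simp add: unital_def)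
    have one: "\<one>\<^bsub>G1\<^esub> \<in> carrier G1" "\<one>\<^bsub>G2\<^esub> \<in> carrier G2" by simp_all
    have \<iota>1: "\<iota> id = \<one>\<^bsub>G2\<^esub>"
      using hom_one[OF \<iota>(1) sym_group_is_group grp[OF G2]] by (simp add: sym_group_def)
    have \<rho>1: "\<rho> (\<one>\<^bsub>G1\<^esub>, \<one>\<^bsub>G2\<^esub>) = \<one>\<^bsub>G\<^esub>"
      using hom_one[OF \<rho>(1) DirProd_group[OF grp[OF G1] grp[OF G2]] grp[OF G]] by simp
    have "\<psi> \<in> carrier \<S> \<rightarrow> carrier G"
      using hom_in_carrier[OF \<rho>(1)] \<theta>C \<iota>T by (auto simp: \<psi>_def)
    moreover have "unital \<S> G \<psi>"
      using \<rho>1 \<theta>1 \<iota>1 T(2) by (simp add: unital_def \<psi>_def S_simps)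
    moreover have "approx_multiplicative \<S> G d F \<epsilon> \<psi>"
      unfolding approx_multiplicative_def
    proof (intro ballI impI)
      fix x y assume xy: "x \<in> F" "y \<in> F" "x \<otimes>\<^bsub>\<S>\<^esub> y \<in> F"
      have x: "x \<in> carrier \<S>" and y: "y \<in> carrier \<S>" and z: "x \<otimes>\<^bsub>\<S>\<^esub> y \<in> carrier \<S>"
        using F xy by blast+
      have "d1 (\<theta> (snd (x \<otimes>\<^bsub>\<S>\<^esub> y))) (\<theta> (snd x) \<otimes>\<^bsub>G1\<^esub> \<theta> (snd y)) < \<epsilon> / 2"
        using \<theta>(3) imageI[OF xy(1), of snd] imageI[OF xy(2), of snd] imageI[OF xy(3), of snd]
        unfolding approx_multiplicative_def snd_mult by blast
      moreover have "hamming_dist {1..m} (T (x \<otimes>\<^bsub>\<S>\<^esub> y)) (T x \<circ> T y) < \<delta>"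
        using T(3) xy unfolding approx_multiplicative_def by (simp add: sym_group_def)
      then have "d2 (\<iota> (T (x \<otimes>\<^bsub>\<S>\<^esub> y))) (\<iota> (T x) \<otimes>\<^bsub>G2\<^esub> \<iota> (T y)) < \<epsilon> / 2"
        using \<iota>(2)[OF Tp[OF z] permutes_compose[OF Tp[OF y] Tp[OF x]]] by (simp only: \<iota>m[OF Tp[OF x] Tp[OF y]])
      moreover have "d (\<psi> (x \<otimes>\<^bsub>\<S>\<^esub> y)) (\<rho> (\<theta> (snd x) \<otimes>\<^bsub>G1\<^esub> \<theta> (snd y), \<iota> (T x) \<otimes>\<^bsub>G2\<^esub> \<iota> (T y)))
          \<le> d1 (\<theta> (snd (x \<otimes>\<^bsub>\<S>\<^esub> y))) (\<theta> (snd x) \<otimes>\<^bsub>G1\<^esub> \<theta> (snd y)) +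
            d2 (\<iota> (T (x \<otimes>\<^bsub>\<S>\<^esub> y))) (\<iota> (T x) \<otimes>\<^bsub>G2\<^esub> \<iota> (T y))"
        unfolding \<psi>_def
        using \<rho>(2)[OF \<theta>C[OF z] G1.m_closed[OF \<theta>C[OF x] \<theta>C[OF y]] \<iota>T[OF z] G2.m_closed[OF \<iota>T[OF x] \<iota>T[OF y]]]
        by (rule conjunct1)
      moreover have "\<rho> (\<theta> (snd x) \<otimes>\<^bsub>G1\<^esub> \<theta> (snd y), \<iota> (T x) \<otimes>\<^bsub>G2\<^esub> \<iota> (T y)) = \<psi> x \<otimes>\<^bsub>G\<^esub> \<psi> y"
        using hom_mult[OF \<rho>(1), of "(\<theta> (snd x), \<iota> (T x))" "(\<theta> (snd y), \<iota> (T y))"] x y \<theta>C \<iota>T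
        by (simp add: \<psi>_def)
      ultimately show "d (\<psi> (x \<otimes>\<^bsub>\<S>\<^esub> y)) (\<psi> x \<otimes>\<^bsub>G\<^esub> \<psi> y) < \<epsilon>" by simp
    qed
    moreover have "separating \<S> G d F c \<psi>"
      unfolding separating_def
    proof (intro ballI impI)
      fix x assume x: "x \<in> F" "x \<noteq> \<one>\<^bsub>\<S>\<^esub>"
      have xS: "x \<in> carrier \<S>" using F x by blast
      have \<psi>x: "\<kappa> * d1 (\<theta> (snd x)) \<one>\<^bsub>G1\<^esub> \<le> d (\<psi> x) \<one>\<^bsub>G\<^esub>" "\<kappa> * d2 (\<iota> (T x)) \<one>\<^bsub>G2\<^esub> \<le> d (\<psi> x) \<one>\<^bsub>G\<^esub>"
        using \<rho>(2)[OF \<theta>C[OF xS] one(1) \<iota>T[OF xS] one(2)] by (simp_all add: \<psi>_def \<rho>1)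
      show "c < d (\<psi> x) \<one>\<^bsub>G\<^esub>"
      \<comment> \<open>A nontrivial element with trivial second component has
        \<open>\<sigma> \<noteq> id\<close> and is seen by the permutation part; every other one is
        seen by \<open>\<theta>\<close>.\<close>
      proof (cases "snd x = \<one>\<^bsub>\<Gamma>\<^esub>")
        case True
        then obtain \<sigma> where \<sigma>: "x = (\<sigma>, \<one>\<^bsub>\<Gamma>\<^esub>)" by (metis prod.collapse)
        then have "\<sigma> \<noteq> id" using x S_simps by auto
        then have "d2 (\<iota> (T x)) \<one>\<^bsub>G2\<^esub> > c2" using \<iota>(3)[OF Tp[OF xS]] T(4)[of \<sigma>] x(1) \<sigma> by simp
        then show ?thesis using \<psi>x(2) c(3) \<kappa>(1) by (smt (verit, best) mult_less_cancel_left_pos)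
      next
        case False
        then have "d1 (\<theta> (snd x)) \<one>\<^bsub>G1\<^esub> > c1" using \<theta>(4) x(1) by (auto simp: separating_def)
        then show ?thesis using \<psi>x(1) c(2) \<kappa>(1) by (smt (verit, best) mult_less_cancel_left_pos)
      qed
    qed
    ultimately show ?thesis using G by blast
  qed
  then show ?thesis unfolding \<S>_def[symmetric] approximable_iff using S.group_axioms c(1) by blast
qed

section \<open>Sofic and weakly sofic groups\<close>

lemma hamming_dist_nonneg: "finite A \<Longrightarrow> 0 \<le> hamming_dist A p q"
  unfolding hamming_dist_def
  by (cases "card A = 0") (auto simp: divide_le_eq intro!: card_mono)

lemma hamming_dist_le_1: "hamming_dist A p q \<le> 1"
  by (simp add: hamming_dist_def)

lemma hom_sym_group_iff:
  "\<iota> \<in> hom (sym_group m) G \<longleftrightarrow> (\<forall>p. p permutes {1..m} \<longrightarrow> \<iota> p \<in> carrier G) \<and>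
     (\<forall>p q. p permutes {1..m} \<longrightarrow> q permutes {1..m} \<longrightarrow> \<iota> (p \<circ> q) = \<iota> p \<otimes>\<^bsub>G\<^esub> \<iota> q)"
  by (auto simp: hom_def sym_group_def)

text \<open>With the modulus an explicit function of \<open>\<eta>\<close>, and
  \<open>\<iota> id\<close> in place of the unit, a single formula or estimate for the distance of
  two images can serve both requirements.\<close>

lemma perm_representableI:
  assumes "c > 0" and \<delta>: "\<And>\<eta>. \<eta> > 0 \<Longrightarrow> \<delta> \<eta> > 0"
    and rep: "\<And>m. m \<ge> 2 \<Longrightarrow> \<exists>G d \<iota>. (G, d) \<in> \<G> \<and> \<iota> \<in> hom (sym_group m) G \<and> \<iota> id = \<one>\<^bsub>G\<^esub> \<and>
     (\<forall>p q. p permutes {1..m} \<and> q permutes {1..m} \<longrightarrow>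
        (\<forall>\<eta>>0. hamming_dist {1..m} p q < \<delta> \<eta> \<longrightarrow> d (\<iota> p) (\<iota> q) < \<eta>) \<and>
        (hamming_dist {1..m} p id \<ge> 1 / 2 \<longrightarrow> d (\<iota> p) (\<iota> id) > c))"
  shows "perm_representable \<G>"
  unfolding perm_representable_def
proof (rule exI[of _ c], rule conjI[OF \<open>c > 0\<close>], intro allI impI)
  fix \<eta> :: real assume \<eta>: "\<eta> > 0"
  show "\<exists>\<delta>>0. \<forall>m\<ge>2. \<exists>G d \<iota>. (G, d) \<in> \<G> \<and> \<iota> \<in> hom (sym_group m) G \<and>
     (\<forall>p q. p permutes {1..m} \<and> q permutes {1..m} \<longrightarrow>
        (hamming_dist {1..m} p q < \<delta> \<longrightarrow> d (\<iota> p) (\<iota> q) < \<eta>) \<and>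
        (hamming_dist {1..m} p id \<ge> 1 / 2 \<longrightarrow> d (\<iota> p) \<one>\<^bsub>G\<^esub> > c))"
  proof (rule exI[of _ "\<delta> \<eta>"], rule conjI[OF \<delta>[OF \<eta>]], intro allI impI)
    fix m :: nat assume "m \<ge> 2"
    from rep[OF this] obtain G d \<iota> where *: "(G, d) \<in> \<G> \<and> \<iota> \<in> hom (sym_group m) G \<and> \<iota> id = \<one>\<^bsub>G\<^esub> \<and>
     (\<forall>p q. p permutes {1..m} \<and> q permutes {1..m} \<longrightarrow>
        (\<forall>\<eta>>0. hamming_dist {1..m} p q < \<delta> \<eta> \<longrightarrow> d (\<iota> p) (\<iota> q) < \<eta>) \<and>
        (hamming_dist {1..m} p id \<ge> 1 / 2 \<longrightarrow> d (\<iota> p) (\<iota> id) > c))"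
      by (elim exE) (rule that)
    show "\<exists>G d \<iota>. (G, d) \<in> \<G> \<and> \<iota> \<in> hom (sym_group m) G \<and>
     (\<forall>p q. p permutes {1..m} \<and> q permutes {1..m} \<longrightarrow>
        (hamming_dist {1..m} p q < \<delta> \<eta> \<longrightarrow> d (\<iota> p) (\<iota> q) < \<eta>) \<and>
        (hamming_dist {1..m} p id \<ge> 1 / 2 \<longrightarrow> d (\<iota> p) \<one>\<^bsub>G\<^esub> > c))"
      by (rule exI[of _ G], rule exI[of _ d], rule exI[of _ \<iota>]) (use * \<eta> in auto)
  qed
qed

lemma perm_representable_sofic: "perm_representable {(sym_group n, hamming_dist {1..n}) |n. n \<ge> 1}"
\<comment> \<open>Any positive constant below \<open>1 / 2\<close> would do, since the required
  inequality is strict.\<close>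
proof (rule perm_representableI[of "1/4" "\<lambda>\<eta>. \<eta>"])
  fix m :: nat assume "m \<ge> 2"
  then show "\<exists>G d \<iota>. (G, d) \<in> {(sym_group n, hamming_dist {1..n}) |n. n \<ge> 1} \<and>
     \<iota> \<in> hom (sym_group m) G \<and> \<iota> id = \<one>\<^bsub>G\<^esub> \<and>
     (\<forall>p q. p permutes {1..m} \<and> q permutes {1..m} \<longrightarrow>
        (\<forall>\<eta>>0. hamming_dist {1..m} p q < \<eta> \<longrightarrow> d (\<iota> p) (\<iota> q) < \<eta>) \<and>
        (hamming_dist {1..m} p id \<ge> 1 / 2 \<longrightarrow> d (\<iota> p) (\<iota> id) > 1/4))"
    by (intro exI[of _ "sym_group m"] exI[of _ "hamming_dist {1..m}"] exI[of _ "\<lambda>p. p"])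
      (auto simp: hom_def sym_group_def)
qed simp_all

text \<open>The restriction matters: \<open>map_prod p q\<close> also moves pairs of which only one
  coordinate lies in its set.\<close>

definition perm_prod :: "'a set \<Rightarrow> 'b set \<Rightarrow> ('a \<Rightarrow> 'a) \<Rightarrow> ('b \<Rightarrow> 'b) \<Rightarrow> 'a \<times> 'b \<Rightarrow> 'a \<times> 'b" where
  "perm_prod A B p q = restrict_id (map_prod p q) (A \<times> B)"

lemma perm_prod_permutes:
  assumes "p permutes A" "q permutes B"
  shows "perm_prod A B p q permutes A \<times> B"
  unfolding perm_prod_def
  by (intro permutes_restrict_id bij_betw_map_prod permutes_imp_bij assms)

lemma perm_prod_comp:
  assumes "p' permutes A" "q' permutes B"
  shows "perm_prod A B (p \<circ> p') (q \<circ> q') = perm_prod A B p q \<circ> perm_prod A B p' q'"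
  using assms by (auto simp: perm_prod_def restrict_id_def fun_eq_iff permutes_in_image)

text \<open>The agreement set of two product permutations is the product of the agreement sets, so
  proportions of agreement multiply.\<close>

lemma hamming_dist_perm_prod:
  "1 - hamming_dist (A \<times> B) (perm_prod A B p q) (perm_prod A B p' q') =
     (1 - hamming_dist A p p') * (1 - hamming_dist B q q')"
proof -
  have "{x \<in> A \<times> B. perm_prod A B p q x = perm_prod A B p' q' x} = {a \<in> A. p a = p' a} \<times> {b \<in> B. q b = q' b}"
    by (auto simp: perm_prod_def)
  then show ?thesis by (simp add: hamming_dist_def card_cartesian_product)
qed

lemma product_closed_sofic: "product_closed {(sym_group n, hamming_dist {1..n}) |n. n \<ge> 1}"
  unfolding product_closed_def
proof (intro exI[of _ 1] conjI allI impI)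
  let ?\<G> = "{(sym_group n, hamming_dist {1..n}) |n. n \<ge> 1}"
  fix G\<^sub>1 d\<^sub>1 G\<^sub>2 d\<^sub>2 assume "(G\<^sub>1, d\<^sub>1) \<in> ?\<G> \<and> (G\<^sub>2, d\<^sub>2) \<in> ?\<G>"
  then obtain n1 n2 where n: "n1 \<ge> 1" "n2 \<ge> 1"
    and G: "G\<^sub>1 = sym_group n1" "d\<^sub>1 = hamming_dist {1..n1}" "G\<^sub>2 = sym_group n2" "d\<^sub>2 = hamming_dist {1..n2}"
    by auto
  let ?A = "{1..n1}" and ?B = "{1..n2}"
  have "card (?A \<times> ?B) = card {1..n1 * n2}" by (simp add: card_cartesian_product)
  then obtain f where f: "bij_betw f (?A \<times> ?B) {1..n1 * n2}"
    using finite_same_card_bij[of "?A \<times> ?B" "{1..n1 * n2}"] by auto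
  then have inj: "inj_on f (?A \<times> ?B)" and im: "f ` (?A \<times> ?B) = {1..n1 * n2}" by (auto simp: bij_betw_def)
  define \<iota> where "\<iota> = (\<lambda>(p, q). map_permutation (?A \<times> ?B) f (perm_prod ?A ?B p q))"
  have hom: "\<iota> \<in> hom (G\<^sub>1 \<times>\<times> G\<^sub>2) (sym_group (n1 * n2))"
  proof (rule homI)
    fix x assume "x \<in> carrier (G\<^sub>1 \<times>\<times> G\<^sub>2)"
    then obtain p q where x: "x = (p, q)" "p permutes ?A" "q permutes ?B" by (auto simp: G sym_group_def)
    then show "\<iota> x \<in> carrier (sym_group (n1 * n2))"
      using map_permutation_permutes[OF f perm_prod_permutes[OF x(2,3)]] by (simp add: \<iota>_def sym_group_def)
    fix y assume "y \<in> carrier (G\<^sub>1 \<times>\<times> G\<^sub>2)"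
    then obtain p' q' where y: "y = (p', q')" "p' permutes ?A" "q' permutes ?B" by (auto simp: G sym_group_def)
    show "\<iota> (x \<otimes>\<^bsub>G\<^sub>1 \<times>\<times> G\<^sub>2\<^esub> y) = \<iota> x \<otimes>\<^bsub>sym_group (n1 * n2)\<^esub> \<iota> y"
      using map_permutation_compose'[OF inj perm_prod_permutes[OF y(2,3)], of "perm_prod ?A ?B p q"]
        perm_prod_comp[OF y(2,3), of p q]
      by (simp add: x y G \<iota>_def sym_group_def)
  qed
  have dist: "1 - hamming_dist {1..n1 * n2} (\<iota> (p, q)) (\<iota> (p', q')) =
     (1 - hamming_dist ?A p p') * (1 - hamming_dist ?B q q')"
    if "p permutes ?A" "q permutes ?B" "p' permutes ?A" "q' permutes ?B" for p q p' q'
  proof -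
    have "hamming_dist {1..n1 * n2} (\<iota> (p, q)) (\<iota> (p', q')) =
        hamming_dist (?A \<times> ?B) (perm_prod ?A ?B p q) (perm_prod ?A ?B p' q')"
      using hamming_dist_map_permutation[OF inj _ perm_prod_permutes[OF that(1,2)] perm_prod_permutes[OF that(3,4)]]
      unfolding im \<iota>_def by simp
    then show ?thesis by (simp only: hamming_dist_perm_prod)
  qed
  have bounds: "hamming_dist {1..n1 * n2} (\<iota> (p, q)) (\<iota> (p', q')) \<le> hamming_dist ?A p p' + hamming_dist ?B q q' \<and>
      1 * hamming_dist ?A p p' \<le> hamming_dist {1..n1 * n2} (\<iota> (p, q)) (\<iota> (p', q')) \<and>
      1 * hamming_dist ?B q q' \<le> hamming_dist {1..n1 * n2} (\<iota> (p, q)) (\<iota> (p', q'))"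
    if "p permutes ?A" "p' permutes ?A" "q permutes ?B" "q' permutes ?B" for p q p' q'
  proof -
    let ?u = "hamming_dist ?A p p'" and ?v = "hamming_dist ?B q q'"
    have u: "0 \<le> ?u" "?u \<le> 1" and v: "0 \<le> ?v" "?v \<le> 1"
      by (simp_all add: hamming_dist_nonneg hamming_dist_le_1)
    \<comment> \<open>The new distance is \<open>?u + ?v - ?u * ?v\<close>, which lies between the
      maximum and the sum of the two because both are in [0, 1]; hence the constant 1.\<close>
    have "0 \<le> ?u * ?v" "0 \<le> ?u * (1 - ?v)" "0 \<le> ?v * (1 - ?u)" using u v by simp_all
    then show ?thesis using dist[OF that(1,3,2,4)] by (simp add: algebra_simps)
  qed
  show "\<exists>G d \<iota>. (G, d) \<in> ?\<G> \<and> \<iota> \<in> hom (G\<^sub>1 \<times>\<times> G\<^sub>2) G \<and>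
       (\<forall>x\<^sub>1\<in>carrier G\<^sub>1. \<forall>y\<^sub>1\<in>carrier G\<^sub>1. \<forall>x\<^sub>2\<in>carrier G\<^sub>2. \<forall>y\<^sub>2\<in>carrier G\<^sub>2.
          d (\<iota> (x\<^sub>1, x\<^sub>2)) (\<iota> (y\<^sub>1, y\<^sub>2)) \<le> d\<^sub>1 x\<^sub>1 y\<^sub>1 + d\<^sub>2 x\<^sub>2 y\<^sub>2 \<and>
          1 * d\<^sub>1 x\<^sub>1 y\<^sub>1 \<le> d (\<iota> (x\<^sub>1, x\<^sub>2)) (\<iota> (y\<^sub>1, y\<^sub>2)) \<and>
          1 * d\<^sub>2 x\<^sub>2 y\<^sub>2 \<le> d (\<iota> (x\<^sub>1, x\<^sub>2)) (\<iota> (y\<^sub>1, y\<^sub>2)))"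
  proof (intro exI conjI)
    show "(sym_group (n1 * n2), hamming_dist {1..n1 * n2}) \<in> ?\<G>" using n by auto
    show "\<iota> \<in> hom (G\<^sub>1 \<times>\<times> G\<^sub>2) (sym_group (n1 * n2))" by (rule hom)
    show "\<forall>x\<^sub>1\<in>carrier G\<^sub>1. \<forall>y\<^sub>1\<in>carrier G\<^sub>1. \<forall>x\<^sub>2\<in>carrier G\<^sub>2. \<forall>y\<^sub>2\<in>carrier G\<^sub>2.
          hamming_dist {1..n1 * n2} (\<iota> (x\<^sub>1, x\<^sub>2)) (\<iota> (y\<^sub>1, y\<^sub>2)) \<le> d\<^sub>1 x\<^sub>1 y\<^sub>1 + d\<^sub>2 x\<^sub>2 y\<^sub>2 \<and>
          1 * d\<^sub>1 x\<^sub>1 y\<^sub>1 \<le> hamming_dist {1..n1 * n2} (\<iota> (x\<^sub>1, x\<^sub>2)) (\<iota> (y\<^sub>1, y\<^sub>2)) \<and>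
          1 * d\<^sub>2 x\<^sub>2 y\<^sub>2 \<le> hamming_dist {1..n1 * n2} (\<iota> (x\<^sub>1, x\<^sub>2)) (\<iota> (y\<^sub>1, y\<^sub>2))"
      unfolding G by (intro ballI bounds) (simp_all add: sym_group_def)
  qed
qed simp

section \<open>Finite groups with bi-invariant metrics of diameter one\<close>

text \<open>The membership condition of \<open>weakly_sofic_group\<close>, but for an arbitrary
  element type: symmetric groups and direct products are shown to satisfy it before their elements
  are encoded as natural numbers.\<close>

definition normalized_metric_group :: "('h, 'n) monoid_scheme \<Rightarrow> ('h \<Rightarrow> 'h \<Rightarrow> real) \<Rightarrow> bool" where
  "normalized_metric_group G d \<longleftrightarrow> group G \<and> finite (carrier G) \<and> Metric_space (carrier G) d \<and>
     bi_invariant G d \<and> Sup {d x y |x y. x \<in> carrier G \<and> y \<in> carrier G} = 1"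

text \<open>Over a finite nonempty carrier the supremum is a maximum, so diameter one splits into a
  bound and an attained value.\<close>

lemma Sup_dist_eq_1_iff:
  assumes "finite C" "C \<noteq> {}"
  shows "Sup {d x y |x y. x \<in> C \<and> y \<in> C} = (1::real) \<longleftrightarrow>
     (\<forall>x\<in>C. \<forall>y\<in>C. d x y \<le> 1) \<and> (\<exists>x\<in>C. \<exists>y\<in>C. d x y = 1)"
proof -
  let ?D = "{d x y |x y. x \<in> C \<and> y \<in> C}"
  have "?D = (\<lambda>(x, y). d x y) ` (C \<times> C)" by auto
  then have "finite ?D" "?D \<noteq> {}" using assms by auto
  then have "Sup ?D = 1 \<longleftrightarrow> 1 \<in> ?D \<and> (\<forall>z\<in>?D. z \<le> 1)"
    by (simp add: cSup_eq_Max Max_eq_iff)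
  moreover have "1 \<in> ?D \<longleftrightarrow> (\<exists>x\<in>C. \<exists>y\<in>C. d x y = 1)" by force
  moreover have "(\<forall>z\<in>?D. z \<le> 1) \<longleftrightarrow> (\<forall>x\<in>C. \<forall>y\<in>C. d x y \<le> 1)" by blast
  ultimately show ?thesis by argo
qed

text \<open>Transport of structure: multiplication and metric are pushed along an injection of the
  finite carrier into the natural numbers.\<close>

lemma normalized_metric_group_nat:
  fixes G :: "('h, 'n) monoid_scheme"
  assumes "normalized_metric_group G d"
  obtains G' :: "nat monoid" and d' \<iota> where "normalized_metric_group G' d'" "\<iota> \<in> hom G G'"
    "\<And>x y. \<lbrakk>x \<in> carrier G; y \<in> carrier G\<rbrakk> \<Longrightarrow> d' (\<iota> x) (\<iota> y) = d x y"
proof -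
  interpret group G using assms by (simp add: normalized_metric_group_def)
  interpret Metric_space "carrier G" d using assms by (simp add: normalized_metric_group_def)
  have fin: "finite (carrier G)" and bi: "bi_invariant G d"
    and Sup: "Sup {d x y |x y. x \<in> carrier G \<and> y \<in> carrier G} = 1"
    using assms by (simp_all add: normalized_metric_group_def)
  obtain \<iota> :: "'h \<Rightarrow> nat" where inj: "inj_on \<iota> (carrier G)"
    using finite_imp_inj_to_nat_seg[OF fin] by blast
  define G' where "G' = image_group \<iota> G"
  define d' where "d' a b = d (inv_into (carrier G) \<iota> a) (inv_into (carrier G) \<iota> b)" for a b
  have C: "carrier G' = \<iota> ` carrier G" by (simp add: G'_def image_group_def)
  have mult: "\<iota> x \<otimes>\<^bsub>G'\<^esub> \<iota> y = \<iota> (x \<otimes>\<^bsub>G\<^esub> y)" if "x \<in> carrier G" "y \<in> carrier G" for x y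
    using that inj by (simp add: G'_def image_group_def)
  have dist: "d' (\<iota> x) (\<iota> y) = d x y" if "x \<in> carrier G" "y \<in> carrier G" for x y
    using that inj by (simp add: d'_def)
  have "group G'" unfolding G'_def by (rule inj_imp_image_group_is_group[OF inj])
  moreover have "finite (carrier G')" using fin by (simp add: C)
  moreover have "Metric_space (carrier G') d'"
  proof
    \<comment> \<open>Nonnegativity and symmetry are demanded off the carrier as well; they hold
      there because \<open>d\<close> has them everywhere.\<close>
    show "0 \<le> d' x y" for x y by (simp add: d'_def)
    show "d' x y = d' y x" for x y by (simp add: d'_def commute)
    show "d' x y = 0 \<longleftrightarrow> x = y" if "x \<in> carrier G'" "y \<in> carrier G'" for x y
      using that inj by (auto simp: C dist)
    show "d' x z \<le> d' x y + d' y z" if "x \<in> carrier G'" "y \<in> carrier G'" "z \<in> carrier G'" for x y z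
      using that by (auto simp: C dist triangle)
  qed
  moreover have "bi_invariant G' d'"
    using bi by (simp add: bi_invariant_def C mult dist)
  moreover have "Sup {d' x y |x y. x \<in> carrier G' \<and> y \<in> carrier G'} = 1"
  proof -
    have "finite (\<iota> ` carrier G)" "\<iota> ` carrier G \<noteq> {}" "carrier G \<noteq> {}" using fin one_closed by auto
    then show ?thesis
      using Sup unfolding C by (simp add: Sup_dist_eq_1_iff[OF fin] Sup_dist_eq_1_iff dist)
  qed
  ultimately have "normalized_metric_group G' d'" by (simp add: normalized_metric_group_def)
  moreover have "\<iota> \<in> hom G G'" by (rule homI) (auto simp: C mult)
  ultimately show thesis using dist by (rule that)
qed

lemma normalized_metric_group_sym_group:
  assumes "m \<ge> 2"
  shows "normalized_metric_group (sym_group m) (hamming_dist {1..m})"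
proof -
  have fin: "finite (carrier (sym_group m))" by (simp add: sym_group_def finite_permutations)
  have ne: "{1..m} \<noteq> {}" using assms by simp
  have Metric: "Metric_space (carrier (sym_group m)) (hamming_dist {1..m})"
  proof
    show "0 \<le> hamming_dist {1..m} p q" for p q by (simp add: hamming_dist_nonneg)
    show "hamming_dist {1..m} p q = hamming_dist {1..m} q p" for p q
    proof -
      have "{i \<in> {1..m}. p i = q i} = {i \<in> {1..m}. q i = p i}" by auto
      then show ?thesis by (simp only: hamming_dist_def)
    qed
    show "hamming_dist {1..m} p q = 0 \<longleftrightarrow> p = q"
      if "p \<in> carrier (sym_group m)" "q \<in> carrier (sym_group m)" for p q
    proof
      have pq: "p permutes {1..m}" "q permutes {1..m}" using that by (simp_all add: sym_group_carrier)
      assume "hamming_dist {1..m} p q = 0"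
      then have "\<forall>i\<in>{1..m}. p i = q i" using ne by (simp add: hamming_dist_eq)
      moreover have "p i = i" "q i = i" if "i \<notin> {1..m}" for i
        using pq that by (meson permutes_not_in)+
      ultimately show "p = q" unfolding fun_eq_iff by metis
    qed (use ne in \<open>simp add: hamming_dist_eq\<close>)
    show "hamming_dist {1..m} p r \<le> hamming_dist {1..m} p q + hamming_dist {1..m} q r" for p q r
    proof -
      have "card {i \<in> {1..m}. p i \<noteq> r i} \<le> card ({i \<in> {1..m}. p i \<noteq> q i} \<union> {i \<in> {1..m}. q i \<noteq> r i})"
        by (intro card_mono) auto
      also have "\<dots> \<le> card {i \<in> {1..m}. p i \<noteq> q i} + card {i \<in> {1..m}. q i \<noteq> r i}" by (rule card_Un_le)
      finally have "real (card {i \<in> {1..m}. p i \<noteq> r i})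
          \<le> real (card {i \<in> {1..m}. p i \<noteq> q i} + card {i \<in> {1..m}. q i \<noteq> r i})" by (rule of_nat_mono)
      then show ?thesis
        unfolding hamming_dist_eq[OF finite_atLeastAtMost ne] of_nat_add add_divide_distrib[symmetric]
        by (rule divide_right_mono) simp
    qed
  qed
  have bi: "bi_invariant (sym_group m) (hamming_dist {1..m})"
    unfolding bi_invariant_def
  proof (intro ballI conjI)
    fix p q r assume "p \<in> carrier (sym_group m)" "q \<in> carrier (sym_group m)" "r \<in> carrier (sym_group m)"
    then have p: "p permutes {1..m}" by (simp add: sym_group_carrier)
    show "hamming_dist {1..m} (p \<otimes>\<^bsub>sym_group m\<^esub> q) (p \<otimes>\<^bsub>sym_group m\<^esub> r) = hamming_dist {1..m} q r"
      using permutes_inj[OF p] by (simp add: sym_group_def hamming_dist_def inj_eq)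
    show "hamming_dist {1..m} (q \<otimes>\<^bsub>sym_group m\<^esub> p) (r \<otimes>\<^bsub>sym_group m\<^esub> p) = hamming_dist {1..m} q r"
      using card_preimage_permutes[OF p, of "\<lambda>i. q i = r i"] by (simp add: sym_group_def hamming_dist_def)
  qed
  have "Sup {hamming_dist {1..m} p q |p q. p \<in> carrier (sym_group m) \<and> q \<in> carrier (sym_group m)} = 1"
  proof (subst Sup_dist_eq_1_iff)
    \<comment> \<open>The full cycle has no fixed point when \<open>m \<ge> 2\<close>, hence lies at
      distance 1 from \<open>id\<close>; for \<open>m = 1\<close> the diameter would be 0.\<close>
    define c where "c i = (if i \<in> {1..m} then if i = m then 1 else Suc i else i)" for i
    have "bij_betw c {1..m} {1..m}"
    proof -
      have "inj_on c {1..m}" by (auto simp: inj_on_def c_def split: if_splits)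
      moreover have "c ` {1..m} \<subseteq> {1..m}" by (auto simp: c_def)
      ultimately show ?thesis by (simp add: bij_betw_def endo_inj_surj)
    qed
    then have "c permutes {1..m}" by (rule bij_imp_permutes) (auto simp: c_def)
    moreover have "{i \<in> {1..m}. c i = id i} = {}" using assms by (auto simp: c_def)
    then have "hamming_dist {1..m} c id = 1" unfolding hamming_dist_def by simp
    ultimately show "(\<forall>p\<in>carrier (sym_group m). \<forall>q\<in>carrier (sym_group m). hamming_dist {1..m} p q \<le> 1) \<and>
        (\<exists>p\<in>carrier (sym_group m). \<exists>q\<in>carrier (sym_group m). hamming_dist {1..m} p q = 1)"
      by (intro conjI ballI hamming_dist_le_1 bexI[of _ c] bexI[of _ id]) (simp_all add: sym_group_carrier permutes_id)
    show "carrier (sym_group m) \<noteq> {}" using permutes_id sym_group_carrier by blast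
  qed (rule fin)
  then show ?thesis using fin Metric bi sym_group_is_group by (simp add: normalized_metric_group_def)
qed

text \<open>Averaging, unlike adding, keeps the diameter at one: the value 1 is attained by
  combining extremal pairs of both factors.\<close>

lemma normalized_metric_group_DirProd:
  assumes "normalized_metric_group G\<^sub>1 d\<^sub>1" "normalized_metric_group G\<^sub>2 d\<^sub>2"
  shows "normalized_metric_group (G\<^sub>1 \<times>\<times> G\<^sub>2) (\<lambda>(x\<^sub>1, x\<^sub>2) (y\<^sub>1, y\<^sub>2). (d\<^sub>1 x\<^sub>1 y\<^sub>1 + d\<^sub>2 x\<^sub>2 y\<^sub>2) / 2)"
    (is "normalized_metric_group ?G ?d")
proof -
  interpret G1: group G\<^sub>1 using assms by (simp add: normalized_metric_group_def)
  interpret G2: group G\<^sub>2 using assms by (simp add: normalized_metric_group_def)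
  interpret M1: Metric_space "carrier G\<^sub>1" d\<^sub>1 using assms by (simp add: normalized_metric_group_def)
  interpret M2: Metric_space "carrier G\<^sub>2" d\<^sub>2 using assms by (simp add: normalized_metric_group_def)
  have fin: "finite (carrier G\<^sub>1)" "finite (carrier G\<^sub>2)" "finite (carrier ?G)"
    using assms by (simp_all add: normalized_metric_group_def)
  have ne: "carrier G\<^sub>1 \<noteq> {}" "carrier G\<^sub>2 \<noteq> {}" "carrier ?G \<noteq> {}" using G1.one_closed G2.one_closed by auto
  have Metric: "Metric_space (carrier ?G) ?d"
  proof
    show "0 \<le> ?d x y" for x y by (simp add: split_beta)
    show "?d x y = ?d y x" for x y by (simp add: split_beta M1.commute M2.commute)
    show "?d x y = 0 \<longleftrightarrow> x = y" if "x \<in> carrier ?G" "y \<in> carrier ?G" for x y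
      using that by (auto simp: add_nonneg_eq_0_iff)
    show "?d x z \<le> ?d x y + ?d y z" if "x \<in> carrier ?G" "y \<in> carrier ?G" "z \<in> carrier ?G" for x y z
    proof -
      have "d\<^sub>1 (fst x) (fst z) \<le> d\<^sub>1 (fst x) (fst y) + d\<^sub>1 (fst y) (fst z)"
        using that by (intro M1.triangle) auto
      moreover have "d\<^sub>2 (snd x) (snd z) \<le> d\<^sub>2 (snd x) (snd y) + d\<^sub>2 (snd y) (snd z)"
        using that by (intro M2.triangle) auto
      ultimately show ?thesis unfolding split_beta by argo
    qed
  qed
  have bi: "bi_invariant ?G ?d"
    using assms by (simp add: normalized_metric_group_def bi_invariant_def)
  have S1: "\<forall>x\<in>carrier G\<^sub>1. \<forall>y\<in>carrier G\<^sub>1. d\<^sub>1 x y \<le> 1" "\<exists>x\<in>carrier G\<^sub>1. \<exists>y\<in>carrier G\<^sub>1. d\<^sub>1 x y = 1"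
    using assms(1) Sup_dist_eq_1_iff[OF fin(1) ne(1)] by (simp_all add: normalized_metric_group_def)
  have S2: "\<forall>x\<in>carrier G\<^sub>2. \<forall>y\<in>carrier G\<^sub>2. d\<^sub>2 x y \<le> 1" "\<exists>x\<in>carrier G\<^sub>2. \<exists>y\<in>carrier G\<^sub>2. d\<^sub>2 x y = 1"
    using assms(2) Sup_dist_eq_1_iff[OF fin(2) ne(2)] by (simp_all add: normalized_metric_group_def)
  have "Sup {?d x y |x y. x \<in> carrier ?G \<and> y \<in> carrier ?G} = 1"
  proof (subst Sup_dist_eq_1_iff[OF fin(3) ne(3)], intro conjI ballI)
    show "?d x y \<le> 1" if "x \<in> carrier ?G" "y \<in> carrier ?G" for x y
    proof -
      have "d\<^sub>1 (fst x) (fst y) \<le> 1" "d\<^sub>2 (snd x) (snd y) \<le> 1" using S1(1) S2(1) that by auto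
      then show ?thesis by (simp add: split_beta)
    qed
    obtain x1 y1 x2 y2 where "x1 \<in> carrier G\<^sub>1" "y1 \<in> carrier G\<^sub>1" "d\<^sub>1 x1 y1 = 1"
      "x2 \<in> carrier G\<^sub>2" "y2 \<in> carrier G\<^sub>2" "d\<^sub>2 x2 y2 = 1" using S1(2) S2(2) by blast
    then show "\<exists>x\<in>carrier ?G. \<exists>y\<in>carrier ?G. ?d x y = 1"
      by (intro bexI[of _ "(x1, x2)"] bexI[of _ "(y1, y2)"]) auto
  qed
  then show ?thesis using fin(3) Metric bi DirProd_group[OF G1.group_axioms G2.group_axioms]
    by (simp add: normalized_metric_group_def)
qed

lemma perm_representable_weakly_sofic:
  "perm_representable {(G :: nat monoid, d). normalized_metric_group G d}" (is "perm_representable ?\<G>")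
proof (rule perm_representableI[of "1/4" "\<lambda>\<eta>. \<eta>"])
  fix m :: nat assume "m \<ge> 2"
  then obtain G :: "nat monoid" and d \<iota> where G: "normalized_metric_group G d"
    and hom: "\<iota> \<in> hom (sym_group m) G"
    and dist: "\<And>p q. p \<in> carrier (sym_group m) \<Longrightarrow> q \<in> carrier (sym_group m) \<Longrightarrow>
      d (\<iota> p) (\<iota> q) = hamming_dist {1..m} p q"
    using normalized_metric_group_nat[OF normalized_metric_group_sym_group] by metis
  have "\<iota> id = \<one>\<^bsub>G\<^esub>"
    using hom_one[OF hom sym_group_is_group] G by (simp add: normalized_metric_group_def sym_group_def)
  moreover have "d (\<iota> p) (\<iota> q) = hamming_dist {1..m} p q" if "p permutes {1..m}" "q permutes {1..m}" for p q
    using dist[of p q] that by (simp add: sym_group_carrier)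
  moreover from this have "d (\<iota> p) (\<iota> id) = hamming_dist {1..m} p id" if "p permutes {1..m}" for p
    using that permutes_id by blast
  ultimately show "\<exists>G d \<iota>. (G, d) \<in> ?\<G> \<and> \<iota> \<in> hom (sym_group m) G \<and> \<iota> id = \<one>\<^bsub>G\<^esub> \<and>
   (\<forall>p q. p permutes {1..m} \<and> q permutes {1..m} \<longrightarrow>
      (\<forall>\<eta>>0. hamming_dist {1..m} p q < \<eta> \<longrightarrow> d (\<iota> p) (\<iota> q) < \<eta>) \<and>
      (hamming_dist {1..m} p id \<ge> 1 / 2 \<longrightarrow> d (\<iota> p) (\<iota> id) > 1/4))"
    using G hom by (intro exI[of _ G] exI[of _ d] exI[of _ \<iota>]) simp
qed simp_all

lemma product_closed_weakly_sofic:
  "product_closed {(G :: nat monoid, d). normalized_metric_group G d}" (is "product_closed ?\<G>")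
  unfolding product_closed_def
\<comment> \<open>The metric of the product is the average, so half of each distance is
  kept.\<close>
proof (intro exI[of _ "1/2"] conjI allI impI)
  fix G\<^sub>1 G\<^sub>2 :: "nat monoid" and d\<^sub>1 d\<^sub>2
  assume *: "(G\<^sub>1, d\<^sub>1) \<in> ?\<G> \<and> (G\<^sub>2, d\<^sub>2) \<in> ?\<G>"
  then have N: "normalized_metric_group G\<^sub>1 d\<^sub>1" "normalized_metric_group G\<^sub>2 d\<^sub>2" by simp_all
  interpret M1: Metric_space "carrier G\<^sub>1" d\<^sub>1 using N by (simp add: normalized_metric_group_def)
  interpret M2: Metric_space "carrier G\<^sub>2" d\<^sub>2 using N by (simp add: normalized_metric_group_def)
  from normalized_metric_group_nat[OF normalized_metric_group_DirProd[OF N]]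
  obtain G :: "nat monoid" and d \<iota> where G: "normalized_metric_group G d" and hom: "\<iota> \<in> hom (G\<^sub>1 \<times>\<times> G\<^sub>2) G"
    and dist: "\<And>x y. x \<in> carrier (G\<^sub>1 \<times>\<times> G\<^sub>2) \<Longrightarrow> y \<in> carrier (G\<^sub>1 \<times>\<times> G\<^sub>2) \<Longrightarrow>
      d (\<iota> x) (\<iota> y) = (case x of (x1, x2) \<Rightarrow> \<lambda>(y1, y2). (d\<^sub>1 x1 y1 + d\<^sub>2 x2 y2) / 2) y"
    by metis
  show "\<exists>G d \<iota>. (G, d) \<in> ?\<G> \<and> \<iota> \<in> hom (G\<^sub>1 \<times>\<times> G\<^sub>2) G \<and>
       (\<forall>x\<^sub>1\<in>carrier G\<^sub>1. \<forall>y\<^sub>1\<in>carrier G\<^sub>1. \<forall>x\<^sub>2\<in>carrier G\<^sub>2. \<forall>y\<^sub>2\<in>carrier G\<^sub>2.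
          d (\<iota> (x\<^sub>1, x\<^sub>2)) (\<iota> (y\<^sub>1, y\<^sub>2)) \<le> d\<^sub>1 x\<^sub>1 y\<^sub>1 + d\<^sub>2 x\<^sub>2 y\<^sub>2 \<and>
          1/2 * d\<^sub>1 x\<^sub>1 y\<^sub>1 \<le> d (\<iota> (x\<^sub>1, x\<^sub>2)) (\<iota> (y\<^sub>1, y\<^sub>2)) \<and>
          1/2 * d\<^sub>2 x\<^sub>2 y\<^sub>2 \<le> d (\<iota> (x\<^sub>1, x\<^sub>2)) (\<iota> (y\<^sub>1, y\<^sub>2)))"
    using G hom by (intro exI[of _ G] exI[of _ d] exI[of _ \<iota>]) (simp add: dist)
qed simp

section \<open>Rank and independent columns\<close>

text \<open>Index sets replace sets of vectors because \<open>set (cols A)\<close> merges equal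
  columns, and because the columns of a block matrix are described by shifting indices.\<close>

definition indep_cols :: "nat \<Rightarrow> 'a::field mat \<Rightarrow> nat set \<Rightarrow> bool" where
  "indep_cols n A J \<longleftrightarrow> (\<forall>c. (\<forall>i<n. (\<Sum>j\<in>J. c j * A $$ (i, j)) = 0) \<longrightarrow> (\<forall>j\<in>J. c j = 0))"

definition spanning_cols :: "nat \<Rightarrow> nat \<Rightarrow> 'a::field mat \<Rightarrow> nat set \<Rightarrow> bool" where
  "spanning_cols n nc A J \<longleftrightarrow> (\<forall>k<nc. \<exists>c. \<forall>i<n. A $$ (i, k) = (\<Sum>j\<in>J. c j * A $$ (i, j)))"

text \<open>Two equal columns would satisfy a relation with coefficients 1 and -1.\<close>

lemma indep_cols_inj_on_col:
  assumes A: "A \<in> carrier_mat n nc" and J: "J \<subseteq> {..<nc}" and indep: "indep_cols n A J"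
  shows "inj_on (col A) J"
proof (rule inj_onI, rule ccontr)
  fix j k assume jk: "j \<in> J" "k \<in> J" "col A j = col A k" "j \<noteq> k"
  have fin: "finite J" using J finite_subset by blast
  define c :: "nat \<Rightarrow> 'a" where "c l = (if l = j then 1 else if l = k then - 1 else 0)" for l
  have "(\<Sum>l\<in>J. c l * A $$ (i, l)) = 0" if "i < n" for i
  proof -
    have "(\<Sum>l\<in>J. c l * A $$ (i, l)) = (\<Sum>l\<in>{j, k}. c l * A $$ (i, l))"
      by (rule sum.mono_neutral_right) (use fin jk in \<open>auto simp: c_def\<close>)
    also have "\<dots> = A $$ (i, j) - A $$ (i, k)" using jk(4) by (simp add: c_def)
    also have "\<dots> = col A j $ i - col A k $ i"
      using that A J jk(1,2) by (auto simp: subset_iff)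
    finally show ?thesis by (simp add: jk(3))
  qed
  then have "\<forall>l\<in>J. c l = 0" using indep unfolding indep_cols_def by blast
  then show False using jk(1) by (auto simp: c_def)
qed

context vec_space
begin

lemma lincomb_cols_index:
  assumes "A \<in> carrier_mat n nc" "J \<subseteq> {..<nc}" "inj_on (col A) J" "i < n"
  shows "lincomb a (col A ` J) $ i = (\<Sum>j\<in>J. a (col A j) * A $$ (i, j))"
proof -
  have "lincomb a (col A ` J) $ i = (\<Sum>x\<in>col A ` J. a x * x $ i)"
    by (rule lincomb_index) (use assms in auto)
  also have "\<dots> = (\<Sum>j\<in>J. a (col A j) * col A j $ i)" using assms(3) by (simp add: sum.reindex)
  also have "\<dots> = (\<Sum>j\<in>J. a (col A j) * A $$ (i, j))"
    by (rule sum.cong) (use assms in \<open>auto simp: subset_iff\<close>)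
  finally show ?thesis .
qed

text \<open>Independence makes \<open>col A\<close> injective on \<open>J\<close>, so indices are
  counted as independent vectors. Together with the upper bound by spanning columns, this reduces
  rank computations to exhibiting index sets.\<close>

lemma card_indep_cols_le_rank:
  assumes A: "A \<in> carrier_mat n nc" and J: "J \<subseteq> {..<nc}" and indep: "indep_cols n A J"
  shows "card J \<le> rank A"
proof -
  have inj: "inj_on (col A) J" by (rule indep_cols_inj_on_col[OF assms])
  have fin: "finite J" using J finite_subset by blast
  have sub: "col A ` J \<subseteq> set (cols A)" using A J by (auto simp: cols_def)
  have "lin_indpt (col A ` J)"
  proof (rule finite_lin_indpt2)
    fix a assume "lincomb a (col A ` J) = 0\<^sub>v n"
    then have "\<forall>i<n. (\<Sum>j\<in>J. a (col A j) * A $$ (i, j)) = 0"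
      using lincomb_cols_index[OF A J inj] by (metis index_zero_vec(1))
    then show "\<forall>v\<in>col A ` J. a v = 0"
      using indep unfolding indep_cols_def by (auto dest: spec[of _ "\<lambda>j. a (col A j)"])
  qed (use fin A in auto)
  then have "card (col A ` J) \<le> rank A" by (rule rank_ge_card_indpt[OF A sub])
  then show ?thesis using inj by (simp add: card_image)
qed

lemma rank_le_card_spanning_cols:
  assumes A: "A \<in> carrier_mat n nc" and J: "J \<subseteq> {..<nc}" and span: "spanning_cols n nc A J"
  shows "rank A \<le> card J"
proof -
  let ?C = "set (cols A)" and ?B = "col A ` J"
  have fin: "finite J" using J finite_subset by blast
  have C: "?C \<subseteq> carrier_vec n" using cols_dim A by blast
  have BC: "?B \<subseteq> ?C" using A J by (auto simp: cols_def)
  have B: "?B \<subseteq> carrier_vec n" using BC C by blast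
  have "?C \<subseteq> span ?B"
  proof
    fix v assume "v \<in> ?C"
    then obtain k where k: "k < nc" "v = col A k" using A by (auto simp: cols_def)
    then obtain c where c: "\<forall>i<n. A $$ (i, k) = (\<Sum>j\<in>J. c j * A $$ (i, j))"
      using span unfolding spanning_cols_def by blast
    \<comment> \<open>The combination is built up index by index because \<open>J\<close> may
      contain indices of equal columns, which \<open>lincomb\<close> over the image would
      merge.\<close>
    have "\<exists>w\<in>span ?B. \<forall>i<n. w $ i = (\<Sum>j\<in>K. c j * A $$ (i, j))" if "finite K" "K \<subseteq> J" for K
      using that
    proof induction
      case empty
      have "0\<^sub>v n \<in> span ?B" using span_empty span_is_monotone[of "{}" ?B] by auto
      then show ?case by (intro bexI[of _ "0\<^sub>v n"]) auto
    next
      case (insert l K)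
      then obtain w where w: "w \<in> span ?B" "\<forall>i<n. w $ i = (\<Sum>j\<in>K. c j * A $$ (i, j))" by auto
      have l: "l < nc" "col A l \<in> span ?B" using insert.prems J span_mem[OF B] by auto
      have "c l \<cdot>\<^sub>v col A l \<in> span ?B"
        using submodule.smult_closed[OF span_is_submodule[OF B], of "c l" "col A l"] l(2) by auto
      then have "w + c l \<cdot>\<^sub>v col A l \<in> span ?B" using span_add1[OF B w(1)] by blast
      moreover have "\<forall>i<n. (w + c l \<cdot>\<^sub>v col A l) $ i = (\<Sum>j\<in>insert l K. c j * A $$ (i, j))"
        using w(2) insert.hyps l(1) A by (auto simp: add.commute)
      ultimately show ?case by blast
    qed
    then obtain w where w: "w \<in> span ?B" "\<forall>i<n. w $ i = (\<Sum>j\<in>J. c j * A $$ (i, j))"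
      using fin by blast
    have "w \<in> carrier_vec n" using w(1) span_closed[OF B] by blast
    then have "v = w" using w(2) c k A by (intro eq_vecI) auto
    then show "v \<in> span ?B" using w(1) by simp
  qed
  then have "span ?C \<subseteq> span ?B" by (rule span_is_subset[OF _ span_is_submodule[OF B]])
  then have eq: "span ?B = span ?C" using span_is_monotone[OF BC] by blast
  have sub: "submodule class_ring (span ?C) V" by (rule span_is_submodule[OF C])
  have BsC: "?B \<subseteq> span ?C" using BC in_own_span[OF C] by blast
  have "vectorspace class_ring (span_vs ?C)" using span_is_subspace[THEN subspace_is_vs, OF C] .
  then have "vectorspace.dim class_ring (span_vs ?C) \<le> card ?B"
    by (rule vectorspace.gen_ge_dim) (use fin BsC span_li_not_depend(1)[OF BsC sub] eq in auto)
  also have "\<dots> \<le> card J" using fin by (rule card_image_le)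
  finally show ?thesis by (simp add: rank_def)
qed

lemma rank_col_basis:
  assumes A: "A \<in> carrier_mat n nc"
  obtains J where "J \<subseteq> {..<nc}" "card J = rank A" "indep_cols n A J" "spanning_cols n nc A J"
proof -
  let ?C = "set (cols A)"
  have C: "?C \<subseteq> carrier_vec n" using cols_dim A by blast
  obtain S where S: "maximal S (\<lambda>T. T \<subseteq> ?C \<and> lin_indpt T)"
    using maximal_exists_superset[of ?C "\<lambda>T. T \<subseteq> ?C \<and> lin_indpt T" "{}"] finite_lin_indpt2[of "{}"]
    by auto
  then have SC: "S \<subseteq> ?C" and li: "lin_indpt S" by (auto simp: maximal_def)
  have finS: "finite S" using SC finite_subset by blast
  have "\<forall>s\<in>S. \<exists>j. j < nc \<and> col A j = s" using SC A by (fastforce simp: cols_def)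
  then obtain g where g: "\<And>s. s \<in> S \<Longrightarrow> g s < nc \<and> col A (g s) = s" by metis
  \<comment> \<open>One index is kept for each vector of the basis, so that \<open>col A\<close> is
    a bijection from \<open>J\<close> onto \<open>S\<close>.\<close>
  define J where "J = g ` S"
  have J: "J \<subseteq> {..<nc}" using g by (auto simp: J_def)
  have colJ: "col A ` J = S" unfolding J_def image_image using g by (simp cong: image_cong)
  have inj: "inj_on (col A) J" by (rule inj_onI) (use g in \<open>auto simp: J_def\<close>)
  have card: "card J = rank A"
    using rank_card_indpt[OF A S] card_image[OF inj] colJ by simp
  have indep: "indep_cols n A J"
    unfolding indep_cols_def
  proof (intro allI impI)
    fix c assume c: "\<forall>i<n. (\<Sum>j\<in>J. c j * A $$ (i, j)) = 0"
    have cg: "c (g (col A j)) = c j" if "j \<in> J" for j using that g by (auto simp: J_def)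
    have "lincomb (\<lambda>v. c (g v)) S = 0\<^sub>v n"
    proof (rule eq_vecI)
      show "dim_vec (lincomb (\<lambda>v. c (g v)) S) = dim_vec (0\<^sub>v n)"
        using lincomb_dim[OF finS] SC C by auto
      fix i assume "i < dim_vec (0\<^sub>v n)"
      then have i: "i < n" by simp
      have "lincomb (\<lambda>v. c (g v)) S $ i = (\<Sum>j\<in>J. c (g (col A j)) * A $$ (i, j))"
        using lincomb_cols_index[OF A J inj i] by (simp add: colJ)
      also have "\<dots> = (\<Sum>j\<in>J. c j * A $$ (i, j))" by (rule sum.cong) (simp_all add: cg)
      finally show "lincomb (\<lambda>v. c (g v)) S $ i = 0\<^sub>v n $ i" using c i by simp
    qed
    then have "(\<lambda>v. c (g v)) \<in> S \<rightarrow> {0}" using not_lindepD[OF li finS subset_refl] by simp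
    then show "\<forall>j\<in>J. c j = 0" using g by (auto simp: J_def)
  qed
  have spanning: "spanning_cols n nc A J"
    unfolding spanning_cols_def
  proof (intro allI impI)
    fix k assume k: "k < nc"
    have ScarV: "S \<subseteq> carrier_vec n" using SC C by blast
    have kC: "col A k \<in> ?C" using k A by (auto simp: cols_def)
    have "col A k \<in> span S"
    proof (cases "col A k \<in> S")
      case True
      then show ?thesis using span_mem[OF ScarV] by blast
    next
      case False
      then have "lin_dep (S \<union> {col A k})" using S kC SC unfolding maximal_def by blast
      then show ?thesis using lin_dep_iff_in_span[OF ScarV li _ False] kC C by blast
    qed
    then obtain a where a: "lincomb a S = col A k" using finite_in_span[OF finS ScarV] by blast
    have "A $$ (i, k) = (\<Sum>j\<in>J. a (col A j) * A $$ (i, j))" if i: "i < n" for i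
      using lincomb_cols_index[OF A J inj i, of a] a colJ A k i by simp
    then show "\<exists>c. \<forall>i<n. A $$ (i, k) = (\<Sum>j\<in>J. c j * A $$ (i, j))" by (intro exI[of _ "\<lambda>j. a (col A j)"]) simp
  qed
  show thesis by (rule that[OF J card indep spanning])
qed

end

text \<open>A column basis of \<open>A\<close> and the shifted column basis of \<open>B\<close>
  together form one of the block matrix: linear relations restrict to each row block, and
  combinations extend by zero coefficients on the other block.\<close>

lemma rank_four_block_diag:
  fixes A B :: "'a::field mat"
  assumes A: "A \<in> carrier_mat n n" and B: "B \<in> carrier_mat m m"
  shows "vec_space.rank (n + m) (four_block_mat A (0\<^sub>m n m) (0\<^sub>m m n) B) =
     vec_space.rank n A + vec_space.rank m B"
proof -
  let ?M = "four_block_mat A (0\<^sub>m n m) (0\<^sub>m m n) B"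
  have M: "?M \<in> carrier_mat (n + m) (n + m)" using A B by auto
  obtain J where J: "J \<subseteq> {..<n}" "card J = vec_space.rank n A" "indep_cols n A J" "spanning_cols n n A J"
    using vec_space.rank_col_basis[OF A] .
  obtain K where K: "K \<subseteq> {..<m}" "card K = vec_space.rank m B" "indep_cols m B K" "spanning_cols m m B K"
    using vec_space.rank_col_basis[OF B] .
  define L where "L = J \<union> (\<lambda>k. n + k) ` K"
  have fin: "finite J" "finite K" using J K finite_subset by blast+
  have L: "L \<subseteq> {..<n + m}" using J K by (auto simp: L_def)
  have disj: "J \<inter> (\<lambda>k. n + k) ` K = {}" using J by auto
  have cardL: "card L = card J + card K"
    unfolding L_def using disj fin by (subst card_Un_disjoint) (auto simp: card_image)
  have sumL: "(\<Sum>j\<in>L. c j * ?M $$ (i, j)) =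
      (\<Sum>j\<in>J. c j * ?M $$ (i, j)) + (\<Sum>k\<in>K. c (n + k) * ?M $$ (i, n + k))" for c i
    unfolding L_def using disj fin by (subst sum.union_disjoint) (auto simp: sum.reindex)
  have M1: "?M $$ (i, j) = A $$ (i, j)" if "i < n" "j < n" for i j using that A B by simp
  have M2: "?M $$ (i, n + j) = 0" if "i < n" "j < m" for i j using that A B by simp
  have M3: "?M $$ (n + i, j) = 0" if "i < m" "j < n" for i j using that A B by simp
  have M4: "?M $$ (n + i, n + j) = B $$ (i, j)" if "i < m" "j < m" for i j using that A B by simp
  have sum1: "(\<Sum>j\<in>L. c j * ?M $$ (i, j)) = (\<Sum>j\<in>J. c j * A $$ (i, j))" if i: "i < n" for c i
  proof -
    have "(\<Sum>j\<in>J. c j * ?M $$ (i, j)) = (\<Sum>j\<in>J. c j * A $$ (i, j))"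
      by (rule sum.cong) (use i J(1) M1 in auto)
    moreover have "(\<Sum>k\<in>K. c (n + k) * ?M $$ (i, n + k)) = 0"
      by (rule sum.neutral) (use i K(1) M2 in auto)
    ultimately show ?thesis unfolding sumL by simp
  qed
  have sum2: "(\<Sum>j\<in>L. c j * ?M $$ (n + i, j)) = (\<Sum>k\<in>K. c (n + k) * B $$ (i, k))" if i: "i < m" for c i
  proof -
    have "(\<Sum>k\<in>K. c (n + k) * ?M $$ (n + i, n + k)) = (\<Sum>k\<in>K. c (n + k) * B $$ (i, k))"
      by (rule sum.cong) (use i K(1) M4 in auto)
    moreover have "(\<Sum>j\<in>J. c j * ?M $$ (n + i, j)) = 0"
      by (rule sum.neutral) (use i J(1) M3 in auto)
    ultimately show ?thesis unfolding sumL by simp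
  qed
  have "indep_cols (n + m) ?M L"
    unfolding indep_cols_def
  proof (intro allI impI)
    fix c assume c: "\<forall>i<n + m. (\<Sum>j\<in>L. c j * ?M $$ (i, j)) = 0"
    have "(\<Sum>j\<in>J. c j * A $$ (i, j)) = 0" if "i < n" for i
      using c[rule_format, of i] sum1[OF that, of c] that by (simp only: trans_less_add1)
    then have "\<forall>j\<in>J. c j = 0" using J(3) unfolding indep_cols_def by blast
    moreover have "(\<Sum>k\<in>K. c (n + k) * B $$ (i, k)) = 0" if "i < m" for i
      using c[rule_format, of "n + i"] sum2[OF that, of c] that by (simp only: nat_add_left_cancel_less)
    then have "\<forall>k\<in>K. c (n + k) = 0" using K(3) unfolding indep_cols_def by (auto dest: spec[of _ "\<lambda>k. c (n + k)"])
    ultimately show "\<forall>j\<in>L. c j = 0" by (auto simp: L_def)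
  qed
  moreover have "spanning_cols (n + m) (n + m) ?M L"
    unfolding spanning_cols_def
  proof (intro allI impI)
    fix k assume k: "k < n + m"
    have split: "P i" if "\<And>i. i < n \<Longrightarrow> P i" "\<And>i. i < m \<Longrightarrow> P (n + i)" "i < n + m" for P i
      using that by (metis add_diff_inverse_nat nat_add_left_cancel_less)
    show "\<exists>c. \<forall>i<n + m. ?M $$ (i, k) = (\<Sum>j\<in>L. c j * ?M $$ (i, j))"
    proof (cases "k < n")
      case True
      then obtain c where c: "\<forall>i<n. A $$ (i, k) = (\<Sum>j\<in>J. c j * A $$ (i, j))"
        using J(4) unfolding spanning_cols_def by blast
      define c' where "c' j = (if j < n then c j else 0)" for j
      have "?M $$ (i, k) = (\<Sum>j\<in>L. c' j * ?M $$ (i, j))" if "i < n + m" for i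
        using that
      proof (rule split[rotated 2])
        fix i assume i: "i < n"
        have "(\<Sum>j\<in>J. c' j * A $$ (i, j)) = (\<Sum>j\<in>J. c j * A $$ (i, j))"
          by (rule sum.cong) (use J(1) in \<open>auto simp: c'_def\<close>)
        then show "?M $$ (i, k) = (\<Sum>j\<in>L. c' j * ?M $$ (i, j))" using sum1[OF i] M1[OF i True] c i by simp
      next
        fix i assume i: "i < m"
        show "?M $$ (n + i, k) = (\<Sum>j\<in>L. c' j * ?M $$ (n + i, j))"
          unfolding sum2[OF i] M3[OF i True] by (simp add: c'_def)
      qed
      then show ?thesis by blast
    next
      case False
      define l where "l = k - n"
      have l: "k = n + l" "l < m" using False k by (auto simp: l_def)
      then obtain c where c: "\<forall>i<m. B $$ (i, l) = (\<Sum>j\<in>K. c j * B $$ (i, j))"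
        using K(4) unfolding spanning_cols_def by blast
      define c' where "c' j = (if j < n then 0 else c (j - n))" for j
      have "?M $$ (i, k) = (\<Sum>j\<in>L. c' j * ?M $$ (i, j))" if "i < n + m" for i
        using that
      proof (rule split[rotated 2])
        fix i assume i: "i < n"
        have "(\<Sum>j\<in>J. c' j * A $$ (i, j)) = 0"
          by (rule sum.neutral) (use J(1) in \<open>auto simp: c'_def\<close>)
        then show "?M $$ (i, k) = (\<Sum>j\<in>L. c' j * ?M $$ (i, j))" using sum1[OF i] M2[OF i l(2)] l(1) by simp
      next
        fix i assume i: "i < m"
        show "?M $$ (n + i, k) = (\<Sum>j\<in>L. c' j * ?M $$ (n + i, j))"
          unfolding sum2[OF i] using M4[OF i l(2)] c i l(1) by (simp add: c'_def)
      qed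
      then show ?thesis by blast
    qed
  qed
  ultimately have "vec_space.rank (n + m) ?M = card L"
    using vec_space.card_indep_cols_le_rank[OF M L] vec_space.rank_le_card_spanning_cols[OF M L]
    by (intro antisym) auto
  then show ?thesis using cardL J(2) K(2) by simp
qed

section \<open>Block sums and permutation matrices\<close>

lemma diag_block_mat_closed:
  "(\<forall>A\<in>set As. dim_row A = dim_col A) \<Longrightarrow>
     diag_block_mat As \<in> carrier_mat (sum_list (map dim_row As)) (sum_list (map dim_row As))"
  by (auto simp: dim_diag_block_mat intro!: carrier_matI arg_cong[of _ _ sum_list] map_cong)

text \<open>Corresponding blocks are square of equal size, but the size may vary along the lists;
  \<open>N\<close> is the sum of the sizes.\<close>

lemma diag_block_mat_pair_closed:
  assumes "list_all2 (\<lambda>A B. \<exists>n. A \<in> carrier_mat n n \<and> B \<in> carrier_mat n n) As Bs"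
  shows "\<exists>N. diag_block_mat As \<in> carrier_mat N N \<and> diag_block_mat Bs \<in> carrier_mat N N"
  using assms
proof induction
  case Nil
  show ?case by (rule exI[of _ 0]) simp
next
  case (Cons A As B Bs)
  then obtain n N where "A \<in> carrier_mat n n" "B \<in> carrier_mat n n"
    "diag_block_mat As \<in> carrier_mat N N" "diag_block_mat Bs \<in> carrier_mat N N" by blast
  then show ?case by (intro exI[of _ "n + N"]) (simp add: Let_def)
qed

lemma diag_block_mat_map2_mult:
  fixes As Bs :: "'a::semiring_0 mat list"
  assumes "list_all2 (\<lambda>A B. \<exists>n. A \<in> carrier_mat n n \<and> B \<in> carrier_mat n n) As Bs"
  shows "diag_block_mat As * diag_block_mat Bs = diag_block_mat (map2 (*) As Bs)"
  using assms
proof induction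
  case (Cons A As B Bs)
  then obtain n where AB: "A \<in> carrier_mat n n" "B \<in> carrier_mat n n" by blast
  obtain N where D: "diag_block_mat As \<in> carrier_mat N N" "diag_block_mat Bs \<in> carrier_mat N N"
    using diag_block_mat_pair_closed[OF Cons.hyps(2)] by blast
  let ?DA = "diag_block_mat As" and ?DB = "diag_block_mat Bs"
  have "four_block_mat A (0\<^sub>m n N) (0\<^sub>m N n) ?DA * four_block_mat B (0\<^sub>m n N) (0\<^sub>m N n) ?DB =
      four_block_mat (A * B + 0\<^sub>m n N * 0\<^sub>m N n) (A * 0\<^sub>m n N + 0\<^sub>m n N * ?DB)
        (0\<^sub>m N n * B + ?DA * 0\<^sub>m N n) (0\<^sub>m N n * 0\<^sub>m n N + ?DA * ?DB)"
    by (rule mult_four_block_mat) (use AB D in auto)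
  also have "\<dots> = four_block_mat (A * B) (0\<^sub>m n N) (0\<^sub>m N n) (?DA * ?DB)"
  proof -
    have "A * B \<in> carrier_mat n n" "?DA * ?DB \<in> carrier_mat N N" using AB D by auto
    then show ?thesis using AB D by simp
  qed
  finally show ?case using AB D by (simp add: Let_def Cons.IH[symmetric])
qed simp

lemma diag_block_mat_map2_minus:
  fixes As Bs :: "'a::ab_group_add mat list"
  assumes "list_all2 (\<lambda>A B. \<exists>n. A \<in> carrier_mat n n \<and> B \<in> carrier_mat n n) As Bs"
  shows "diag_block_mat As - diag_block_mat Bs = diag_block_mat (map2 (-) As Bs)"
  using assms
proof induction
  case (Cons A As B Bs)
  then obtain n where AB: "A \<in> carrier_mat n n" "B \<in> carrier_mat n n" by blast
  obtain N where D: "diag_block_mat As \<in> carrier_mat N N" "diag_block_mat Bs \<in> carrier_mat N N"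
    using diag_block_mat_pair_closed[OF Cons.hyps(2)] by blast
  have "diag_block_mat (A # As) - diag_block_mat (B # Bs) =
      four_block_mat (A - B) (0\<^sub>m n N) (0\<^sub>m N n) (diag_block_mat As - diag_block_mat Bs)"
    using AB D by (intro eq_matI) (auto simp: Let_def)
  then show ?case using AB D by (simp add: Let_def Cons.IH[symmetric])
qed simp

lemma rank_diag_block_mat:
  fixes As :: "'a::field mat list"
  assumes "\<forall>A\<in>set As. dim_row A = dim_col A"
  shows "vec_space.rank (dim_row (diag_block_mat As)) (diag_block_mat As) =
     (\<Sum>A\<leftarrow>As. vec_space.rank (dim_row A) A)"
  using assms
proof (induction As)
  case Nil
  then show ?case using vec_space.rank_0I[of 0 0] by simp
next
  case (Cons A As)
  let ?D = "diag_block_mat As"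
  obtain a where A: "A \<in> carrier_mat a a" using Cons.prems by (auto intro: carrier_matI)
  obtain N where D: "?D \<in> carrier_mat N N"
    using diag_block_mat_closed[of As] Cons.prems by auto
  have dims: "dim_row A = a" "dim_col A = a" "dim_row ?D = N" "dim_col ?D = N" using A D by auto
  have eq: "diag_block_mat (A # As) = four_block_mat A (0\<^sub>m a N) (0\<^sub>m N a) ?D"
    by (simp add: Let_def dims)
  have "vec_space.rank N ?D = (\<Sum>A\<leftarrow>As. vec_space.rank (dim_row A) A)"
    using Cons.IH Cons.prems dims by simp
  then show ?case using rank_four_block_diag[OF A D] by (simp add: eq dims)
qed

lemma mat_trace_four_block_diag:
  assumes "A \<in> carrier_mat n n" "B \<in> carrier_mat m m"
  shows "mat_trace (four_block_mat A (0\<^sub>m n m) (0\<^sub>m m n) B) = mat_trace A + mat_trace B"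
proof -
  have "(\<Sum>i<n + m. f i) = (\<Sum>i<n. f i) + (\<Sum>i<m. f (n + i))" for f :: "nat \<Rightarrow> 'a"
    by (induction m) (simp_all add: add.assoc)
  then show ?thesis using assms by (simp add: mat_trace_def)
qed

lemma mat_trace_diag_block_mat:
  assumes "\<forall>A\<in>set As. dim_row A = dim_col A"
  shows "mat_trace (diag_block_mat As) = (\<Sum>A\<leftarrow>As. mat_trace A)"
  using assms
proof (induction As)
  case Nil
  then show ?case by (simp add: mat_trace_def)
next
  case (Cons A As)
  let ?D = "diag_block_mat As"
  obtain a where A: "A \<in> carrier_mat a a" using Cons.prems by (auto intro: carrier_matI)
  obtain N where D: "?D \<in> carrier_mat N N"
    using diag_block_mat_closed[of As] Cons.prems by auto
  have dims: "dim_row A = a" "dim_col A = a" "dim_row ?D = N" "dim_col ?D = N" using A D by auto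
  have eq: "diag_block_mat (A # As) = four_block_mat A (0\<^sub>m a N) (0\<^sub>m N a) ?D"
    by (simp add: Let_def dims)
  show ?case using mat_trace_four_block_diag[OF A D] Cons.IH Cons.prems by (simp add: eq del: diag_block_mat.simps)
qed

section \<open>Adjoints of complex matrices\<close>

lemma dim_mat_adjoint [simp]:
  "dim_row (mat_adjoint A) = dim_col A" "dim_col (mat_adjoint A) = dim_row A"
  by (simp_all add: mat_adjoint_def)

lemma mat_adjoint_index [simp]:
  "i < dim_col A \<Longrightarrow> j < dim_row A \<Longrightarrow> mat_adjoint A $$ (i, j) = conjugate (A $$ (j, i))"
  by (simp add: mat_adjoint_def mat_of_rows_index)

lemma mat_adjoint_carrier: "A \<in> carrier_mat n m \<Longrightarrow> mat_adjoint A \<in> carrier_mat m n"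
  by (auto intro: carrier_matI)

lemma mat_adjoint_mat_adjoint: "mat_adjoint (mat_adjoint A) = (A :: complex mat)"
  by (rule eq_matI) auto

lemma mat_adjoint_mult:
  assumes "A \<in> carrier_mat n m" "B \<in> carrier_mat m k"
  shows "mat_adjoint (A * B) = mat_adjoint B * mat_adjoint (A :: complex mat)"
  using assms by (intro eq_matI) (auto simp: scalar_prod_def cnj_sum mult.commute intro!: sum.cong)

lemma mat_adjoint_diag_block_mat:
  "mat_adjoint (diag_block_mat As) = diag_block_mat (map mat_adjoint (As :: complex mat list))"
proof (induction As)
  case (Cons A As)
  have "mat_adjoint (four_block_mat A (0\<^sub>m (dim_row A) (dim_col B)) (0\<^sub>m (dim_row B) (dim_col A)) B) =
      four_block_mat (mat_adjoint A) (0\<^sub>m (dim_col A) (dim_row B)) (0\<^sub>m (dim_col B) (dim_row A)) (mat_adjoint B)"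
    for B :: "complex mat"
    by (rule eq_matI) auto
  then show ?case by (simp add: Let_def Cons.IH[symmetric])
qed (auto intro: eq_matI)

text \<open>Repeating the two blocks \<open>m\<close> and \<open>n\<close> times gives them equal weight, so normalised ranks and
  traces are averaged. (Tensor products would not do in the linear case: there a scalar matrix may
  cancel against an eigenvalue of the other factor.)\<close>

definition block_sum :: "nat \<Rightarrow> nat \<Rightarrow> 'a::zero mat \<Rightarrow> 'a mat \<Rightarrow> 'a mat" where
  "block_sum n m A B = diag_block_mat (replicate m A @ replicate n B)"

lemma block_sum_carrier:
  assumes "A \<in> carrier_mat n n" "B \<in> carrier_mat m m"
  shows "block_sum n m A B \<in> carrier_mat (2 * n * m) (2 * n * m)"
proof -
  let ?L = "replicate m A @ replicate n B"
  have "sum_list (map dim_row ?L) = 2 * n * m" using assms by (simp add: sum_list_replicate)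
  moreover have "\<forall>A\<in>set ?L. dim_row A = dim_col A" using assms by auto
  ultimately show ?thesis using diag_block_mat_closed[of ?L] unfolding block_sum_def by simp
qed

lemma block_sum_blocks:
  assumes "A \<in> carrier_mat n n" "B \<in> carrier_mat m m" "A' \<in> carrier_mat n n" "B' \<in> carrier_mat m m"
  shows "list_all2 (\<lambda>A B. \<exists>n. A \<in> carrier_mat n n \<and> B \<in> carrier_mat n n)
     (replicate m A @ replicate n B) (replicate m A' @ replicate n B')"
  using assms by (intro list_all2_appendI) (auto simp: list_all2_conv_all_nth)

lemma block_sum_mult:
  fixes A B :: "'a::semiring_0 mat"
  assumes "A \<in> carrier_mat n n" "B \<in> carrier_mat m m" "A' \<in> carrier_mat n n" "B' \<in> carrier_mat m m"
  shows "block_sum n m A B * block_sum n m A' B' = block_sum n m (A * A') (B * B')"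
  unfolding block_sum_def diag_block_mat_map2_mult[OF block_sum_blocks[OF assms]]
  by (simp add: zip_replicate)

lemma block_sum_minus:
  fixes A B :: "'a::ab_group_add mat"
  assumes "A \<in> carrier_mat n n" "B \<in> carrier_mat m m" "A' \<in> carrier_mat n n" "B' \<in> carrier_mat m m"
  shows "block_sum n m A B - block_sum n m A' B' = block_sum n m (A - A') (B - B')"
  unfolding block_sum_def diag_block_mat_map2_minus[OF block_sum_blocks[OF assms]]
  by (simp add: zip_replicate)

lemma block_sum_one: "block_sum n m (1\<^sub>m n) (1\<^sub>m m) = (1\<^sub>m (2 * n * m) :: 'a::{zero,one} mat)"
proof -
  let ?L = "replicate m (1\<^sub>m n) @ replicate n (1\<^sub>m m) :: 'a mat list"
  have "diag_block_mat ?L = diag_block_mat (map (\<lambda>A. 1\<^sub>m (dim_row A)) ?L)" by simp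
  also have "\<dots> = 1\<^sub>m (sum_list (map dim_row ?L))" by (rule diag_block_one_mat)
  also have "sum_list (map dim_row ?L) = 2 * n * m" by (simp add: sum_list_replicate)
  finally show ?thesis unfolding block_sum_def .
qed

lemma block_sum_adjoint:
  "mat_adjoint (block_sum n m A B) = block_sum n m (mat_adjoint A) (mat_adjoint (B :: complex mat))"
  by (simp add: block_sum_def mat_adjoint_diag_block_mat)

lemma rank_block_sum:
  fixes A B :: "'a::field mat"
  assumes "A \<in> carrier_mat n n" "B \<in> carrier_mat m m"
  shows "vec_space.rank (2 * n * m) (block_sum n m A B) = m * vec_space.rank n A + n * vec_space.rank m B"
  using rank_diag_block_mat[of "replicate m A @ replicate n B"] block_sum_carrier[OF assms] assms
  by (simp add: sum_list_replicate Ball_def flip: block_sum_def)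

lemma mat_trace_block_sum:
  fixes A B :: "'a::comm_semiring_1 mat"
  assumes "A \<in> carrier_mat n n" "B \<in> carrier_mat m m"
  shows "mat_trace (block_sum n m A B) = of_nat m * mat_trace A + of_nat n * mat_trace B"
  using mat_trace_diag_block_mat[of "replicate m A @ replicate n B"] assms
  by (simp add: block_sum_def sum_list_replicate Ball_def)

text \<open>Rows and columns are counted from 0, whereas \<open>sym_group m\<close> acts on \<open>{1..m}\<close>.\<close>

definition perm_mat :: "nat \<Rightarrow> (nat \<Rightarrow> nat) \<Rightarrow> 'a::{zero,one} mat" where
  "perm_mat m p = mat m m (\<lambda>(i, j). if p (Suc j) = Suc i then 1 else 0)"

lemma perm_mat_carrier [simp]: "perm_mat m p \<in> carrier_mat m m"
  by (simp add: perm_mat_def)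

lemma perm_mat_index:
  "i < m \<Longrightarrow> j < m \<Longrightarrow> perm_mat m p $$ (i, j) = (if p (Suc j) = Suc i then 1 else 0)"
  by (simp add: perm_mat_def)

lemma perm_mat_id: "perm_mat m id = 1\<^sub>m m"
  by (rule eq_matI) (auto simp: perm_mat_def)

lemma permutes_Suc_image:
  assumes "p permutes {1..m}" "j < m"
  obtains k where "k < m" "p (Suc j) = Suc k"
proof -
  have "p (Suc j) \<in> {1..m}" using assms permutes_in_image[OF assms(1), of "Suc j"] by simp
  then show thesis using that[of "p (Suc j) - 1"] by auto
qed

text \<open>Column \<open>j\<close> of \<open>perm_mat m q\<close> is the unit vector at
  \<open>l\<close>, where \<open>q (Suc j) = Suc l\<close>, so the sum over the inner index
  collapses to one term.\<close>

lemma perm_mat_mult: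
  assumes "q permutes {1..m}"
  shows "perm_mat m (p \<circ> q) = (perm_mat m p * perm_mat m q :: 'a::semiring_1 mat)"
proof (rule eq_matI)
  fix i j assume "i < dim_row (perm_mat m p * perm_mat m q :: 'a mat)" "j < dim_col (perm_mat m p * perm_mat m q :: 'a mat)"
  then have ij: "i < m" "j < m" by (simp_all add: perm_mat_def)
  obtain l where l: "l < m" "q (Suc j) = Suc l" using permutes_Suc_image[OF assms ij(2)] .
  have "(perm_mat m p * perm_mat m q :: 'a mat) $$ (i, j)
      = (\<Sum>k = 0..<m. perm_mat m p $$ (i, k) * perm_mat m q $$ (k, j))"
    using ij by (simp add: perm_mat_def scalar_prod_def)
  also have "\<dots> = (\<Sum>k = 0..<m. if k = l then perm_mat m p $$ (i, k) else 0)"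
    by (rule sum.cong) (use ij l in \<open>auto simp: perm_mat_index\<close>)
  also have "\<dots> = perm_mat m p $$ (i, l)" using l by simp
  finally show "perm_mat m (p \<circ> q) $$ (i, j) = (perm_mat m p * perm_mat m q :: 'a mat) $$ (i, j)"
    using ij l by (simp add: perm_mat_index)
qed (simp_all add: perm_mat_def)

text \<open>Column \<open>j\<close> stands for the point \<open>Suc j\<close>; this turns counts of
  columns into counts of points.\<close>

lemma card_moved_Suc:
  "card {j. j < m \<and> p (Suc j) \<noteq> q (Suc j)} = card {i \<in> {1..m}. p i \<noteq> q i}"
proof -
  have "{i \<in> {1..m}. p i \<noteq> q i} = Suc ` {j. j < m \<and> p (Suc j) \<noteq> q (Suc j)}"
    by (auto simp: image_iff) (metis Suc_le_D Suc_le_eq)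
  then show ?thesis by (simp add: card_image)
qed

text \<open>Columns at which \<open>p\<close> and \<open>q\<close> agree vanish in the difference,
  so the others span.\<close>

lemma rank_perm_mat_diff_le:
  "vec_space.rank m (perm_mat m p - perm_mat m q :: 'a::field mat) \<le> card {i \<in> {1..m}. p i \<noteq> q i}"
proof -
  let ?M = "perm_mat m p - perm_mat m q :: 'a mat" and ?J = "{j. j < m \<and> p (Suc j) \<noteq> q (Suc j)}"
  have "spanning_cols m m ?M ?J"
    unfolding spanning_cols_def
  proof (intro allI impI)
    fix k assume k: "k < m"
    have "?M $$ (i, k) = (\<Sum>j\<in>?J. (if j = k then 1 else 0) * ?M $$ (i, j))" if i: "i < m" for i
    proof (cases "k \<in> ?J")
      case True
      then show ?thesis by (simp add: if_distrib[of "\<lambda>x. x * _"] cong: if_cong)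
    next
      case False
      then have "(\<Sum>j\<in>?J. (if j = k then 1 else 0) * ?M $$ (i, j)) = 0" by (intro sum.neutral) auto
      then show ?thesis using False k i by (simp add: perm_mat_def)
    qed
    then show "\<exists>c. \<forall>i<m. ?M $$ (i, k) = (\<Sum>j\<in>?J. c j * ?M $$ (i, j))"
      by (intro exI[of _ "\<lambda>j. if j = k then 1 else 0"]) simp
  qed
  then have "vec_space.rank m ?M \<le> card ?J"
    by (intro vec_space.rank_le_card_spanning_cols[of _ _ m]) (auto intro: minus_carrier_mat[OF perm_mat_carrier])
  then show ?thesis by (simp only: card_moved_Suc)
qed

text \<open>A maximal \<open>I\<close> with \<open>s ` I\<close> disjoint from \<open>I\<close> works, as every other point of \<open>M\<close> lies in \<open>s ` I\<close>
  or is mapped into \<open>I\<close>.\<close>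

lemma exists_large_displaced_subset:
  assumes fin: "finite M" and inj: "inj_on s M" and moved: "\<And>x. x \<in> M \<Longrightarrow> s x \<noteq> x"
  obtains I where "I \<subseteq> M" "s ` I \<inter> I = {}" "card M \<le> 3 * card I"
proof -
  let ?P = "\<lambda>I. I \<subseteq> M \<and> s ` I \<inter> I = {}"
  have "?P {}" by simp
  moreover have "\<forall>I. ?P I \<longrightarrow> card I < Suc (card M)" using fin by (auto simp: less_Suc_eq_le intro: card_mono)
  ultimately obtain I where I: "?P I" "\<And>I'. ?P I' \<Longrightarrow> card I' \<le> card I"
    using ex_has_greatest_nat[of ?P "{}" card "Suc (card M)"] by (metis less_imp_le)
  have finI: "finite I" using I(1) fin finite_subset by blast
  have "M \<subseteq> I \<union> s ` I \<union> {x \<in> M. s x \<in> I}"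
  proof (rule ccontr)
    assume "\<not> ?thesis"
    then obtain x where x: "x \<in> M" "x \<notin> I" "x \<notin> s ` I" "s x \<notin> I" by blast
    then have "?P (insert x I)" using I(1) moved by auto
    then have "card (insert x I) \<le> card I" by (rule I(2))
    then show False using x(2) finI by simp
  qed
  then have "card M \<le> card (I \<union> s ` I \<union> {x \<in> M. s x \<in> I})"
    by (rule card_mono[rotated]) (use finI fin in simp)
  also have "\<dots> \<le> card I + card (s ` I) + card {x \<in> M. s x \<in> I}"
    by (intro order_trans[OF card_Un_le] add_right_mono card_Un_le)
  also have "card (s ` I) \<le> card I" by (rule card_image_le[OF finI])
  also have "card {x \<in> M. s x \<in> I} \<le> card I"
    by (rule card_inj_on_le[OF _ _ finI, of s]) (use inj in \<open>auto intro: inj_on_subset\<close>)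
  finally have "card M \<le> 3 * card I" by simp
  then show thesis using I(1) by (intro that[of I]) blast+
qed

text \<open>Column \<open>j\<close> of the difference, for a moved point, has 1 in row
  \<open>s j\<close> and -1 in row \<open>j\<close>. If \<open>I\<close> is disjoint from its image
  under \<open>s\<close>, row \<open>s l\<close> with \<open>l \<in> I\<close> meets the columns of
  \<open>I\<close> only in column \<open>l\<close>; hence these columns are independent over every
  field. The factor 3 is the loss in choosing \<open>I\<close>.\<close>

lemma rank_perm_mat_diff_one_ge:
  assumes p: "p permutes {1..m}"
  shows "card {i \<in> {1..m}. p i \<noteq> i} \<le> 3 * vec_space.rank m (perm_mat m p - perm_mat m id :: 'a::field mat)"
proof -
  let ?M = "perm_mat m p - perm_mat m id :: 'a mat" and ?J = "{j. j < m \<and> p (Suc j) \<noteq> id (Suc j)}"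
  define s where "s j = p (Suc j) - 1" for j
  have s: "p (Suc j) = Suc (s j)" "s j < m" if j: "j < m" for j
  proof -
    obtain k where k: "k < m" "p (Suc j) = Suc k" using permutes_Suc_image[OF p j] .
    show "p (Suc j) = Suc (s j)" "s j < m" using k by (simp_all add: s_def)
  qed
  have "inj_on s ?J"
  proof (rule inj_onI)
    fix j k assume "j \<in> ?J" "k \<in> ?J" "s j = s k"
    then have "p (Suc j) = p (Suc k)" using s(1) by simp
    then show "j = k" using permutes_inj[OF p] by (simp add: inj_eq)
  qed
  moreover have "s j \<noteq> j" if "j \<in> ?J" for j using that s(1) by auto
  ultimately obtain I where I: "I \<subseteq> ?J" "s ` I \<inter> I = {}" "card ?J \<le> 3 * card I"
    using exists_large_displaced_subset[of ?J s] by auto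
  have finI: "finite I" using I(1) finite_subset by fastforce
  have "indep_cols m ?M I"
    unfolding indep_cols_def
  proof (intro allI impI ballI)
    fix c l assume c: "\<forall>i<m. (\<Sum>j\<in>I. c j * ?M $$ (i, j)) = 0" and l: "l \<in> I"
    have lm: "l < m" using l I(1) by auto
    have "c j * ?M $$ (s l, j) = (if j = l then c j else 0)" if j: "j \<in> I" for j
    proof -
      have jm: "j < m" using j I(1) by auto
      have "s l \<noteq> j" using I(2) l j by blast
      moreover have "s j = s l \<longleftrightarrow> j = l"
        using \<open>inj_on s ?J\<close> I(1) j l by (auto dest: inj_onD)
      ultimately show ?thesis using s[OF jm] s[OF lm] jm by (auto simp: perm_mat_def)
    qed
    then have "(\<Sum>j\<in>I. c j * ?M $$ (s l, j)) = (\<Sum>j\<in>I. if j = l then c j else 0)" by (rule sum.cong[OF refl])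
    also have "\<dots> = c l" using finI l by simp
    finally show "c l = 0" using c s(2)[OF lm] by simp
  qed
  moreover have "?M \<in> carrier_mat m m" by (rule minus_carrier_mat[OF perm_mat_carrier])
  moreover have "I \<subseteq> {..<m}" using I(1) by auto
  ultimately have "card I \<le> vec_space.rank m ?M" by (intro vec_space.card_indep_cols_le_rank)
  moreover have "card ?J = card {i \<in> {1..m}. p i \<noteq> i}" using card_moved_Suc[of m p id] by simp
  ultimately show ?thesis using I(3) by simp
qed

section \<open>Linear sofic and hyperlinear groups\<close>

lemma GL_group_simps:
  "A \<in> carrier (GL_group TYPE('k::field) n) \<longleftrightarrow>
     A \<in> carrier_mat n n \<and> (\<exists>B\<in>carrier_mat n n. B * A = 1\<^sub>m n \<and> A * B = 1\<^sub>m n)"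
  "A \<otimes>\<^bsub>GL_group TYPE('k) n\<^esub> B = A * B" "\<one>\<^bsub>GL_group TYPE('k) n\<^esub> = 1\<^sub>m n"
  by (auto simp: GL_group_def units_of_def Units_def ring_mat_def)

lemma group_GL_group: "group (GL_group TYPE('k::field) n)"
proof -
  interpret ring "ring_mat TYPE('k) n ()" by (rule ring_mat)
  show ?thesis unfolding GL_group_def by (rule units_group)
qed

lemma unitary_group_simps:
  "A \<in> carrier (unitary_group n) \<longleftrightarrow>
     A \<in> carrier_mat n n \<and> A * mat_adjoint A = 1\<^sub>m n \<and> mat_adjoint A * A = 1\<^sub>m n"
  "A \<otimes>\<^bsub>unitary_group n\<^esub> B = A * B" "\<one>\<^bsub>unitary_group n\<^esub> = 1\<^sub>m n"
  by (auto simp: unitary_group_def)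

lemma mat_adjoint_one: "mat_adjoint (1\<^sub>m n) = (1\<^sub>m n :: complex mat)"
  by (rule eq_matI) auto

lemma unitary_mult:
  assumes "A \<in> carrier_mat n n" "B \<in> carrier_mat n n" "A * mat_adjoint A = 1\<^sub>m n" "B * mat_adjoint B = (1\<^sub>m n :: complex mat)"
  shows "(A * B) * mat_adjoint (A * B) = 1\<^sub>m n"
proof -
  have adj: "mat_adjoint A \<in> carrier_mat n n" "mat_adjoint B \<in> carrier_mat n n"
    using assms mat_adjoint_carrier by blast+
  have "(A * B) * mat_adjoint (A * B) = A * (B * (mat_adjoint B * mat_adjoint A))"
    unfolding mat_adjoint_mult[OF assms(1,2)]
    by (rule assoc_mult_mat[OF assms(1,2) mult_carrier_mat[OF adj(2,1)]])
  also have "B * (mat_adjoint B * mat_adjoint A) = (B * mat_adjoint B) * mat_adjoint A"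
    by (rule assoc_mult_mat[OF assms(2) adj(2,1), symmetric])
  finally show ?thesis using assms(3,4) by (simp add: left_mult_one_mat[OF adj(1)])
qed

lemma group_unitary_group: "group (unitary_group n)"
proof (rule groupI)
  fix A B assume "A \<in> carrier (unitary_group n)" "B \<in> carrier (unitary_group n)"
  then have A: "A \<in> carrier_mat n n" "A * mat_adjoint A = 1\<^sub>m n" "mat_adjoint A * A = 1\<^sub>m n"
    and B: "B \<in> carrier_mat n n" "B * mat_adjoint B = 1\<^sub>m n" "mat_adjoint B * B = 1\<^sub>m n"
    by (simp_all add: unitary_group_simps)
  have adj: "mat_adjoint A \<in> carrier_mat n n" "mat_adjoint B \<in> carrier_mat n n"
    using A B mat_adjoint_carrier by blast+
  \<comment> \<open>The one-sided result, applied to the adjoints in reverse order, yields the other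
    side, because the adjoint of their product is \<open>A * B\<close>.\<close>
  have "mat_adjoint (A * B) * (A * B) = 1\<^sub>m n"
    using unitary_mult[OF adj(2,1)] A B mat_adjoint_mult[OF adj(2,1)] mat_adjoint_mult[OF A(1) B(1)]
    by (simp add: mat_adjoint_mat_adjoint)
  then show "A \<otimes>\<^bsub>unitary_group n\<^esub> B \<in> carrier (unitary_group n)"
    using A B unitary_mult[OF A(1) B(1) A(2) B(2)] by (simp add: unitary_group_simps)
next
  fix A assume "A \<in> carrier (unitary_group n)"
  then show "\<exists>B\<in>carrier (unitary_group n). B \<otimes>\<^bsub>unitary_group n\<^esub> A = \<one>\<^bsub>unitary_group n\<^esub>"
    by (intro bexI[of _ "mat_adjoint A"]) (auto simp: unitary_group_simps mat_adjoint_mat_adjoint mat_adjoint_carrier)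
qed (auto simp: unitary_group_simps mat_adjoint_one assoc_mult_mat[where ?n\<^sub>1 = n])

lemma perm_mat_inverse:
  assumes p: "p permutes {1..m}"
  shows "perm_mat m p * perm_mat m (inv' p) = (1\<^sub>m m :: 'a::semiring_1 mat)"
    "perm_mat m (inv' p) * perm_mat m p = (1\<^sub>m m :: 'a::semiring_1 mat)"
  using perm_mat_mult[OF permutes_inv[OF p], of p, where 'a = 'a] perm_mat_mult[OF p, of "inv' p", where 'a = 'a]
    permutes_inv_o[OF p] by (simp_all add: perm_mat_id)

lemma mat_adjoint_perm_mat:
  assumes p: "p permutes {1..m}"
  shows "mat_adjoint (perm_mat m p) = (perm_mat m (inv' p) :: complex mat)"
proof (rule eq_matI)
  fix i j assume "i < dim_row (perm_mat m (inv' p) :: complex mat)" "j < dim_col (perm_mat m (inv' p) :: complex mat)"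
  then have ij: "i < m" "j < m" by (simp_all add: perm_mat_def)
  have "p (Suc i) = Suc j \<longleftrightarrow> inv' p (Suc j) = Suc i" using permutes_inv_eq[OF p] by metis
  then show "mat_adjoint (perm_mat m p) $$ (i, j) = (perm_mat m (inv' p) :: complex mat) $$ (i, j)"
    using ij by (simp add: perm_mat_def)
qed (simp_all add: perm_mat_def)

section \<open>The family of general linear groups\<close>

lemma perm_representable_linear_sofic:
  "perm_representable {(GL_group TYPE('k::field) n, rank_dist n) |n. n \<ge> 1}" (is "perm_representable ?\<G>")
\<comment> \<open>The rank bound loses a factor 3, so a displacement of \<open>1 / 2\<close> leaves
  rank distance at least \<open>1 / 6\<close>, which exceeds \<open>1 / 10\<close>.\<close>
proof (rule perm_representableI[of "1/10" "\<lambda>\<eta>. \<eta>"])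
  fix m :: nat assume m: "m \<ge> 2"
  let ?P = "perm_mat m :: _ \<Rightarrow> 'k mat"
  have hom: "?P \<in> hom (sym_group m) (GL_group TYPE('k) m)"
    unfolding hom_sym_group_iff GL_group_simps
    using perm_mat_inverse perm_mat_mult by (metis perm_mat_carrier)
  have ne: "{1..m} \<noteq> {}" using m by simp
  have le: "rank_dist m (?P p) (?P q) \<le> hamming_dist {1..m} p q" for p q
  proof -
    have "real (vec_space.rank m (?P p - ?P q)) / real m \<le> real (card {i \<in> {1..m}. p i \<noteq> q i}) / real m"
      by (intro divide_right_mono of_nat_mono rank_perm_mat_diff_le) simp
    then show ?thesis using hamming_dist_eq[OF _ ne, of p q] by (simp add: rank_dist_def)
  qed
  have ge: "hamming_dist {1..m} p id \<le> 3 * rank_dist m (?P p) (?P id)" if "p permutes {1..m}" for p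
  proof -
    have "real (card {i \<in> {1..m}. p i \<noteq> i}) \<le> real (3 * vec_space.rank m (?P p - ?P id))"
      using rank_perm_mat_diff_one_ge[OF that, where 'a = 'k] by (rule of_nat_mono)
    then have "real (card {i \<in> {1..m}. p i \<noteq> i}) / real m \<le> real (3 * vec_space.rank m (?P p - ?P id)) / real m"
      by (rule divide_right_mono) simp
    then show ?thesis using hamming_dist_eq[OF _ ne, of p id] by (simp add: rank_dist_def)
  qed
  show "\<exists>G d \<iota>. (G, d) \<in> ?\<G> \<and> \<iota> \<in> hom (sym_group m) G \<and> \<iota> id = \<one>\<^bsub>G\<^esub> \<and>
     (\<forall>p q. p permutes {1..m} \<and> q permutes {1..m} \<longrightarrow>
        (\<forall>\<eta>>0. hamming_dist {1..m} p q < \<eta> \<longrightarrow> d (\<iota> p) (\<iota> q) < \<eta>) \<and>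
        (hamming_dist {1..m} p id \<ge> 1 / 2 \<longrightarrow> d (\<iota> p) (\<iota> id) > 1/10))"
  proof (intro exI conjI allI impI)
    show "(GL_group TYPE('k) m, rank_dist m) \<in> ?\<G>" using m by auto
    show "?P \<in> hom (sym_group m) (GL_group TYPE('k) m)" by (rule hom)
    show "?P id = \<one>\<^bsub>GL_group TYPE('k) m\<^esub>" by (simp add: GL_group_simps perm_mat_id)
    fix p q assume pq: "p permutes {1..m} \<and> q permutes {1..m}"
    show "rank_dist m (?P p) (?P q) < \<eta>" if "hamming_dist {1..m} p q < \<eta>" for \<eta>
      using le[of p q] that by simp
    show "1 / 10 < rank_dist m (?P p) (?P id)" if "hamming_dist {1..m} p id \<ge> 1 / 2"
      using ge[of p] pq that by simp
  qed
qed simp_all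

lemma product_closed_linear_sofic:
  "product_closed {(GL_group TYPE('k::field) n, rank_dist n) |n. n \<ge> 1}" (is "product_closed ?\<G>")
  unfolding product_closed_def
\<comment> \<open>The block sum realises the average of the two rank metrics, so half of each is
  kept.\<close>
proof (intro exI[of _ "1/2"] conjI allI impI)
  fix G\<^sub>1 G\<^sub>2 :: "'k mat monoid" and d\<^sub>1 d\<^sub>2
  assume "(G\<^sub>1, d\<^sub>1) \<in> ?\<G> \<and> (G\<^sub>2, d\<^sub>2) \<in> ?\<G>"
  then obtain n m where nm: "n \<ge> 1" "m \<ge> 1" and G: "G\<^sub>1 = GL_group TYPE('k) n" "d\<^sub>1 = rank_dist n"
    "G\<^sub>2 = GL_group TYPE('k) m" "d\<^sub>2 = rank_dist m" by auto
  let ?N = "2 * n * m"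
  define \<iota> :: "'k mat \<times> 'k mat \<Rightarrow> 'k mat" where "\<iota> = (\<lambda>(A, B). block_sum n m A B)"
  have hom: "\<iota> \<in> hom (G\<^sub>1 \<times>\<times> G\<^sub>2) (GL_group TYPE('k) ?N)"
  proof (rule homI)
    fix x assume "x \<in> carrier (G\<^sub>1 \<times>\<times> G\<^sub>2)"
    then obtain A B A' B' where x: "x = (A, B)" and A: "A \<in> carrier_mat n n" and B: "B \<in> carrier_mat m m"
      and A': "A' \<in> carrier_mat n n" "A' * A = 1\<^sub>m n" "A * A' = 1\<^sub>m n"
      and B': "B' \<in> carrier_mat m m" "B' * B = 1\<^sub>m m" "B * B' = 1\<^sub>m m"
      by (auto simp: G GL_group_simps)
    show "\<iota> x \<in> carrier (GL_group TYPE('k) ?N)"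
      unfolding GL_group_simps \<iota>_def x prod.case
      using block_sum_carrier[OF A B] block_sum_carrier[OF A'(1) B'(1)]
        block_sum_mult[OF A B A'(1) B'(1)] block_sum_mult[OF A'(1) B'(1) A B]
      by (intro conjI bexI[of _ "block_sum n m A' B'"]) (simp_all only: A' B' block_sum_one)
    fix y assume "y \<in> carrier (G\<^sub>1 \<times>\<times> G\<^sub>2)"
    then obtain C D where y: "y = (C, D)" "C \<in> carrier_mat n n" "D \<in> carrier_mat m m"
      by (auto simp: G GL_group_simps)
    show "\<iota> (x \<otimes>\<^bsub>G\<^sub>1 \<times>\<times> G\<^sub>2\<^esub> y) = \<iota> x \<otimes>\<^bsub>GL_group TYPE('k) ?N\<^esub> \<iota> y"
      by (simp add: x y(1) G GL_group_simps \<iota>_def block_sum_mult[OF A B y(2,3)])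
  qed
  have dist: "rank_dist ?N (\<iota> (A, B)) (\<iota> (C, D)) = (rank_dist n A C + rank_dist m B D) / 2"
    if "A \<in> carrier_mat n n" "C \<in> carrier_mat n n" "B \<in> carrier_mat m m" "D \<in> carrier_mat m m" for A B C D
  proof -
    have "A - C \<in> carrier_mat n n" "B - D \<in> carrier_mat m m" using that by (auto intro: minus_carrier_mat)
    then have "rank_dist ?N (\<iota> (A, B)) (\<iota> (C, D)) =
        real (m * vec_space.rank n (A - C) + n * vec_space.rank m (B - D)) / real ?N"
      unfolding rank_dist_def \<iota>_def prod.case block_sum_minus[OF that(1,3,2,4)] by (simp only: rank_block_sum)
    then show ?thesis using nm by (simp add: rank_dist_def field_simps)
  qed
  have nonneg: "0 \<le> rank_dist k A C" for k and A C :: "'k mat" by (simp add: rank_dist_def)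
  show "\<exists>G d \<iota>. (G, d) \<in> ?\<G> \<and> \<iota> \<in> hom (G\<^sub>1 \<times>\<times> G\<^sub>2) G \<and>
       (\<forall>x\<^sub>1\<in>carrier G\<^sub>1. \<forall>y\<^sub>1\<in>carrier G\<^sub>1. \<forall>x\<^sub>2\<in>carrier G\<^sub>2. \<forall>y\<^sub>2\<in>carrier G\<^sub>2.
          d (\<iota> (x\<^sub>1, x\<^sub>2)) (\<iota> (y\<^sub>1, y\<^sub>2)) \<le> d\<^sub>1 x\<^sub>1 y\<^sub>1 + d\<^sub>2 x\<^sub>2 y\<^sub>2 \<and>
          1/2 * d\<^sub>1 x\<^sub>1 y\<^sub>1 \<le> d (\<iota> (x\<^sub>1, x\<^sub>2)) (\<iota> (y\<^sub>1, y\<^sub>2)) \<and>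
          1/2 * d\<^sub>2 x\<^sub>2 y\<^sub>2 \<le> d (\<iota> (x\<^sub>1, x\<^sub>2)) (\<iota> (y\<^sub>1, y\<^sub>2)))"
  proof (intro exI conjI ballI)
    show "(GL_group TYPE('k) ?N, rank_dist ?N) \<in> ?\<G>" using nm by auto
    show "\<iota> \<in> hom (G\<^sub>1 \<times>\<times> G\<^sub>2) (GL_group TYPE('k) ?N)" by (rule hom)
    fix A C B D assume "A \<in> carrier G\<^sub>1" "C \<in> carrier G\<^sub>1" "B \<in> carrier G\<^sub>2" "D \<in> carrier G\<^sub>2"
    then have *: "rank_dist ?N (\<iota> (A, B)) (\<iota> (C, D)) = (rank_dist n A C + rank_dist m B D) / 2"
      by (intro dist) (simp_all add: G GL_group_simps)
    show "rank_dist ?N (\<iota> (A, B)) (\<iota> (C, D)) \<le> d\<^sub>1 A C + d\<^sub>2 B D"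
      "1/2 * d\<^sub>1 A C \<le> rank_dist ?N (\<iota> (A, B)) (\<iota> (C, D))"
      "1/2 * d\<^sub>2 B D \<le> rank_dist ?N (\<iota> (A, B)) (\<iota> (C, D))"
      unfolding * G using nonneg[of n A C] nonneg[of m B D] by simp_all
  qed
qed simp

section \<open>The family of unitary groups\<close>

definition frobenius_square :: "complex mat \<Rightarrow> real" where
  "frobenius_square A = Re (mat_trace (A * mat_adjoint A))"

lemma hs_dist_eq: "hs_dist n A B = sqrt (frobenius_square (A - B) / real n)"
  by (simp add: hs_dist_def frobenius_square_def)

text \<open>The entrywise form shows nonnegativity and, after exchanging the sums, allows evaluation
  column by column.\<close>

lemma frobenius_square_eq:
  assumes "A \<in> carrier_mat n m"
  shows "frobenius_square A = (\<Sum>i<n. \<Sum>j<m. (cmod (A $$ (i, j)))\<^sup>2)"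
proof -
  have "mat_trace (A * mat_adjoint A) = (\<Sum>i<n. \<Sum>j<m. A $$ (i, j) * cnj (A $$ (i, j)))"
    using assms by (auto simp: mat_trace_def scalar_prod_def atLeast0LessThan intro!: sum.cong)
  also have "\<dots> = (\<Sum>i<n. \<Sum>j<m. complex_of_real ((cmod (A $$ (i, j)))\<^sup>2))"
    by (simp only: complex_norm_square)
  finally show ?thesis by (simp add: frobenius_square_def)
qed

text \<open>A column at which \<open>p\<close> and \<open>q\<close> disagree has the nonzero entries
  1 and -1 in different rows and contributes 2; all other columns vanish.\<close>

lemma frobenius_square_perm_mat_diff:
  assumes p: "p permutes {1..m}" and q: "q permutes {1..m}"
  shows "frobenius_square (perm_mat m p - perm_mat m q) = 2 * real (card {i \<in> {1..m}. p i \<noteq> q i})"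
proof -
  let ?D = "perm_mat m p - perm_mat m q :: complex mat" and ?J = "{j. j < m \<and> p (Suc j) \<noteq> q (Suc j)}"
  have col: "(\<Sum>i<m. (cmod (?D $$ (i, j)))\<^sup>2) = (if p (Suc j) \<noteq> q (Suc j) then 2 else 0)" if j: "j < m" for j
  proof -
    obtain k where k: "k < m" "p (Suc j) = Suc k" using permutes_Suc_image[OF p j] .
    obtain l where l: "l < m" "q (Suc j) = Suc l" using permutes_Suc_image[OF q j] .
    have entry: "?D $$ (i, j) = (if i = k then 1 else 0) - (if i = l then 1 else 0)" if "i < m" for i
      using that j k l by (auto simp: perm_mat_def)
    show ?thesis
    proof (cases "k = l")
      case True
      then have "(\<Sum>i<m. (cmod (?D $$ (i, j)))\<^sup>2) = 0" by (intro sum.neutral) (simp add: entry)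
      then show ?thesis using True k l by simp
    next
      case False
      have "(\<Sum>i<m. (cmod (?D $$ (i, j)))\<^sup>2) = (\<Sum>i<m. (if i = k then 1 else 0) + (if i = l then 1 else 0))"
        by (rule sum.cong) (use False in \<open>auto simp: entry\<close>)
      also have "\<dots> = 2" using k l by (simp add: sum.distrib)
      finally show ?thesis using False k l by simp
    qed
  qed
  have "?D \<in> carrier_mat m m" by (rule minus_carrier_mat[OF perm_mat_carrier])
  then have "frobenius_square ?D = (\<Sum>j<m. \<Sum>i<m. (cmod (?D $$ (i, j)))\<^sup>2)"
    by (subst sum.swap) (rule frobenius_square_eq)
  also have "\<dots> = (\<Sum>j<m. if p (Suc j) \<noteq> q (Suc j) then 2 else 0)"
    by (rule sum.cong) (simp_all add: col)
  also have "\<dots> = (\<Sum>j\<in>?J. 2)"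
    by (rule sum.mono_neutral_cong_right) auto
  also have "\<dots> = 2 * real (card {i \<in> {1..m}. p i \<noteq> q i})" using card_moved_Suc[of m p q] by simp
  finally show ?thesis .
qed

lemma perm_representable_hyperlinear:
  "perm_representable {(unitary_group n, hs_dist n) |n. n \<ge> 1}" (is "perm_representable ?\<G>")
\<comment> \<open>The distance here is the square root of twice the Hamming distance. This explains
  the modulus \<open>\<eta>\<^sup>2 / 2\<close>; a displacement of \<open>1 / 2\<close> becomes a
  distance of at least 1.\<close>
proof (rule perm_representableI[of "1/2" "\<lambda>\<eta>. \<eta>\<^sup>2 / 2"])
  fix m :: nat assume m: "m \<ge> 2"
  let ?P = "perm_mat m :: _ \<Rightarrow> complex mat"
  have hom: "?P \<in> hom (sym_group m) (unitary_group m)"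
    unfolding hom_sym_group_iff unitary_group_simps
    by (auto simp: perm_mat_inverse mat_adjoint_perm_mat perm_mat_mult)
  have ne: "{1..m} \<noteq> {}" using m by simp
  have dist: "hs_dist m (?P p) (?P q) = sqrt (2 * hamming_dist {1..m} p q)"
    if "p permutes {1..m}" "q permutes {1..m}" for p q
    unfolding hs_dist_eq frobenius_square_perm_mat_diff[OF that] hamming_dist_eq[OF finite_atLeastAtMost ne] by simp
  show "\<exists>G d \<iota>. (G, d) \<in> ?\<G> \<and> \<iota> \<in> hom (sym_group m) G \<and> \<iota> id = \<one>\<^bsub>G\<^esub> \<and>
     (\<forall>p q. p permutes {1..m} \<and> q permutes {1..m} \<longrightarrow>
        (\<forall>\<eta>>0. hamming_dist {1..m} p q < \<eta>\<^sup>2 / 2 \<longrightarrow> d (\<iota> p) (\<iota> q) < \<eta>) \<and>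
        (hamming_dist {1..m} p id \<ge> 1 / 2 \<longrightarrow> d (\<iota> p) (\<iota> id) > 1/2))"
  proof (intro exI conjI allI impI)
    show "(unitary_group m, hs_dist m) \<in> ?\<G>" using m by auto
    show "?P \<in> hom (sym_group m) (unitary_group m)" by (rule hom)
    show "?P id = \<one>\<^bsub>unitary_group m\<^esub>" by (simp add: unitary_group_simps perm_mat_id)
    fix p q assume pq: "p permutes {1..m} \<and> q permutes {1..m}"
    show "hs_dist m (?P p) (?P q) < \<eta>" if "\<eta> > 0" "hamming_dist {1..m} p q < \<eta>\<^sup>2 / 2" for \<eta>
    proof -
      have "2 * hamming_dist {1..m} p q < \<eta>\<^sup>2" using that(2) by simp
      then show ?thesis using dist[of p q] pq that(1) by (simp add: real_less_lsqrt)
    qed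
    show "1 / 2 < hs_dist m (?P p) (?P id)" if "hamming_dist {1..m} p id \<ge> 1 / 2"
    proof -
      have "1 \<le> sqrt (2 * hamming_dist {1..m} p id)" using that by (simp add: real_le_rsqrt)
      then show ?thesis unfolding dist[OF conjunct1[OF pq] permutes_id] by linarith
    qed
  qed
qed simp_all

text \<open>Block sums average the squares of Hilbert-Schmidt distances, so the quadratic mean
  appears. The lower factor \<open>1 / 2\<close> is weaker than one over the square root of 2 but
  keeps the constant rational.\<close>

lemma sqrt_mean_square_bounds:
  fixes a b :: real
  assumes "0 \<le> a" "0 \<le> b"
  shows "sqrt ((a\<^sup>2 + b\<^sup>2) / 2) \<le> a + b" "a / 2 \<le> sqrt ((a\<^sup>2 + b\<^sup>2) / 2)" "b / 2 \<le> sqrt ((a\<^sup>2 + b\<^sup>2) / 2)"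
proof -
  have "0 \<le> a * b" "0 \<le> a\<^sup>2" "0 \<le> b\<^sup>2" using assms by simp_all
  then show "sqrt ((a\<^sup>2 + b\<^sup>2) / 2) \<le> a + b" using assms by (intro real_le_lsqrt) (simp_all add: power2_sum)
  show "a / 2 \<le> sqrt ((a\<^sup>2 + b\<^sup>2) / 2)" "b / 2 \<le> sqrt ((a\<^sup>2 + b\<^sup>2) / 2)"
    using \<open>0 \<le> a\<^sup>2\<close> \<open>0 \<le> b\<^sup>2\<close> by (intro real_le_rsqrt; simp add: power_divide)+
qed

lemma product_closed_hyperlinear:
  "product_closed {(unitary_group n, hs_dist n) |n. n \<ge> 1}" (is "product_closed ?\<G>")
  unfolding product_closed_def
proof (intro exI[of _ "1/2"] conjI allI impI)
  fix G\<^sub>1 G\<^sub>2 :: "complex mat monoid" and d\<^sub>1 d\<^sub>2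
  assume "(G\<^sub>1, d\<^sub>1) \<in> ?\<G> \<and> (G\<^sub>2, d\<^sub>2) \<in> ?\<G>"
  then obtain n m where nm: "n \<ge> 1" "m \<ge> 1" and G: "G\<^sub>1 = unitary_group n" "d\<^sub>1 = hs_dist n"
    "G\<^sub>2 = unitary_group m" "d\<^sub>2 = hs_dist m" by auto
  let ?N = "2 * n * m"
  define \<iota> :: "complex mat \<times> complex mat \<Rightarrow> complex mat" where "\<iota> = (\<lambda>(A, B). block_sum n m A B)"
  have hom: "\<iota> \<in> hom (G\<^sub>1 \<times>\<times> G\<^sub>2) (unitary_group ?N)"
  proof (rule homI)
    fix x assume "x \<in> carrier (G\<^sub>1 \<times>\<times> G\<^sub>2)"
    then obtain A B where x: "x = (A, B)"
      and A: "A \<in> carrier_mat n n" "A * mat_adjoint A = 1\<^sub>m n" "mat_adjoint A * A = 1\<^sub>m n"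
      and B: "B \<in> carrier_mat m m" "B * mat_adjoint B = 1\<^sub>m m" "mat_adjoint B * B = 1\<^sub>m m"
      by (auto simp: G unitary_group_simps)
    note adj = mat_adjoint_carrier[OF A(1)] mat_adjoint_carrier[OF B(1)]
    show "\<iota> x \<in> carrier (unitary_group ?N)"
      unfolding unitary_group_simps \<iota>_def x prod.case block_sum_adjoint
        block_sum_mult[OF A(1) B(1) adj] block_sum_mult[OF adj A(1) B(1)] A(2,3) B(2,3) block_sum_one
      using block_sum_carrier[OF A(1) B(1)] by simp
    fix y assume "y \<in> carrier (G\<^sub>1 \<times>\<times> G\<^sub>2)"
    then obtain C D where y: "y = (C, D)" "C \<in> carrier_mat n n" "D \<in> carrier_mat m m"
      by (auto simp: G unitary_group_simps)
    show "\<iota> (x \<otimes>\<^bsub>G\<^sub>1 \<times>\<times> G\<^sub>2\<^esub> y) = \<iota> x \<otimes>\<^bsub>unitary_group ?N\<^esub> \<iota> y"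
      by (simp add: x y(1) G unitary_group_simps \<iota>_def block_sum_mult[OF A(1) B(1) y(2,3)])
  qed
  have nonneg: "0 \<le> frobenius_square A" if "A \<in> carrier_mat k k" for A k
    unfolding frobenius_square_eq[OF that] by (intro sum_nonneg) simp
  \<comment> \<open>Block sums respect products and adjoints, so the claim reduces to the trace of a
    block sum.\<close>
  have frob: "frobenius_square (block_sum n m A B) = m * frobenius_square A + n * frobenius_square B"
    if A: "A \<in> carrier_mat n n" and B: "B \<in> carrier_mat m m" for A B
  proof -
    note adj = mat_adjoint_carrier[OF A] mat_adjoint_carrier[OF B]
    have "A * mat_adjoint A \<in> carrier_mat n n" "B * mat_adjoint B \<in> carrier_mat m m"
      using A B adj by auto
    then show ?thesis
      unfolding frobenius_square_def block_sum_adjoint block_sum_mult[OF A B adj]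
      by (simp add: mat_trace_block_sum)
  qed
  have dist: "hs_dist ?N (\<iota> (A, B)) (\<iota> (C, D)) = sqrt (((hs_dist n A C)\<^sup>2 + (hs_dist m B D)\<^sup>2) / 2) \<and>
      0 \<le> hs_dist n A C \<and> 0 \<le> hs_dist m B D"
    if "A \<in> carrier_mat n n" "C \<in> carrier_mat n n" "B \<in> carrier_mat m m" "D \<in> carrier_mat m m" for A B C D
  proof -
    have c: "A - C \<in> carrier_mat n n" "B - D \<in> carrier_mat m m" using that by (auto intro: minus_carrier_mat)
    have "hs_dist ?N (\<iota> (A, B)) (\<iota> (C, D)) =
        sqrt ((m * frobenius_square (A - C) + n * frobenius_square (B - D)) / real ?N)"
      unfolding hs_dist_eq \<iota>_def prod.case block_sum_minus[OF that(1,3,2,4)] frob[OF c] ..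
    also have "(m * frobenius_square (A - C) + n * frobenius_square (B - D)) / real ?N =
        (frobenius_square (A - C) / real n + frobenius_square (B - D) / real m) / 2"
      using nm by (simp add: field_simps)
    finally show ?thesis using nonneg[OF c(1)] nonneg[OF c(2)] by (simp add: hs_dist_eq)
  qed
  show "\<exists>G d \<iota>. (G, d) \<in> ?\<G> \<and> \<iota> \<in> hom (G\<^sub>1 \<times>\<times> G\<^sub>2) G \<and>
       (\<forall>x\<^sub>1\<in>carrier G\<^sub>1. \<forall>y\<^sub>1\<in>carrier G\<^sub>1. \<forall>x\<^sub>2\<in>carrier G\<^sub>2. \<forall>y\<^sub>2\<in>carrier G\<^sub>2.
          d (\<iota> (x\<^sub>1, x\<^sub>2)) (\<iota> (y\<^sub>1, y\<^sub>2)) \<le> d\<^sub>1 x\<^sub>1 y\<^sub>1 + d\<^sub>2 x\<^sub>2 y\<^sub>2 \<and>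
          1/2 * d\<^sub>1 x\<^sub>1 y\<^sub>1 \<le> d (\<iota> (x\<^sub>1, x\<^sub>2)) (\<iota> (y\<^sub>1, y\<^sub>2)) \<and>
          1/2 * d\<^sub>2 x\<^sub>2 y\<^sub>2 \<le> d (\<iota> (x\<^sub>1, x\<^sub>2)) (\<iota> (y\<^sub>1, y\<^sub>2)))"
  proof (intro exI conjI ballI)
    show "(unitary_group ?N, hs_dist ?N) \<in> ?\<G>" using nm by auto
    show "\<iota> \<in> hom (G\<^sub>1 \<times>\<times> G\<^sub>2) (unitary_group ?N)" by (rule hom)
    fix A C B D assume "A \<in> carrier G\<^sub>1" "C \<in> carrier G\<^sub>1" "B \<in> carrier G\<^sub>2" "D \<in> carrier G\<^sub>2"
    then have *: "hs_dist ?N (\<iota> (A, B)) (\<iota> (C, D)) = sqrt (((hs_dist n A C)\<^sup>2 + (hs_dist m B D)\<^sup>2) / 2) \<and>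
      0 \<le> hs_dist n A C \<and> 0 \<le> hs_dist m B D"
      by (intro dist) (simp_all add: G unitary_group_simps)
    show "hs_dist ?N (\<iota> (A, B)) (\<iota> (C, D)) \<le> d\<^sub>1 A C + d\<^sub>2 B D"
      "1/2 * d\<^sub>1 A C \<le> hs_dist ?N (\<iota> (A, B)) (\<iota> (C, D))"
      "1/2 * d\<^sub>2 B D \<le> hs_dist ?N (\<iota> (A, B)) (\<iota> (C, D))"
      using * sqrt_mean_square_bounds[of "hs_dist n A C" "hs_dist m B D"] by (simp_all add: G)
  qed
qed simp

section \<open>Application to the four families\<close>

lemma approximable_enrichments:
  fixes \<Gamma> :: "('g, 'm) monoid_scheme" and X :: "'x set" and \<alpha> :: "'g \<Rightarrow> 'x \<Rightarrow> 'x"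
  assumes "group_action \<Gamma> X \<alpha>" "sofic_action \<Gamma> X \<alpha>" "\<And>G d. (G, d) \<in> \<G> \<Longrightarrow> group G"
    "perm_representable \<G>" "product_closed \<G>" "approximable \<G> \<Gamma>"
  shows "approximable \<G> (symmetric_enrichment \<Gamma> X \<alpha>) \<and> approximable \<G> (alternating_enrichment \<Gamma> X \<alpha>)"
proof -
  have sym: "approximable \<G> (symmetric_enrichment \<Gamma> X \<alpha>)"
    by (rule approximable_symmetric_enrichment[OF assms(1,2,3,6,4,5)])
  then show ?thesis
    unfolding alternating_enrichment_eq
    using approximable_subgroup[OF sym subgroup_alternating_enrichment[OF assms(1)]] by blast
qed

theorem theorem6p1:
  fixes \<Gamma> :: "('g, 'm) monoid_scheme" and X :: "'x set" and \<alpha> :: "'g \<Rightarrow> 'x \<Rightarrow> 'x"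
  assumes "group_action \<Gamma> X \<alpha>"
    and "sofic_action \<Gamma> X \<alpha>"
  shows "(sofic_group \<Gamma> \<longrightarrow>
            sofic_group (symmetric_enrichment \<Gamma> X \<alpha>) \<and>
            sofic_group (alternating_enrichment \<Gamma> X \<alpha>)) \<and>
         (linear_sofic_group TYPE('k::field) \<Gamma> \<longrightarrow>
            linear_sofic_group TYPE('k) (symmetric_enrichment \<Gamma> X \<alpha>) \<and>
            linear_sofic_group TYPE('k) (alternating_enrichment \<Gamma> X \<alpha>)) \<and>
         (hyperlinear_group \<Gamma> \<longrightarrow>
            hyperlinear_group (symmetric_enrichment \<Gamma> X \<alpha>) \<and>
            hyperlinear_group (alternating_enrichment \<Gamma> X \<alpha>)) \<and>
         (weakly_sofic_group \<Gamma> \<longrightarrow>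
            weakly_sofic_group (symmetric_enrichment \<Gamma> X \<alpha>) \<and>
            weakly_sofic_group (alternating_enrichment \<Gamma> X \<alpha>))"
proof (intro conjI[of "_ \<longrightarrow> _"] impI)
  assume "sofic_group \<Gamma>"
  then show "sofic_group (symmetric_enrichment \<Gamma> X \<alpha>) \<and> sofic_group (alternating_enrichment \<Gamma> X \<alpha>)"
    unfolding sofic_group_def
    by (rule approximable_enrichments[OF assms _ perm_representable_sofic product_closed_sofic, rotated])
      (use sym_group_is_group in blast)
next
  assume "linear_sofic_group TYPE('k) \<Gamma>"
  then show "linear_sofic_group TYPE('k) (symmetric_enrichment \<Gamma> X \<alpha>) \<and>
      linear_sofic_group TYPE('k) (alternating_enrichment \<Gamma> X \<alpha>)"
    unfolding linear_sofic_group_def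
    by (rule approximable_enrichments[OF assms _ perm_representable_linear_sofic product_closed_linear_sofic, rotated])
      (use group_GL_group in blast)
next
  assume "hyperlinear_group \<Gamma>"
  then show "hyperlinear_group (symmetric_enrichment \<Gamma> X \<alpha>) \<and> hyperlinear_group (alternating_enrichment \<Gamma> X \<alpha>)"
    unfolding hyperlinear_group_def
    by (rule approximable_enrichments[OF assms _ perm_representable_hyperlinear product_closed_hyperlinear, rotated])
      (use group_unitary_group in blast)
next
  assume "weakly_sofic_group \<Gamma>"
  then show "weakly_sofic_group (symmetric_enrichment \<Gamma> X \<alpha>) \<and> weakly_sofic_group (alternating_enrichment \<Gamma> X \<alpha>)"
    \<comment> \<open>Folding the predicate identifies the family with the one for which both
      closure conditions were established.\<close>
    unfolding weakly_sofic_group_def normalized_metric_group_def[symmetric]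
    by (rule approximable_enrichments[OF assms _ perm_representable_weakly_sofic product_closed_weakly_sofic, rotated])
      (simp add: normalized_metric_group_def)
qed

end
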